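(* Let $T\in(0,\infty)$, $\alpha>0$, $\nu:=\alpha-1/2$, let $0<z^{(\nu)}_1<z^{(\nu)}_2<\cdots$ be the positive zeros of the Bessel function $J_\nu$ of the first kind, and let $(X^{(\alpha)}_t)_{t\in[0,T]}$ be the $\alpha$-Wiener bridge on $[0,T]$. Then for all $x>0$, $$\mathsf{P}\left(\int_0^T(X^{(\alpha)}_t)^2\,dt>x\right)=\frac{2^{1-\nu/2}}{\pi\sqrt{\Gamma(\nu+1)}}\sum_{k=1}^\infty(-1)^{k+1}\int_{z_{2k-1}^{(\nu)}}^{z_{2k}^{(\nu)}}u^{\nu/2-1}\,\frac{e^{-xu^2/(2T^2)}}{\sqrt{|J_\nu(u)|}}\,du.$$
   Context: Let $(B_t)_{t\ge 0}$ be a standard Wiener process. For $\alpha>0$ and $T\in(0,\infty)$ the $\alpha$-Wiener bridge on $[0,T]$ is the process $X_t^{(\alpha)}=\int_0^t\big(\frac{T-t}{T-s}\big)^\alpha\,dB_s$, $t\in[0,T)$, i.e. the unique strong solution of $dX_t^{(\alpha)}=-\frac{\alpha}{T-t}X_t^{(\alpha)}\,dt+dB_t$, $X_0^{(\alpha)}=0$, extended by $X_T^{(\alpha)}=0$ (the extension is almost surely continuous on $[0,T]$). The Bessel function of the first kind of order $\nu>-1$ is $J_\nu(x)=\sum_{k=0}^\infty\frac{(-1)^k}{k!\,\Gamma(k+\nu+1)}\big(\frac{x}{2}\big)^{2k+\nu}$, $x>0$; it has infinitely many positive zeros, all simple, listed increasingly as $z^{(\nu)}_k$, $k\in\mathbb{N}=\{1,2,\dots\}$.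 *)

theory Defs
  imports "HOL-Probability.Probability"
begin

definition standard_wiener_process :: "'a measure \<Rightarrow> (real \<Rightarrow> 'a \<Rightarrow> real) \<Rightarrow> bool" where
  "standard_wiener_process M B \<longleftrightarrow>
     prob_space M \<and>
     (\<forall>t\<ge>0. B t \<in> borel_measurable M) \<and>
     (AE \<omega> in M. B 0 \<omega> = 0) \<and>
     (\<forall>(n::nat) (t::nat \<Rightarrow> real). 0 \<le> t 0 \<and> strict_mono_on {..n} t \<longrightarrow>
        prob_space.indep_vars M (\<lambda>_. borel) (\<lambda>i \<omega>. B (t (Suc i)) \<omega> - B (t i) \<omega>) {..<n}) \<and>
     (\<forall>s t. 0 \<le> s \<and> s < t \<longrightarrow>
        distributed M lborel (\<lambda>\<omega>. B t \<omega> - B s \<omega>) (normal_density 0 (sqrt (t - s)))) \<and>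
     (AE \<omega> in M. continuous_on {0..} (\<lambda>t. B t \<omega>))"

definition step_function :: "nat \<Rightarrow> (nat \<Rightarrow> real) \<Rightarrow> (nat \<Rightarrow> real) \<Rightarrow> real \<Rightarrow> real" where
  "step_function n p c s = (\<Sum>i<n. c i * indicator {p i<..p (Suc i)} s)"

definition step_integral ::
    "(real \<Rightarrow> 'a \<Rightarrow> real) \<Rightarrow> nat \<Rightarrow> (nat \<Rightarrow> real) \<Rightarrow> (nat \<Rightarrow> real) \<Rightarrow> 'a \<Rightarrow> real" where
  "step_integral B n p c \<omega> = (\<Sum>i<n. c i * (B (p (Suc i)) \<omega> - B (p i) \<omega>))"

text \<open>The stochastic integral over \<open>[0,t]\<close> of a deterministic square integrable \<open>f\<close> against \<open>B\<close>:
  the limit in \<open>L\<^sup>2(M)\<close> of the integrals of step functions tending to \<open>f\<close> in \<open>L\<^sup>2[0,t]\<close>. It is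
  determined only up to null sets, hence a relation: \<open>I\<close> is a version of the integral.\<close>

definition has_wiener_integral ::
    "'a measure \<Rightarrow> (real \<Rightarrow> 'a \<Rightarrow> real) \<Rightarrow> (real \<Rightarrow> real) \<Rightarrow> real \<Rightarrow> ('a \<Rightarrow> real) \<Rightarrow> bool" where
  "has_wiener_integral M B f t I \<longleftrightarrow>
     set_borel_measurable lborel {0..t} f \<and>
     I \<in> borel_measurable M \<and>
     (\<exists>(n :: nat \<Rightarrow> nat) (p :: nat \<Rightarrow> nat \<Rightarrow> real) (c :: nat \<Rightarrow> nat \<Rightarrow> real).
        (\<forall>m. 0 \<le> p m 0 \<and> mono_on {..n m} (p m) \<and> p m (n m) \<le> t) \<and>
        (\<lambda>m. \<integral>\<^sup>+s\<in>{0..t}. ennreal ((f s - step_function (n m) (p m) (c m) s)\<^sup>2) \<partial>lborel)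
           \<longlonglongrightarrow> 0 \<and>
        (\<lambda>m. \<integral>\<^sup>+\<omega>. ennreal ((I \<omega> - step_integral B (n m) (p m) (c m) \<omega>)\<^sup>2) \<partial>M)
           \<longlonglongrightarrow> 0)"

text \<open>Since each \<open>X t\<close> is fixed only up to a null set, path continuity on \<open>[0,T)\<close> selects the usual
  version of the process of stochastic integrals. Continuity at \<open>T\<close> is a theorem and not required.\<close>

definition alpha_wiener_bridge ::
    "'a measure \<Rightarrow> (real \<Rightarrow> 'a \<Rightarrow> real) \<Rightarrow> real \<Rightarrow> real \<Rightarrow> (real \<Rightarrow> 'a \<Rightarrow> real) \<Rightarrow> bool" where
  "alpha_wiener_bridge M B \<alpha> T X \<longleftrightarrow>
     (\<forall>t\<in>{0..<T}. has_wiener_integral M B (\<lambda>s. ((T - t) / (T - s)) powr \<alpha>) t (X t)) \<and>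
     (AE \<omega> in M. continuous_on {0..<T} (\<lambda>t. X t \<omega>)) \<and>
     (AE \<omega> in M. X T \<omega> = 0)"

definition bessel_J :: "real \<Rightarrow> real \<Rightarrow> real" where
  "bessel_J \<nu> x =
     (\<Sum>k. (-1) ^ k / (fact k * Gamma (real k + \<nu> + 1)) * (x / 2) powr (2 * real k + \<nu>))"

end

theory Submission
  imports Defs "HOL-Complex_Analysis.Complex_Analysis"
begin

text \<open>
  The coefficients of $X$ along the eigenfunctions $(T-t)^{1/2} J_\nu(z_k (T-t)/T)$ of its covariance
  are independent centred normal variables with variances $\lambda_k = T^2/z_k^2$. Bessel's inequality
  gives $\sum_k \lambda_k \xi_k^2 \le \int_0^T X^2$, and equality follows by comparing expectations: the
  trace of the covariance is $T^2/(4(\nu+1))$, which is $\sum_k T^2/z_k^2$ by Rayleigh's formula, a consequence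
  of the Hadamard product of $J_\nu$. So completeness of the eigenfunctions is not needed.

  For finitely many variables, a pair $\lambda_{2k-1}\xi_{2k-1}^2 + \lambda_{2k}\xi_{2k}^2$ is a mixture of
  exponential variables whose rates have an arcsine law on $[1/\lambda_{2k-1}, 1/\lambda_{2k}]$, up to the factor
  $1/2$. Partial fractions then give the tail of the sum of $2m$ terms as an alternating sum of $m$ integrals.
  The partial sums increase to $\int_0^T X^2$, and the partial Hadamard products dominate the full one in
  modulus on the intervals of integration, so the limit is taken by dominated convergence. The summable majorant comes from Bessel's
  equation: between large zeros $\sqrt{u}\,|J_\nu(u)|$ is concave, with a maximum of order at least $1/u$.
\<close>

section \<open>The entire function of Bessel\<close>

text \<open>The square of the argument is the natural variable: in it the Bessel function, freed of
  its power factor, is entire of order one half, so the Hadamard product carries no exponential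
  factor, and the zeros are the numbers 1/\<lambda>_k up to the factor T^2. The density that the
  partial fractions produce is an alternating sum and not visibly nonnegative, so the law is
  identified by comparing Laplace transforms at the integers with those of a merely integrable
  function. The partial fractions come from an induction over pairs of zeros: the reciprocal square
  root of a product with interlacing zeros is a signed Stieltjes transform, and the product of two
  such transforms on separated intervals is again a sum of such transforms. This keeps the argument
  on the real line, away from branch cuts. The analytic obstacle on the probabilistic side is the
  end point T, since paths are controlled on [0,T) only. Linear functionals are first taken up to
  some b < T, where paths are bounded; the passage to T rests on the finite mean of the squared
  norm.\<close>

definition bessel_coeff :: "real \<Rightarrow> nat \<Rightarrow> real" where
  "bessel_coeff \<nu> k = (-1) ^ k / (4 ^ k * fact k * pochhammer (\<nu> + 1) k)"

text \<open>Normalised so that $J_\nu(x) = (x/2)^\nu / \Gamma(\nu+1) \cdot \varphi_\nu(x^2)$.\<close>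

definition bessel_phi :: "real \<Rightarrow> 'a::{real_normed_field,banach} \<Rightarrow> 'a" where
  "bessel_phi \<nu> w = (\<Sum>k. of_real (bessel_coeff \<nu> k) * w ^ k)"

lemma bessel_coeff_Suc:
  assumes "-1 < \<nu>"
  shows "real (Suc k) * bessel_coeff \<nu> (Suc k) = - bessel_coeff (\<nu> + 1) k / (4 * (\<nu> + 1))"
proof -
  have "pochhammer (\<nu> + 1) (Suc k) = (\<nu> + 1) * pochhammer (\<nu> + 1 + 1) k"
    by (rule pochhammer_rec)
  moreover have "pochhammer (\<nu> + 1 + 1) k > 0" using assms by (intro pochhammer_pos) auto
  ultimately show ?thesis using assms
    unfolding bessel_coeff_def by (simp add: divide_simps)
qed

text \<open>\<open>fact (2 * k)\<close> is \<open>4 ^ k * fact k * pochhammer (1/2) k\<close>, and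
  \<open>pochhammer\<close> grows with its base. The extremal case \<nu> = -1/2 is the series of cos
  (sqrt w).\<close>

lemma abs_bessel_coeff_le:
  assumes "-1/2 < \<nu>"
  shows "\<bar>bessel_coeff \<nu> k\<bar> \<le> 1 / fact (2 * k)"
proof -
  have "pochhammer (1/2) k \<le> pochhammer (\<nu> + 1) k"
    unfolding pochhammer_prod using assms by (intro prod_mono) auto
  hence "(fact (2 * k) :: real) \<le> 4 ^ k * fact k * pochhammer (\<nu> + 1) k"
    using mult_left_mono[of "pochhammer (1/2) k" "pochhammer (\<nu> + 1) k" "4 ^ k * fact k"]
    unfolding fact_double power_mult by (simp add: mult_ac)
  moreover have "0 < pochhammer (\<nu> + 1) k" using assms by (intro pochhammer_pos) auto
  ultimately show ?thesis unfolding bessel_coeff_def by (simp add: abs_mult divide_simps)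
qed

lemma even_exp_terms:
  fixes s :: real assumes "0 \<le> s"
  shows "summable (\<lambda>k. s ^ (2 * k) / fact (2 * k))" "(\<Sum>k. s ^ (2 * k) / fact (2 * k)) \<le> exp s"
proof -
  have le: "(\<Sum>k<n. s ^ (2 * k) / fact (2 * k)) \<le> exp s" for n
  proof -
    have "(\<Sum>k<n. s ^ (2 * k) / fact (2 * k)) = (\<Sum>j\<in>(*) 2 ` {..<n}. s ^ j / fact j)"
      by (subst sum.reindex) (auto simp: inj_on_def)
    also have "\<dots> \<le> (\<Sum>j. s ^ j / fact j)"
      using summable_exp[of s] assms by (intro sum_le_suminf) (auto simp: field_simps)
    also have "\<dots> = exp s" by (simp add: exp_def divide_inverse mult.commute)
    finally show ?thesis .
  qed
  show "summable (\<lambda>k. s ^ (2 * k) / fact (2 * k))"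
    using le assms by (intro summableI_nonneg_bounded[where x="exp s"]) auto
  thus "(\<Sum>k. s ^ (2 * k) / fact (2 * k)) \<le> exp s" by (intro suminf_le_const le)
qed

lemma norm_bessel_term_le:
  fixes w :: "'a::{real_normed_field,banach}"
  assumes "-1/2 < \<nu>"
  shows "norm (of_real (bessel_coeff \<nu> k) * w ^ k) \<le> sqrt (norm w) ^ (2 * k) / fact (2 * k)"
proof -
  have "sqrt (norm w) ^ (2 * k) = norm w ^ k" by (simp add: power_mult)
  thus ?thesis using mult_right_mono[OF abs_bessel_coeff_le[OF assms, of k], of "norm w ^ k"]
    by (simp add: norm_mult norm_power)
qed

lemma summable_norm_bessel:
  fixes w :: "'a::{real_normed_field,banach}"
  assumes "-1/2 < \<nu>"
  shows "summable (\<lambda>k. norm (of_real (bessel_coeff \<nu> k) * w ^ k))"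
  by (rule summable_comparison_test'[OF even_exp_terms(1)[of "sqrt (norm w)"], of 0])
     (use norm_bessel_term_le[OF assms, of _ w] in auto)

lemma summable_bessel:
  fixes w :: "'a::{real_normed_field,banach}"
  assumes "-1/2 < \<nu>"
  shows "summable (\<lambda>k. of_real (bessel_coeff \<nu> k) * w ^ k)"
  using summable_norm_bessel[OF assms] by (rule summable_norm_cancel)

text \<open>Growth of order one half: the series of moduli is at most cosh (sqrt |w|). The bound has
  exactly the form that \<open>Hadamard_order_half\<close> asks for.\<close>

lemma norm_bessel_phi_le:
  fixes w :: "'a::{real_normed_field,banach}"
  assumes "-1/2 < \<nu>"
  shows "norm (bessel_phi \<nu> w) \<le> exp (sqrt (norm w))"
proof -
  have "norm (bessel_phi \<nu> w) \<le> (\<Sum>k. norm (of_real (bessel_coeff \<nu> k) * w ^ k))"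
    unfolding bessel_phi_def by (rule summable_norm[OF summable_norm_bessel[OF assms]])
  also have "\<dots> \<le> (\<Sum>k. sqrt (norm w) ^ (2 * k) / fact (2 * k))"
    by (intro suminf_le norm_bessel_term_le[OF assms] summable_norm_bessel[OF assms] even_exp_terms) auto
  also have "\<dots> \<le> exp (sqrt (norm w))" by (rule even_exp_terms) auto
  finally show ?thesis .
qed

lemma bessel_phi_0 [simp]: "bessel_phi \<nu> (0::'a::{real_normed_field,banach}) = 1"
  unfolding bessel_phi_def
  by (subst powser_zero[where f="\<lambda>k. of_real (bessel_coeff \<nu> k)"]) (simp add: bessel_coeff_def)

lemma of_real_bessel_phi:
  assumes "-1/2 < \<nu>"
  shows "of_real (bessel_phi \<nu> x) = bessel_phi \<nu> (of_real x :: complex)"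
  unfolding bessel_phi_def
  using summable_of_real_iff summable_bessel[OF assms, of x]
  by (subst suminf_of_real) auto

text \<open>Differentiation raises the order by one, so simplicity of the zeros becomes a statement
  about two neighbouring orders.\<close>

lemma bessel_phi_deriv:
  fixes w :: "'a::{real_normed_field,banach}"
  assumes "-1/2 < \<nu>"
  shows "(bessel_phi \<nu> has_field_derivative - bessel_phi (\<nu> + 1) w / of_real (4 * (\<nu> + 1))) (at w)"
proof -
  have eq: "diffs (\<lambda>k. of_real (bessel_coeff \<nu> k)) n * w ^ n =
      (- 1 / of_real (4 * (\<nu> + 1))) * (of_real (bessel_coeff (\<nu> + 1) n) * w ^ n :: 'a)" for n
  proof -
    have "diffs (\<lambda>k. of_real (bessel_coeff \<nu> k)) n
        = (of_real (real (Suc n) * bessel_coeff \<nu> (Suc n)) :: 'a)"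
      unfolding diffs_def by (simp only: of_real_mult of_real_of_nat_eq)
    also have "\<dots> = (- 1 / of_real (4 * (\<nu> + 1))) * of_real (bessel_coeff (\<nu> + 1) n)"
      using assms by (subst bessel_coeff_Suc) (auto simp only: of_real_mult of_real_divide of_real_minus minus_divide_left mult_minus_left mult_1_left times_divide_eq_left)
    finally show ?thesis by (simp only: mult.assoc)
  qed
  have "((\<lambda>x. \<Sum>n. of_real (bessel_coeff \<nu> n) * x^n) has_field_derivative
      (\<Sum>n. diffs (\<lambda>k. of_real (bessel_coeff \<nu> k)) n * w ^ n)) (at w)"
    by (rule termdiffs_strong_converges_everywhere[OF summable_bessel[OF assms]])
  moreover have "(\<Sum>n. diffs (\<lambda>k. of_real (bessel_coeff \<nu> k)) n * w ^ n)
      = - bessel_phi (\<nu> + 1) w / of_real (4 * (\<nu> + 1))"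
    unfolding eq bessel_phi_def using assms
    by (subst suminf_mult) (auto intro: summable_bessel)
  ultimately show ?thesis unfolding bessel_phi_def[abs_def] by simp
qed

lemma bessel_phi_deriv' [derivative_intros]:
  assumes "-1/2 < \<nu>" "(g has_field_derivative g') (at x within S)"
  shows "((\<lambda>x. bessel_phi \<nu> (g x)) has_field_derivative
     - bessel_phi (\<nu> + 1) (g x) / of_real (4 * (\<nu> + 1)) * g') (at x within S)"
  using DERIV_chain2[OF bessel_phi_deriv[OF assms(1)] assms(2)] .

lemma continuous_on_bessel_phi [continuous_intros]:
  assumes "-1/2 < \<nu>" "continuous_on S g"
  shows "continuous_on S (\<lambda>x. bessel_phi \<nu> (g x :: 'a::{real_normed_field,banach}))"
proof -
  have "continuous_on UNIV (bessel_phi \<nu> :: 'a \<Rightarrow> 'a)"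
    by (intro continuous_at_imp_continuous_on ballI DERIV_isCont[OF bessel_phi_deriv[OF assms(1)]])
  thus ?thesis using assms(2) continuous_on_compose2 by blast
qed

text \<open>This is J_\<nu>(x) + J_{\<nu>+2}(x) = (2 (\<nu>+1) / x) J_{\<nu>+1}(x) in the variable w
  = x^2. The constant terms of the two series on the left cancel, which produces the factor
  w.\<close>

lemma bessel_phi_recurrence:
  fixes w :: "'a::{real_normed_field,banach}"
  assumes "-1/2 < \<nu>"
  shows "bessel_phi (\<nu> + 1) w - bessel_phi \<nu> w = w / of_real (4 * (\<nu> + 1) * (\<nu> + 2)) * bessel_phi (\<nu> + 2) w"
proof -
  let ?c = "\<lambda>k. bessel_coeff (\<nu> + 1) k - bessel_coeff \<nu> k"
  have c0: "?c 0 = 0" by (simp add: bessel_coeff_def)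
  have cS: "?c (Suc k) = bessel_coeff (\<nu> + 2) k / (4 * (\<nu> + 1) * (\<nu> + 2))" for k
  proof -
    have p1: "pochhammer (\<nu> + 1) (Suc k) = (\<nu> + 1) * pochhammer (\<nu> + 2) k"
      using pochhammer_rec[of "\<nu> + 1" k] by (simp add: add_ac)
    have p2: "pochhammer (\<nu> + 2) (Suc k) = pochhammer (\<nu> + 2) k * (\<nu> + 2 + k)"
      by (rule pochhammer_Suc)
    have p3: "pochhammer (\<nu> + 2) (Suc k) = (\<nu> + 2) * pochhammer (\<nu> + 3) k"
      using pochhammer_rec[of "\<nu> + 2" k] by (simp add: add_ac)
    have pos: "pochhammer (\<nu> + 2) k > 0" "pochhammer (\<nu> + 3) k > 0"
      using assms by (auto intro!: pochhammer_pos)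
    have p4: "pochhammer (\<nu> + 3) k = pochhammer (\<nu> + 2) k * (\<nu> + 2 + k) / (\<nu> + 2)"
      using p2 p3 assms by (simp add: field_simps)
    have e: "\<nu> + 1 + 1 = \<nu> + 2" "\<nu> + 2 + 1 = \<nu> + 3" by auto
    have f: "fact (Suc k) = real (Suc k) * fact k" by simp
    show ?thesis unfolding bessel_coeff_def e p1 p2 p4 f power_Suc using pos assms
      by (simp add: divide_simps) (simp add: algebra_simps)
  qed
  have s: "(\<lambda>k. of_real (?c k) * w ^ k) sums (bessel_phi (\<nu> + 1) w - bessel_phi \<nu> w)"
    unfolding bessel_phi_def of_real_diff left_diff_distrib
    using assms by (intro sums_diff summable_sums summable_bessel) auto
  have "(\<lambda>k. of_real (?c (Suc k)) * w ^ Suc k) sums (bessel_phi (\<nu> + 1) w - bessel_phi \<nu> w)"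
    using s c0 by (subst sums_Suc_iff) simp
  moreover have "(\<lambda>k. of_real (?c (Suc k)) * w ^ Suc k) sums
      (w / of_real (4 * (\<nu> + 1) * (\<nu> + 2)) * bessel_phi (\<nu> + 2) w)"
  proof -
    have "(\<lambda>k. w / of_real (4 * (\<nu> + 1) * (\<nu> + 2)) * (of_real (bessel_coeff (\<nu> + 2) k) * w ^ k)) sums
      (w / of_real (4 * (\<nu> + 1) * (\<nu> + 2)) * bessel_phi (\<nu> + 2) w)"
      unfolding bessel_phi_def using assms by (intro sums_mult summable_sums summable_bessel) auto
    moreover have "w / of_real (4 * (\<nu> + 1) * (\<nu> + 2)) * (of_real (bessel_coeff (\<nu> + 2) k) * w ^ k)
       = of_real (?c (Suc k)) * w ^ Suc k" for k
      unfolding cS by (simp add: of_real_divide del: of_real_mult)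
    ultimately show ?thesis by simp
  qed
  ultimately show ?thesis by (rule sums_unique2)
qed

text \<open>Every factor of \<open>pochhammer (\<mu> + 1) k\<close> is at least \<mu> + 1, so the
  series without its constant term is dominated by that of exp (|w| / (4 (\<mu> + 1))) - 1.\<close>

lemma bessel_phi_tendsto_1:
  fixes w :: complex
  assumes "-1/2 < \<nu>"
  shows "(\<lambda>n. bessel_phi (\<nu> + real n) w) \<longlonglongrightarrow> 1"
proof -
  have bd: "norm (bessel_phi (\<nu> + real n) w - 1) \<le> exp (norm w / (4 * (\<nu> + real n + 1))) - 1" for n
  proof -
    define \<mu> where "\<mu> = \<nu> + real n"
    have mu: "-1/2 < \<mu>" using assms by (simp add: \<mu>_def)
    define r where "r = norm w / (4 * (\<mu> + 1))"
    have term_le: "norm (of_real (bessel_coeff \<mu> k) * w ^ k) \<le> r ^ k / fact k" for k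
    proof -
      have "(\<mu> + 1) ^ k = (\<Prod>i<k. \<mu> + 1)" by simp
      also have "\<dots> \<le> pochhammer (\<mu> + 1) k" unfolding pochhammer_prod atLeast0LessThan
        using mu by (intro prod_mono) auto
      finally have p: "(\<mu> + 1) ^ k \<le> pochhammer (\<mu> + 1) k" .
      have "0 < (\<mu> + 1) ^ k" using mu by simp
      have "norm (of_real (bessel_coeff \<mu> k) * w ^ k) = norm w ^ k / (4 ^ k * fact k * pochhammer (\<mu> + 1) k)"
        using mu pochhammer_pos[of "\<mu> + 1" k] by (simp add: norm_mult norm_power norm_divide bessel_coeff_def pochhammer_pos less_imp_le)
      also have "\<dots> \<le> norm w ^ k / (4 ^ k * fact k * (\<mu> + 1) ^ k)"
        using p \<open>0 < (\<mu> + 1) ^ k\<close> by (intro divide_left_mono mult_left_mono mult_pos_pos) auto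
      also have "\<dots> = r ^ k / fact k" unfolding r_def power_divide power_mult_distrib by simp
      finally show ?thesis .
    qed
    have s1: "(\<lambda>k. of_real (bessel_coeff \<mu> (Suc k)) * w ^ Suc k) sums (bessel_phi \<mu> w - 1)"
      using summable_sums[OF summable_bessel[OF mu, of w]]
      by (subst sums_Suc_iff) (simp add: bessel_phi_def bessel_coeff_def)
    have s2: "(\<lambda>k. r ^ Suc k / fact (Suc k)) sums (exp r - 1)"
      using exp_converges[of r] by (subst sums_Suc_iff) (simp add: field_simps)
    have "summable (\<lambda>k. norm (of_real (bessel_coeff \<mu> (Suc k)) * w ^ Suc k))"
      using summable_norm_bessel[OF mu, of w] by (subst summable_Suc_iff)
    hence "norm (bessel_phi \<mu> w - 1) \<le> (\<Sum>k. norm (of_real (bessel_coeff \<mu> (Suc k)) * w ^ Suc k))"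
      unfolding sums_unique[OF s1] by (rule summable_norm)
    also have "\<dots> \<le> (\<Sum>k. r ^ Suc k / fact (Suc k))"
      using \<open>summable _\<close> s2 by (intro suminf_le term_le) (auto simp: sums_iff)
    also have "\<dots> = exp r - 1" using s2 by (simp add: sums_iff)
    finally show ?thesis by (simp add: r_def \<mu>_def add_ac)
  qed
  have "(\<lambda>n. exp (norm w / (4 * (\<nu> + real n + 1))) - 1) \<longlonglongrightarrow> 0"
    by real_asymp
  hence "(\<lambda>n. bessel_phi (\<nu> + real n) w - 1) \<longlonglongrightarrow> 0"
    by (rule Lim_null_comparison[rotated]) (use bd in auto)
  thus ?thesis by (simp add: LIM_zero_iff)
qed

text \<open>A common zero of $\varphi_\nu$ and $\varphi_{\nu+1}$ would by the recurrence be a zero of all $\varphi_{\nu+n}$,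
  which tend to 1.\<close>

lemma bessel_phi_zero_simple:
  fixes w :: complex
  assumes "-1/2 < \<nu>" "bessel_phi \<nu> w = 0"
  shows "bessel_phi (\<nu> + 1) w \<noteq> 0"
proof
  assume 1: "bessel_phi (\<nu> + 1) w = 0"
  have w: "w \<noteq> 0" using assms(2) by auto
  have "bessel_phi (\<nu> + real n) w = 0 \<and> bessel_phi (\<nu> + real n + 1) w = 0" for n
  proof (induction n)
    case (Suc n)
    have "\<nu> + real n + 1 > 0" using assms by auto
    hence "complex_of_real (4 * (\<nu> + real n + 1) * (\<nu> + real n + 2)) \<noteq> 0"
      by (simp only: of_real_eq_0_iff) auto
    hence "bessel_phi (\<nu> + real n + 2) w = 0"
      using bessel_phi_recurrence[of "\<nu> + real n" w] assms(1) Suc w by (auto simp del: of_real_mult)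
    thus ?case using Suc by (simp add: add_ac)
  qed (use assms 1 in auto)
  hence "(\<lambda>n::nat. 0) \<longlonglongrightarrow> (1::complex)" using bessel_phi_tendsto_1[OF assms(1), of w] by simp
  thus False by (simp add: LIMSEQ_const_iff)
qed

section \<open>Hadamard products of order one half\<close>

text \<open>The last conjunct is where simplicity enters: a zero of the quotient remaining on A
  would be a multiple zero of f. It is what later shows the quotient to be free of zeros near the
  removed points.\<close>

lemma simple_zeros_factor:
  fixes f :: "complex \<Rightarrow> complex"
  assumes "finite A" "f holomorphic_on UNIV"
    and "\<And>a. a \<in> A \<Longrightarrow> f a = 0 \<and> deriv f a \<noteq> 0 \<and> a \<noteq> 0"
  shows "\<exists>g. g holomorphic_on UNIV \<and> (\<forall>w. f w = (\<Prod>a\<in>A. 1 - w / a) * g w)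
            \<and> (\<forall>w. g w = 0 \<longrightarrow> f w = 0 \<and> w \<notin> A)"
  using assms
proof (induction A rule: finite_induct)
  case empty
  then show ?case by (intro exI[of _ f]) auto
next
  case (insert a A)
  then obtain g where g: "g holomorphic_on UNIV" "\<And>w. f w = (\<Prod>a\<in>A. 1 - w / a) * g w"
     "\<And>w. g w = 0 \<Longrightarrow> f w = 0 \<and> w \<notin> A" by (metis insertCI)
  have a: "f a = 0" "deriv f a \<noteq> 0" "a \<noteq> 0" using insert by auto
  have "(\<Prod>b\<in>A. 1 - a / b) \<noteq> 0" using insert by (auto simp: field_simps)
  hence ga: "g a = 0" using g(2)[of a] a by auto
  define h where "h w = (if w = a then deriv g a else (g w - g a) / (w - a))" for w
  have hol: "h holomorphic_on UNIV" unfolding h_def[abs_def] by (rule pole_lemma) (use g in auto)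
  have gh: "g w = (w - a) * h w" for w using ga by (auto simp: h_def)
  \<comment> \<open>Otherwise g would have a double zero at a, and the product rule would give
    \<open>deriv f a = 0\<close>.\<close>
  have ha: "h a \<noteq> 0"
  proof
    assume "h a = 0"
    hence d: "deriv g a = 0" by (simp add: h_def)
    have feq: "f = (\<lambda>w. (\<Prod>b\<in>A. 1 - w / b) * g w)" using g(2) by blast
    have "(\<lambda>w. \<Prod>b\<in>A. 1 - w / b) field_differentiable (at a)"
      by (rule holomorphic_on_imp_differentiable_at[of _ UNIV]) (use insert in \<open>auto intro!: holomorphic_intros\<close>)
    moreover have "g field_differentiable (at a)"
      by (rule holomorphic_on_imp_differentiable_at[of _ UNIV]) (use g in auto)
    ultimately have "deriv f a = 0" unfolding feq by (subst deriv_mult) (simp_all add: d ga)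
    thus False using a by simp
  qed
  show ?case
  proof (intro exI[of _ "\<lambda>w. - a * h w"] conjI allI impI)
    show "(\<lambda>w. - a * h w) holomorphic_on UNIV" using hol by (intro holomorphic_intros)
    show "f w = (\<Prod>b\<in>insert a A. 1 - w / b) * (- a * h w)" for w
      using insert a by (simp add: g(2)[of w] gh field_simps)
    fix w assume "- a * h w = 0"
    hence "h w = 0" using a by simp
    thus "f w = 0" "w \<notin> insert a A" using ha gh[of w] g(3)[of w] by auto
  qed
qed

lemma Borel_Caratheodory:
  fixes L :: "complex \<Rightarrow> complex"
  assumes L: "L holomorphic_on ball 0 \<rho>" "L 0 = 0" and "0 < \<rho>"
    and K: "0 < K" "\<And>w. norm w < \<rho> \<Longrightarrow> Re (L w) < K" and w: "norm w < \<rho>"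
  shows "norm (L w) \<le> 2 * K * norm w / (\<rho> - norm w)"
proof -
  \<comment> \<open>The Moebius map L / (2 K - L) sends the half plane Re < K into the unit disc and
    fixes 0, so the Schwarz lemma applies after rescaling to radius 1.\<close>
  define h where "h u = L (of_real \<rho> * u) / (2 * of_real K - L (of_real \<rho> * u))" for u
  have in_ball: "norm (of_real \<rho> * u) < \<rho>" if "norm u < 1" for u :: complex
    using that \<open>0 < \<rho>\<close> by (simp add: norm_mult)
  have ne: "2 * of_real K - L v \<noteq> 0" if "norm v < \<rho>" for v
  proof
    assume "2 * of_real K - L v = 0"
    hence "Re (L v) = 2 * K" by (metis Re_complex_of_real eq_iff_diff_eq_0 of_real_mult of_real_numeral)
    thus False using K(1) K(2)[OF that] by simp
  qed
  have lt: "norm (L v) < norm (2 * of_real K - L v)" if "norm v < \<rho>" for v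
  proof -
    have "(norm (2 * of_real K - L v))\<^sup>2 - (norm (L v))\<^sup>2 = 4 * K * (K - Re (L v))"
      unfolding cmod_power2 by (simp add: power2_eq_square algebra_simps)
    also have "\<dots> > 0" using K(1) K(2)[OF that] by simp
    finally show ?thesis using power2_less_imp_less[of "norm (L v)"] by simp
  qed
  have "h holomorphic_on ball 0 1"
    unfolding h_def using ne in_ball \<open>0 < \<rho>\<close>
    by (intro holomorphic_intros holomorphic_on_compose_gen[OF _ L(1), unfolded o_def])
       (auto simp: norm_mult)
  moreover have "norm (h u) < 1" if "norm u < 1" for u
    using lt[OF in_ball[OF that]] ne[OF in_ball[OF that]] by (simp add: h_def norm_divide)
  moreover define u where "u = w / of_real \<rho>"
  moreover have nu: "norm u < 1" using w \<open>0 < \<rho>\<close> by (simp add: u_def norm_divide)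
  ultimately have hu: "norm (h u) \<le> norm u"
    using Schwarz_Lemma(1)[of h u] L(2) by (simp add: h_def)
  have ru: "of_real \<rho> * u = w" using \<open>0 < \<rho>\<close> by (simp add: u_def)
  have "L w = h u * (2 * of_real K - L w)" using ne[OF w] by (simp add: h_def ru)
  hence "norm (L w) = norm (h u) * norm (2 * of_real K - L w)" by (metis norm_mult)
  also have "\<dots> \<le> norm u * (2 * K + norm (L w))"
    using hu norm_triangle_ineq4[of "2 * of_real K" "L w"] K(1)
    by (intro mult_mono) (auto simp: norm_mult)
  finally have "norm (L w) * (1 - norm u) \<le> 2 * K * norm u" by (simp add: algebra_simps)
  hence "norm (L w) * (1 - norm u) * \<rho> \<le> 2 * K * norm u * \<rho>"
    using \<open>0 < \<rho>\<close> by (intro mult_right_mono) auto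
  moreover have nw: "norm u * \<rho> = norm w" using \<open>0 < \<rho>\<close> by (simp add: u_def norm_divide)
  have "norm (L w) * (1 - norm u) * \<rho> = norm (L w) * (\<rho> - norm u * \<rho>)" by (simp add: algebra_simps)
  moreover have "2 * K * norm u * \<rho> = 2 * K * (norm u * \<rho>)" by simp
  ultimately show ?thesis using w unfolding nw by (simp add: pos_le_divide_eq)
qed

text \<open>Divide $f$ by the factors of its first $n$ zeros. The quotient has no zero on the disc of radius
  $\varrho = a_n$, and on the circle of radius $2\varrho$ the divisor has modulus at least 1, so the logarithm of the
  quotient has real part at most $\sqrt{2\varrho}$; by Borel-Caratheodory it tends to 0.\<close>

lemma Hadamard_order_half:
  fixes f :: "complex \<Rightarrow> complex" and a :: "nat \<Rightarrow> real"
  assumes hol: "f holomorphic_on UNIV" and f0: "f 0 = 1"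
    and growth: "\<And>w. norm (f w) \<le> exp (sqrt (norm w))"
    and zeros: "\<And>w. f w = 0 \<longleftrightarrow> (\<exists>k. w = of_real (a k))"
    and simple: "\<And>k. deriv f (of_real (a k)) \<noteq> 0"
    and a: "strict_mono a" "a 0 > 0" "filterlim a at_top sequentially"
  shows "(\<lambda>n. \<Prod>k<n. 1 - w / of_real (a k)) \<longlonglongrightarrow> f w"
proof -
  have apos: "a k > 0" for k using a(1,2) by (metis less_le_trans strict_mono_less_eq zero_le)
  have ex: "\<exists>g. g holomorphic_on UNIV \<and> (\<forall>w. f w = (\<Prod>k<n. 1 - w / of_real (a k)) * g w)
            \<and> (\<forall>w. g w = 0 \<longrightarrow> norm w \<ge> a n)" for n
  proof -
    have inj: "inj_on (\<lambda>k. complex_of_real (a k)) {..<n}"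
      using a(1) by (auto simp: inj_on_def strict_mono_eq)
    obtain g where g: "g holomorphic_on UNIV" "\<And>w. f w = (\<Prod>b\<in>(\<lambda>k. complex_of_real (a k)) ` {..<n}. 1 - w / b) * g w"
      "\<And>w. g w = 0 \<Longrightarrow> f w = 0 \<and> w \<notin> (\<lambda>k. complex_of_real (a k)) ` {..<n}"
      using simple_zeros_factor[of "(\<lambda>k. complex_of_real (a k)) ` {..<n}" f] hol zeros simple apos
      by (smt (verit, best) finite_imageI finite_lessThan imageE of_real_eq_0_iff)
    have "norm w \<ge> a n" if gw: "g w = 0" for w
    proof -
      obtain k where k: "w = of_real (a k)" using g(3)[OF gw] zeros by auto
      hence "\<not> k < n" using g(3)[OF gw] by auto
      thus ?thesis using k apos[of k] a(1) by (simp add: strict_mono_less_eq)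
    qed
    thus ?thesis using g by (intro exI[of _ g]) (auto simp: prod.reindex[OF inj])
  qed
  define g where "g n = (SOME g. g holomorphic_on UNIV \<and> (\<forall>w. f w = (\<Prod>k<n. 1 - w / of_real (a k)) * g w)
            \<and> (\<forall>w. g w = 0 \<longrightarrow> norm w \<ge> a n))" for n
  have g: "g n holomorphic_on UNIV" "f w = (\<Prod>k<n. 1 - w / of_real (a k)) * g n w"
    "g n w = 0 \<Longrightarrow> norm w \<ge> a n" for n w
    using someI_ex[OF ex[of n]] unfolding g_def by blast+
  have g0: "g n 0 = 1" for n using g(2)[of 0 n] f0 by simp
  have gbound: "norm (g n v) \<le> exp (sqrt (2 * a n))" if v: "norm v < 2 * a n" for n v
  proof (rule maximum_modulus_frontier[of "g n" "ball 0 (2 * a n)"])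
    show "g n holomorphic_on interior (ball 0 (2 * a n))" using g(1) holomorphic_on_subset by blast
    show "continuous_on (closure (ball 0 (2 * a n))) (g n)"
      using g(1) holomorphic_on_imp_continuous_on continuous_on_subset by blast
    fix u :: complex assume "u \<in> frontier (ball 0 (2 * a n))"
    hence nu: "norm u = 2 * a n" using apos[of n] by (simp add: frontier_ball)
    have "1 \<le> norm (1 - u / of_real (a k))" if "k < n" for k
    proof -
      have "a k \<le> a n" using that a(1) by (simp add: strict_mono_less_eq)
      hence "2 \<le> norm (u / of_real (a k))" using apos[of k] by (simp add: nu norm_divide field_simps)
      thus ?thesis using norm_triangle_ineq2[of "u / of_real (a k)" 1] by (simp add: norm_minus_commute)
    qed
    hence "1 \<le> (\<Prod>k<n. norm (1 - u / of_real (a k)))" by (intro prod_ge_1) auto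
    hence "norm (g n u) \<le> norm (f u)"
      using g(2)[of u n] mult_right_mono[of 1 _ "norm (g n u)"] by (simp add: norm_mult prod_norm)
    also have "\<dots> \<le> exp (sqrt (2 * a n))" using growth[of u] nu by simp
    finally show "norm (g n u) \<le> exp (sqrt (2 * a n))" .
  qed (use v in auto)
  have close: "\<exists>l. g n w = exp l \<and> norm l \<le> 2 * (sqrt (2 * a n) + 1) * norm w / (a n - norm w)"
    if n: "norm w < a n" for n
  proof -
    have "g n holomorphic_on ball 0 (a n)" using g(1) holomorphic_on_subset by blast
    then obtain L where L: "L holomorphic_on ball 0 (a n)" "\<And>v. v \<in> ball 0 (a n) \<Longrightarrow> g n v = exp (L v)"
      using contractible_imp_holomorphic_log[of "g n" "ball 0 (a n)"] g(3)
      by (metis convex_ball convex_imp_contractible mem_ball_0 not_less)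
    \<comment> \<open>Borel-Caratheodory needs the value 0 at the centre. Since g n 0 = 1,
      subtracting \<open>L 0\<close> leaves the exponential unchanged.\<close>
    define L' where "L' v = L v - L 0" for v
    have L'0: "L' 0 = 0" by (simp add: L'_def)
    have e0: "exp (L 0) = 1" using L(2)[of 0] g0 apos[of n] by auto
    have eL: "g n v = exp (L' v)" if "norm v < a n" for v
      using L(2)[of v] that e0 by (simp add: L'_def exp_diff)
    \<comment> \<open>The summand 1 makes the bound strict; it is harmless, as the final quotient
      still tends to 0 with a n.\<close>
    have "Re (L' v) < sqrt (2 * a n) + 1" if v: "norm v < a n" for v
    proof -
      have "exp (Re (L' v)) \<le> exp (sqrt (2 * a n))"
        using gbound[of v n] v eL[OF v] apos[of n] by (simp add: norm_exp_eq_Re)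
      thus ?thesis by simp
    qed
    moreover have "L' holomorphic_on ball 0 (a n)" unfolding L'_def using L(1) by (intro holomorphic_intros)
    ultimately have "norm (L' w) \<le> 2 * (sqrt (2 * a n) + 1) * norm w / (a n - norm w)"
      using apos[of n] n by (intro Borel_Caratheodory) (auto simp: L'0 add_pos_pos)
    thus ?thesis using eL[OF n] by auto
  qed
  have ev: "eventually (\<lambda>n. norm w < a n) sequentially" using a(3) by (simp add: filterlim_at_top_dense)
  define l where "l n = (SOME l. g n w = exp l \<and> norm l \<le> 2 * (sqrt (2 * a n) + 1) * norm w / (a n - norm w))" for n
  have l: "g n w = exp (l n)" "norm (l n) \<le> 2 * (sqrt (2 * a n) + 1) * norm w / (a n - norm w)"
    if "norm w < a n" for n using someI_ex[OF close[OF that]] unfolding l_def by blast+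
  have "((\<lambda>x. 2 * (sqrt (2 * x) + 1) * norm w / (x - norm w)) \<longlongrightarrow> 0) at_top" by real_asymp
  hence "(\<lambda>n. 2 * (sqrt (2 * a n) + 1) * norm w / (a n - norm w)) \<longlonglongrightarrow> 0"
    using a(3) by (rule filterlim_compose)
  hence "l \<longlonglongrightarrow> 0" by (rule Lim_null_comparison[rotated]) (use ev l in \<open>auto elim!: eventually_mono\<close>)
  hence "(\<lambda>n. f w / exp (l n)) \<longlonglongrightarrow> f w / exp 0" by (intro tendsto_intros) auto
  moreover have "eventually (\<lambda>n. f w / exp (l n) = (\<Prod>k<n. 1 - w / of_real (a k))) sequentially"
    using ev
  proof eventually_elim
    case (elim n)
    show ?case using g(2)[of w n] l(1)[OF elim] by simp
  qed
  ultimately show ?thesis by (simp add: filterlim_cong)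
qed

section \<open>Zeros of the Bessel function\<close>

text \<open>The weights below are integrated from t = 0 on, where the exponent must be positive
  instead of the base nonzero. The rule for a nonzero base is withdrawn so that this one is
  tried.\<close>

lemma continuous_on_powr_nonneg:
  fixes p :: real
  assumes "0 < p" "\<And>x. x \<in> S \<Longrightarrow> 0 \<le> x"
  shows "continuous_on S (\<lambda>x. x powr p)"
  using assms by (intro continuous_on_powr') (auto intro!: continuous_intros)

declare continuous_on_powr [continuous_intros del] continuous_on_powr_nonneg [continuous_intros]

section \<open>Differential relations and the reality of the zeros\<close>

lemma bessel_phi_sq_vderiv:
  fixes w :: "'a::{real_normed_field,banach}"
  assumes "-1/2 < \<nu>"
  shows "((\<lambda>t. bessel_phi \<nu> (w * of_real t ^ 2)) has_vector_derivative
           - (w * of_real (t / (2 * (\<nu> + 1))) * bessel_phi (\<nu> + 1) (w * of_real t ^ 2))) (at t within S)"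
proof (rule has_vector_derivative_real_field[where f="\<lambda>s. bessel_phi \<nu> (w * s ^ 2)"])
  define c :: 'a where "c = of_real (2 * (\<nu> + 1))"
  have "c \<noteq> 0" unfolding c_def using assms by (simp only: of_real_eq_0_iff) auto
  have eqs: "of_real (4 * (\<nu> + 1)) = 2 * c" "of_real (t / (2 * (\<nu> + 1))) = of_real t / c"
    unfolding c_def by (simp_all only: of_real_divide) simp
  have "- bessel_phi (\<nu> + 1) (w * of_real t ^ 2) / of_real (4 * (\<nu> + 1)) * (w * (of_nat 2 * (of_real t ^ 1 * 1)))
     = - (w * of_real (t / (2 * (\<nu> + 1))) * bessel_phi (\<nu> + 1) (w * of_real t ^ 2))"
    unfolding eqs using \<open>c \<noteq> 0\<close> by (simp add: divide_simps)
  moreover have "((\<lambda>s. w * s ^ 2) has_field_derivative w * (of_nat 2 * (of_real t ^ 1 * 1))) (at (of_real t))"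
    by (auto intro!: derivative_eq_intros)
  ultimately show "((\<lambda>s. bessel_phi \<nu> (w * s ^ 2)) has_field_derivative
     - (w * of_real (t / (2 * (\<nu> + 1))) * bessel_phi (\<nu> + 1) (w * of_real t ^ 2))) (at (of_real t))"
    using bessel_phi_deriv'[OF assms, of "\<lambda>s. w * s ^ 2"] by metis
qed

text \<open>The relation (x^(\<nu>+1) J_{\<nu>+1}(x))' = x^(\<nu>+1) J_\<nu>(x). Together with the
  preceding one it is Bessel's equation written as a first order system in self-adjoint form, in a
  real variable t with a possibly complex spectral parameter w.\<close>

lemma bessel_phi_powr_vderiv:
  fixes w :: "'a::{real_normed_field,banach}"
  assumes "-1/2 < \<nu>" "0 < t"
  shows "((\<lambda>t. (t powr (2 * \<nu> + 2)) *\<^sub>R bessel_phi (\<nu> + 1) (w * of_real t ^ 2)) has_vector_derivative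
           (2 * (\<nu> + 1) * t powr (2 * \<nu> + 1)) *\<^sub>R bessel_phi \<nu> (w * of_real t ^ 2)) (at t within S)"
proof -
  let ?P = "\<lambda>j. bessel_phi (\<nu> + j) (w * of_real t ^ 2)"
  have d1: "((\<lambda>t. t powr (2 * \<nu> + 2)) has_field_derivative (2 * \<nu> + 2) * t powr (2 * \<nu> + 2 - 1)) (at t within S)"
    using has_real_derivative_powr[OF assms(2), of "2 * \<nu> + 2"] by (rule has_field_derivative_at_within)
  have d2: "((\<lambda>t. bessel_phi (\<nu> + 1) (w * of_real t ^ 2)) has_vector_derivative
     - (w * of_real (t / (2 * (\<nu> + 1 + 1))) * bessel_phi (\<nu> + 1 + 1) (w * of_real t ^ 2))) (at t within S)"
    using assms by (intro bessel_phi_sq_vderiv) auto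
  have rec: "bessel_phi \<nu> (w * of_real t ^ 2) = ?P 1 - (t ^ 2 / (4 * (\<nu> + 1) * (\<nu> + 2))) *\<^sub>R (w * ?P 2)"
    using bessel_phi_recurrence[OF assms(1), of "w * of_real t ^ 2"]
    by (simp add: scaleR_conv_of_real algebra_simps)
  have p: "t powr (2 * \<nu> + 2) = t * t powr (2 * \<nu> + 1)"
    using assms(2) powr_add[of t 1 "2 * \<nu> + 1"] by (simp add: algebra_simps)
  have "(t powr (2 * \<nu> + 2)) *\<^sub>R - (w * of_real (t / (2 * (\<nu> + 1 + 1))) * bessel_phi (\<nu> + 1 + 1) (w * of_real t ^ 2))
      = - (t powr (2 * \<nu> + 2) * (t / (2 * (\<nu> + 2)))) *\<^sub>R (w * ?P 2)"
    by (simp add: scaleR_conv_of_real add_ac)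
  also have "t powr (2 * \<nu> + 2) * (t / (2 * (\<nu> + 2)))
      = (2 * (\<nu> + 1) * t powr (2 * \<nu> + 1)) * (t ^ 2 / (4 * (\<nu> + 1) * (\<nu> + 2)))"
    using assms(1) unfolding p by (simp add: divide_simps) (simp add: power2_eq_square algebra_simps)
  finally have "(t powr (2 * \<nu> + 2)) *\<^sub>R - (w * of_real (t / (2 * (\<nu> + 1 + 1))) * bessel_phi (\<nu> + 1 + 1) (w * of_real t ^ 2))
      + ((2 * \<nu> + 2) * t powr (2 * \<nu> + 2 - 1)) *\<^sub>R bessel_phi (\<nu> + 1) (w * of_real t ^ 2)
    = (2 * (\<nu> + 1) * t powr (2 * \<nu> + 1)) *\<^sub>R bessel_phi \<nu> (w * of_real t ^ 2)"
    unfolding rec scaleR_diff_right by (simp add: algebra_simps)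
  thus ?thesis using has_vector_derivative_scaleR[OF d1 d2] by simp
qed

text \<open>The power weight vanishes at 0, so positivity of the integrand there is not immediate; a
  vanishing integral would force the Bessel factor to vanish along 1/(n+1), against its value 1 at
  0.\<close>

lemma bessel_phi_energy_pos:
  fixes w :: "'a::{real_normed_field,banach}"
  assumes "-1/2 < \<nu>"
  shows "integral {0..1} (\<lambda>t. t powr (2 * \<nu> + 1) * (norm (bessel_phi \<nu> (w * of_real t ^ 2)))\<^sup>2) > 0" (is "integral _ ?f > 0")
proof -
  have cont: "continuous_on {0..1} ?f" using assms by (intro continuous_intros) auto
  have ge: "integral {0..1} ?f \<ge> 0" by (intro integral_nonneg integrable_continuous_interval cont) auto
  have "integral {0..1} ?f \<noteq> 0"
  proof
    assume "integral {0..1} ?f = 0"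
    hence z: "?f t = 0" if "t \<in> {0..1}" for t using integral_eq_0_iff[OF cont] that by auto
    have "continuous_on UNIV (\<lambda>t::real. bessel_phi \<nu> (w * of_real t ^ 2))"
      by (intro continuous_intros assms)
    hence "isCont (\<lambda>t::real. bessel_phi \<nu> (w * of_real t ^ 2)) 0"
      by (simp add: continuous_on_eq_continuous_at)
    hence "(\<lambda>n. bessel_phi \<nu> (w * of_real (inverse (real (Suc n))) ^ 2)) \<longlonglongrightarrow> bessel_phi \<nu> (w * of_real 0 ^ 2)"
      by (rule isCont_tendsto_compose) (rule LIMSEQ_inverse_real_of_nat)
    moreover have "bessel_phi \<nu> (w * of_real (inverse (real (Suc n))) ^ 2) = 0" for n
      using z[of "inverse (real (Suc n))"] by (auto simp: inverse_le_1_iff)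
    ultimately show False by (simp add: LIMSEQ_const_iff)
  qed
  thus ?thesis using ge by linarith
qed

text \<open>Self-adjointness: integrating the derivative of V, whose boundary values vanish at a
  zero w, gives 2 (\<nu>+1) w C2 = C1 for two integrals of nonnegative functions, with C2 > 0. The
  imaginary part yields that w is real, the real part that it is nonnegative.\<close>

lemma bessel_phi_zero_real_pos:
  fixes w :: complex
  assumes nu: "-1/2 < \<nu>" and zero: "bessel_phi \<nu> w = 0"
  shows "\<exists>x>0. w = of_real x"
proof -
  define A where "A j t = bessel_phi (\<nu> + j) (w * of_real t ^ 2)" for j t
  define V where "V t = w * (cnj (A 0 t) * (t powr (2 * \<nu> + 2)) *\<^sub>R A 1 t)" for t
  define c1 where "c1 t = (norm w)\<^sup>2 * t / (2 * (\<nu> + 1)) * t powr (2 * \<nu> + 2) * (norm (A 1 t))\<^sup>2" for t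
  define c2 where "c2 t = t powr (2 * \<nu> + 1) * (norm (bessel_phi \<nu> (w * of_real t ^ 2)))\<^sup>2" for t
  have "((\<lambda>t. 2 * (\<nu> + 1) * c2 t *\<^sub>R w - of_real (c1 t)) has_integral V 1 - V 0) {0..1}"
  proof (rule fundamental_theorem_of_calculus_interior)
    show "continuous_on {0..1} V" unfolding V_def A_def using nu by (intro continuous_intros) auto
    fix t :: real assume t: "t \<in> {0<..<1}"
    have dA: "(A 0 has_vector_derivative - (w * of_real (t / (2 * (\<nu> + 1))) * A 1 t)) (at t)"
      unfolding A_def using bessel_phi_sq_vderiv[OF nu, of w t] by simp
    have dU: "((\<lambda>t. (t powr (2 * \<nu> + 2)) *\<^sub>R A 1 t) has_vector_derivative (2 * (\<nu> + 1) * t powr (2 * \<nu> + 1)) *\<^sub>R A 0 t) (at t)"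
      unfolding A_def using bessel_phi_powr_vderiv[OF nu, of t w] t by simp
    have "(V has_vector_derivative w * (cnj (A 0 t) * ((2 * (\<nu> + 1) * t powr (2 * \<nu> + 1)) *\<^sub>R A 0 t)
        + cnj (- (w * of_real (t / (2 * (\<nu> + 1))) * A 1 t)) * ((t powr (2 * \<nu> + 2)) *\<^sub>R A 1 t))) (at t)"
      unfolding V_def
      by (intro has_vector_derivative_mult_right has_vector_derivative_mult has_vector_derivative_cnj dA dU)
    moreover have "w * (cnj (A 0 t) * ((2 * (\<nu> + 1) * t powr (2 * \<nu> + 1)) *\<^sub>R A 0 t)
        + cnj (- (w * of_real (t / (2 * (\<nu> + 1))) * A 1 t)) * ((t powr (2 * \<nu> + 2)) *\<^sub>R A 1 t))
      = w * of_real (2 * (\<nu> + 1) * t powr (2 * \<nu> + 1)) * (A 0 t * cnj (A 0 t))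
        - of_real (t / (2 * (\<nu> + 1)) * t powr (2 * \<nu> + 2)) * (w * cnj w) * (A 1 t * cnj (A 1 t))"
      by (simp add: scaleR_conv_of_real algebra_simps)
    moreover have "\<dots> = 2 * (\<nu> + 1) * c2 t *\<^sub>R w - of_real (c1 t)"
      unfolding complex_norm_square[symmetric] c1_def c2_def
      by (simp add: scaleR_conv_of_real A_def algebra_simps)
    ultimately show "(V has_vector_derivative 2 * (\<nu> + 1) * c2 t *\<^sub>R w - of_real (c1 t)) (at t)" by simp
  qed simp
  moreover have "V 1 - V 0 = 0" using nu zero by (simp add: V_def A_def)
  ultimately have I: "((\<lambda>t. 2 * (\<nu> + 1) * c2 t *\<^sub>R w - of_real (c1 t)) has_integral 0) {0..1}" by simp
  have cc: "continuous_on {0..1} c1" "continuous_on {0..1} c2"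
    unfolding c1_def c2_def A_def using nu by (intro continuous_intros; auto)+
  have C2: "integral {0..1} c2 > 0" using bessel_phi_energy_pos[OF nu, of w] unfolding c2_def .
  have C1: "integral {0..1} c1 \<ge> 0" using nu
    by (intro integral_nonneg integrable_continuous_interval cc) (auto simp: c1_def)
  have ii: "(c2 has_integral integral {0..1} c2) {0..1}" "(c1 has_integral integral {0..1} c1) {0..1}"
    using cc by (auto intro!: integrable_integral integrable_continuous_interval)
  have "((\<lambda>t. 2 * (\<nu> + 1) * Im w * c2 t) has_integral 0) {0..1}"
    using has_integral_linear[OF I bounded_linear_Im] by (simp add: o_def mult_ac)
  moreover have "((\<lambda>t. 2 * (\<nu> + 1) * Im w * c2 t) has_integral 2 * (\<nu> + 1) * Im w * integral {0..1} c2) {0..1}"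
    by (intro has_integral_mult_right ii)
  ultimately have "2 * (\<nu> + 1) * Im w * integral {0..1} c2 = 0" by (rule has_integral_unique[symmetric])
  hence im: "Im w = 0" using C2 nu by auto
  have "((\<lambda>t. 2 * (\<nu> + 1) * Re w * c2 t - c1 t) has_integral 0) {0..1}"
    using has_integral_linear[OF I bounded_linear_Re] by (simp add: o_def mult_ac)
  moreover have "((\<lambda>t. 2 * (\<nu> + 1) * Re w * c2 t - c1 t) has_integral
      2 * (\<nu> + 1) * Re w * integral {0..1} c2 - integral {0..1} c1) {0..1}"
    by (intro has_integral_diff has_integral_mult_right ii)
  ultimately have "2 * (\<nu> + 1) * Re w * integral {0..1} c2 - integral {0..1} c1 = 0"
    by (rule has_integral_unique[symmetric])
  hence "0 \<le> Re w * (2 * (\<nu> + 1) * integral {0..1} c2)" using C1 by (simp add: mult_ac)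
  hence "Re w \<ge> 0" using C2 nu by (subst (asm) zero_le_mult_iff) (auto simp: mult_le_0_iff)
  moreover have "w \<noteq> 0" using zero by auto
  ultimately show ?thesis using im by (intro exI[of _ "Re w"]) (auto simp: complex_eq_iff)
qed

section \<open>Integral identities and orthogonality of the eigenfunctions\<close>

lemma bessel_phi_real_derivs:
  fixes w :: real
  assumes "-1/2 < \<nu>"
  shows "((\<lambda>t. bessel_phi \<nu> (w * t ^ 2)) has_real_derivative
           - (w * (t / (2 * (\<nu> + 1))) * bessel_phi (\<nu> + 1) (w * t ^ 2))) (at t within S)"
    and "0 < t \<Longrightarrow> ((\<lambda>t. t powr (2 * \<nu> + 2) * bessel_phi (\<nu> + 1) (w * t ^ 2)) has_real_derivative
           2 * (\<nu> + 1) * t powr (2 * \<nu> + 1) * bessel_phi \<nu> (w * t ^ 2)) (at t within S)"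
  using bessel_phi_sq_vderiv[OF assms, of w t S] bessel_phi_powr_vderiv[OF assms, of t w S]
  by (simp_all add: has_real_derivative_iff_has_vector_derivative)

text \<open>It evaluates the kernel of the bridge on an eigenfunction: the result involves the next
  order only.\<close>

lemma bessel_phi_primitive:
  fixes w :: real
  assumes "-1/2 < \<nu>" "0 \<le> r"
  shows "((\<lambda>t. t powr (2 * \<nu> + 1) * bessel_phi \<nu> (w * t ^ 2)) has_integral
           r powr (2 * \<nu> + 2) * bessel_phi (\<nu> + 1) (w * r ^ 2) / (2 * (\<nu> + 1))) {0..r}"
proof -
  have "((\<lambda>t. 2 * (\<nu> + 1) * t powr (2 * \<nu> + 1) * bessel_phi \<nu> (w * t ^ 2)) has_integral
    r powr (2 * \<nu> + 2) * bessel_phi (\<nu> + 1) (w * r ^ 2) - 0 powr (2 * \<nu> + 2) * bessel_phi (\<nu> + 1) (w * 0 ^ 2)) {0..r}"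
    using assms by (intro fundamental_theorem_of_calculus_interior continuous_intros)
      (auto simp: has_real_derivative_iff_has_vector_derivative[symmetric]
            simp del: distrib_left_numeral intro!: bessel_phi_real_derivs)
  from has_integral_divide[OF this, of "2 * (\<nu> + 1)"] show ?thesis using assms by simp
qed

lemma bessel_phi_cross_energy:
  fixes w v :: real
  assumes "-1/2 < \<nu>"
  shows "((\<lambda>t. 2 * (\<nu> + 1) * (t powr (2 * \<nu> + 1) * bessel_phi \<nu> (v * t ^ 2) * bessel_phi \<nu> (w * t ^ 2))
             - v / (2 * (\<nu> + 1)) * (t powr (2 * \<nu> + 3) * bessel_phi (\<nu> + 1) (v * t ^ 2) * bessel_phi (\<nu> + 1) (w * t ^ 2)))
          has_integral bessel_phi \<nu> v * bessel_phi (\<nu> + 1) w) {0..1}" (is "(?f has_integral _) _")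
proof -
  let ?A = "\<lambda>t. bessel_phi \<nu> (v * t ^ 2)" and ?U = "\<lambda>t. t powr (2 * \<nu> + 2) * bessel_phi (\<nu> + 1) (w * t ^ 2)"
  have "(?f has_integral ?A 1 * ?U 1 - ?A 0 * ?U 0) {0..1}"
  proof (rule fundamental_theorem_of_calculus_interior)
    show "continuous_on {0..1} (\<lambda>t. ?A t * ?U t)" using assms by (intro continuous_intros) auto
    fix t :: real assume t: "t \<in> {0<..<1}"
    have p: "t powr (2 * \<nu> + 3) = t * t powr (2 * \<nu> + 2)"
      using t powr_add[of t 1 "2 * \<nu> + 2"] by (simp add: algebra_simps)
    have "((\<lambda>t. ?A t * ?U t) has_real_derivative
        (- (v * (t / (2 * (\<nu> + 1))) * bessel_phi (\<nu> + 1) (v * t ^ 2))) * ?U t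
        + (2 * (\<nu> + 1) * t powr (2 * \<nu> + 1) * bessel_phi \<nu> (w * t ^ 2)) * ?A t) (at t)"
      using t by (intro DERIV_mult bessel_phi_real_derivs assms) auto
    moreover have "(- (v * (t / (2 * (\<nu> + 1))) * bessel_phi (\<nu> + 1) (v * t ^ 2))) * ?U t
        + (2 * (\<nu> + 1) * t powr (2 * \<nu> + 1) * bessel_phi \<nu> (w * t ^ 2)) * ?A t = ?f t"
      unfolding p by (simp add: algebra_simps)
    ultimately show "((\<lambda>t. ?A t * ?U t) has_vector_derivative ?f t) (at t)"
      by (simp only: has_real_derivative_iff_has_vector_derivative)
  qed simp
  thus ?thesis by simp
qed

lemma bessel_phi_cont_integrable:
  fixes v w :: real
  assumes "-1/2 < \<mu>" "0 < p"
  shows "(\<lambda>t. t powr p * bessel_phi \<mu> (v * t ^ 2) * bessel_phi \<mu> (w * t ^ 2)) integrable_on {0..1}"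
  by (intro integrable_continuous_interval continuous_intros) (use assms in auto)

text \<open>If v is a zero, the boundary term of the integration by parts vanishes whatever w is.
  The identity is used twice: for orthogonality, and to compute the norms of the functions
  \<open>G (h k)\<close>, where the factor v becomes the reciprocal eigenvalue.\<close>

lemma bessel_phi_dirichlet:
  fixes v w :: real
  assumes nu: "-1/2 < \<nu>" and v: "bessel_phi \<nu> v = 0"
  shows "v * integral {0..1} (\<lambda>t. t powr (2 * \<nu> + 3) * bessel_phi (\<nu> + 1) (v * t ^ 2) * bessel_phi (\<nu> + 1) (w * t ^ 2))
     = (2 * (\<nu> + 1))\<^sup>2 * integral {0..1} (\<lambda>t. t powr (2 * \<nu> + 1) * bessel_phi \<nu> (v * t ^ 2) * bessel_phi \<nu> (w * t ^ 2))"
proof -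
  let ?f = "\<lambda>t. t powr (2 * \<nu> + 1) * bessel_phi \<nu> (v * t ^ 2) * bessel_phi \<nu> (w * t ^ 2)"
  let ?g = "\<lambda>t. t powr (2 * \<nu> + 3) * bessel_phi (\<nu> + 1) (v * t ^ 2) * bessel_phi (\<nu> + 1) (w * t ^ 2)"
  have "((\<lambda>t. 2 * (\<nu> + 1) * ?f t - v / (2 * (\<nu> + 1)) * ?g t) has_integral
      2 * (\<nu> + 1) * integral {0..1} ?f - v / (2 * (\<nu> + 1)) * integral {0..1} ?g) {0..1}"
    using nu by (intro has_integral_diff has_integral_mult_right integrable_integral bessel_phi_cont_integrable) auto
  from has_integral_unique[OF this bessel_phi_cross_energy[OF nu]]
  have "2 * (\<nu> + 1) * integral {0..1} ?f = v / (2 * (\<nu> + 1)) * integral {0..1} ?g" using v by simp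
  thus ?thesis using nu by (simp add: field_simps power2_eq_square)
qed

lemma bessel_phi_orthogonal:
  fixes v w :: real
  assumes nu: "-1/2 < \<nu>" and "bessel_phi \<nu> v = 0" "bessel_phi \<nu> w = 0" "v \<noteq> w"
  shows "integral {0..1} (\<lambda>t. t powr (2 * \<nu> + 1) * bessel_phi \<nu> (v * t ^ 2) * bessel_phi \<nu> (w * t ^ 2)) = 0"
    (is "?I = 0")
proof -
  \<comment> \<open>?G is symmetric in v and w, whereas its prefactor in the identity is v in one
    reading and w in the other.\<close>
  let ?G = "\<lambda>v w. integral {0..1} (\<lambda>t. t powr (2 * \<nu> + 3) * bessel_phi (\<nu> + 1) (v * t ^ 2) * bessel_phi (\<nu> + 1) (w * t ^ 2))"
  have "v * ?G v w = (2 * (\<nu> + 1))\<^sup>2 * ?I" by (rule bessel_phi_dirichlet[OF nu assms(2)])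
  moreover have "w * ?G v w = (2 * (\<nu> + 1))\<^sup>2 * ?I"
    using bessel_phi_dirichlet[OF nu assms(3), of v] by (simp only: mult_ac)
  ultimately have "(v - w) * ?G v w = 0" by (simp only: left_diff_distrib diff_self)
  hence "(2 * (\<nu> + 1))\<^sup>2 * ?I = 0" using \<open>v * ?G v w = _\<close> \<open>v \<noteq> w\<close> by auto
  thus ?thesis using nu by auto
qed

section \<open>The sequence of zeros, the product formula and Rayleigh's sum\<close>

lemma bessel_J_eq_bessel_phi:
  assumes "-1/2 < \<nu>" "0 < u"
  shows "bessel_J \<nu> u = (u / 2) powr \<nu> / Gamma (\<nu> + 1) * bessel_phi \<nu> (u\<^sup>2)"
proof -
  have G: "Gamma (real k + \<nu> + 1) = pochhammer (\<nu> + 1) k * Gamma (\<nu> + 1)" for k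
  proof -
    have "\<nu> + 1 \<notin> \<int>\<^sub>\<le>\<^sub>0" using assms by (auto elim!: nonpos_Ints_cases)
    thus ?thesis using pochhammer_Gamma[of "\<nu> + 1" k] Gamma_eq_zero_iff[of "\<nu> + 1"] by (simp add: add_ac)
  qed
  have "(-1) ^ k / (fact k * Gamma (real k + \<nu> + 1)) * (u / 2) powr (2 * real k + \<nu>)
      = (u / 2) powr \<nu> / Gamma (\<nu> + 1) * (bessel_coeff \<nu> k * (u\<^sup>2) ^ k)" for k
  proof -
    have "(u / 2) powr (2 * real k + \<nu>) = (u / 2) ^ (2 * k) * (u / 2) powr \<nu>"
      using assms powr_realpow[of "u / 2" "2 * k"] by (simp add: powr_add)
    also have "(u / 2) ^ (2 * k) = (u\<^sup>2) ^ k / 4 ^ k" by (simp add: power_mult power_divide)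
    finally show ?thesis unfolding G bessel_coeff_def by (simp add: mult_ac)
  qed
  thus ?thesis unfolding bessel_J_def bessel_phi_def
    using suminf_mult[OF summable_bessel[OF assms(1), of "u\<^sup>2"], of "(u / 2) powr \<nu> / Gamma (\<nu> + 1)"] by simp
qed

text \<open>That there are infinitely many zeros is contained in their enumeration by a strictly
  increasing sequence. Indices start at 0 here, so \<open>z 0\<close> is the first zero.\<close>

locale bessel_zeros =
  fixes \<nu> :: real and z :: "nat \<Rightarrow> real"
  assumes nu: "-1/2 < \<nu>" and mono: "strict_mono z"
    and range_z: "range z = {u. 0 < u \<and> bessel_phi \<nu> (u\<^sup>2) = 0}"
begin

lemma z_pos: "0 < z k" and phi_z: "bessel_phi \<nu> ((z k)\<^sup>2) = 0"
proof -
  have "z k \<in> {u. 0 < u \<and> bessel_phi \<nu> (u\<^sup>2) = 0}" unfolding range_z[symmetric] by (rule rangeI)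
  thus "0 < z k" "bessel_phi \<nu> ((z k)\<^sup>2) = 0" by auto
qed

lemma zsq_mono: "strict_mono (\<lambda>k. (z k)\<^sup>2)"
proof (rule strict_monoI)
  fix j k :: nat assume "j < k"
  hence "z j < z k" using mono by (simp add: strict_mono_less)
  thus "(z j)\<^sup>2 < (z k)\<^sup>2" using z_pos[of j] by (intro power_strict_mono) auto
qed

lemma complex_zeros: "bessel_phi \<nu> (w::complex) = 0 \<longleftrightarrow> (\<exists>k. w = of_real ((z k)\<^sup>2))"
proof
  assume 0: "bessel_phi \<nu> w = 0"
  obtain x where x: "x > 0" "w = of_real x" using bessel_phi_zero_real_pos[OF nu 0] by auto
  have "bessel_phi \<nu> x = 0" using 0 x of_real_bessel_phi[OF nu, of x] by (metis of_real_eq_0_iff)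
  hence "sqrt x \<in> range z" using x unfolding range_z by auto
  then obtain k where "sqrt x = z k" by auto
  hence "x = (z k)\<^sup>2" using x by (metis less_imp_le real_sqrt_pow2)
  thus "\<exists>k. w = of_real ((z k)\<^sup>2)" using x by auto
next
  assume "\<exists>k. w = of_real ((z k)\<^sup>2)"
  then obtain k where "w = of_real ((z k)\<^sup>2)" by auto
  thus "bessel_phi \<nu> w = 0" using of_real_bessel_phi[OF nu, of "(z k)\<^sup>2"] phi_z[of k] by simp
qed

lemma phi_holomorphic: "bessel_phi \<nu> holomorphic_on UNIV"
  using bessel_phi_deriv[OF nu] by (auto simp: holomorphic_on_def field_differentiable_def)

text \<open>Bounded zeros would accumulate in a disc, and an entire function taking the values 1 at
  0 and 0 at \<open>z 0\<close> squared has finitely many zeros there.\<close>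

lemma zsq_at_top: "filterlim (\<lambda>k. (z k)\<^sup>2) at_top sequentially"
proof (rule ccontr)
  assume "\<not> filterlim (\<lambda>k. (z k)\<^sup>2) at_top sequentially"
  then obtain C where "\<not> eventually (\<lambda>k. C \<le> (z k)\<^sup>2) sequentially" by (auto simp: filterlim_at_top)
  hence "\<exists>k\<ge>n. (z k)\<^sup>2 < C" for n by (auto simp: eventually_sequentially not_le)
  hence lt: "(z n)\<^sup>2 < C" for n
  proof -
    obtain k where "k \<ge> n" "(z k)\<^sup>2 < C" using \<open>\<And>n. \<exists>k\<ge>n. (z k)\<^sup>2 < C\<close> by blast
    moreover have "(z n)\<^sup>2 \<le> (z k)\<^sup>2" using strict_mono_less_eq[OF zsq_mono] \<open>k \<ge> n\<close> by simp
    ultimately show ?thesis by simp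
  qed
  have "finite {w \<in> cball (0::complex) C. bessel_phi \<nu> w = 0}"
  proof (rule holomorphic_compact_finite_zeros[OF phi_holomorphic])
    show "\<not> bessel_phi \<nu> constant_on (UNIV::complex set)"
    proof
      assume "bessel_phi \<nu> constant_on (UNIV::complex set)"
      then obtain c where c: "bessel_phi \<nu> w = c" for w :: complex unfolding constant_on_def by blast
      have "bessel_phi \<nu> (of_real ((z 0)\<^sup>2)) = bessel_phi \<nu> (0::complex)" unfolding c by (rule refl)
      moreover have "bessel_phi \<nu> (complex_of_real ((z 0)\<^sup>2)) = 0" using complex_zeros by blast
      ultimately show False by simp
    qed
  qed auto
  moreover have "range (\<lambda>k. complex_of_real ((z k)\<^sup>2)) \<subseteq> {w \<in> cball 0 C. bessel_phi \<nu> w = 0}"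
    using complex_zeros lt by (auto simp: less_imp_le simp del: of_real_power)
  ultimately have "finite (range (\<lambda>k. complex_of_real ((z k)\<^sup>2)))" by (rule finite_subset[rotated])
  moreover have "inj (\<lambda>k. complex_of_real ((z k)\<^sup>2))"
    using strict_mono_eq[OF zsq_mono] by (intro injI) (simp only: of_real_eq_iff)
  ultimately show False using finite_imageD infinite_UNIV_nat by blast
qed

lemma deriv_phi_z: "deriv (bessel_phi \<nu>) (complex_of_real ((z k)\<^sup>2)) \<noteq> 0"
proof -
  have "bessel_phi (\<nu> + 1) (complex_of_real ((z k)\<^sup>2)) \<noteq> 0"
    by (rule bessel_phi_zero_simple[OF nu]) (use complex_zeros in blast)
  moreover have "complex_of_real (4 * (\<nu> + 1)) \<noteq> 0" using nu by (simp only: of_real_eq_0_iff) auto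
  ultimately show ?thesis
    unfolding DERIV_imp_deriv[OF bessel_phi_deriv[OF nu]] by (simp del: of_real_mult of_real_power)
qed

lemma product_complex: "(\<lambda>n. \<Prod>k<n. 1 - w / of_real ((z k)\<^sup>2)) \<longlonglongrightarrow> bessel_phi \<nu> (w::complex)"
proof (rule Hadamard_order_half[OF phi_holomorphic _ _ _ _ zsq_mono _ zsq_at_top])
  show "deriv (bessel_phi \<nu>) (complex_of_real ((z k)\<^sup>2)) \<noteq> 0" for k by (rule deriv_phi_z)
  show "bessel_phi \<nu> w = 0 \<longleftrightarrow> (\<exists>k. w = complex_of_real ((z k)\<^sup>2))" for w by (rule complex_zeros)
  show "0 < (z 0)\<^sup>2" using z_pos[of 0] by simp
  show "bessel_phi \<nu> (0::complex) = 1" by simp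
  show "norm (bessel_phi \<nu> w) \<le> exp (sqrt (norm w))" for w :: complex
    by (rule norm_bessel_phi_le[OF nu])
qed

lemma product_real: "(\<lambda>n. \<Prod>k<n. 1 - x / (z k)\<^sup>2) \<longlonglongrightarrow> bessel_phi \<nu> (x::real)"
proof -
  have "(\<lambda>n. complex_of_real (\<Prod>k<n. 1 - x / (z k)\<^sup>2)) \<longlonglongrightarrow> of_real (bessel_phi \<nu> x)"
    using product_complex[of "of_real x"] unfolding of_real_bessel_phi[OF nu] by simp
  thus ?thesis by (simp only: tendsto_of_real_iff)
qed

text \<open>At -s with s > 0 all factors of the product and all terms of the series are nonnegative.
  The product is at most exp (s S), the series at least 1 + s / (4 (\<nu>+1)); the linear
  coefficients at 0 then compare. The opposite estimate is supplied later by Bessel's inequality for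
  the paths.\<close>

lemma rayleigh: "summable (\<lambda>k. 1 / (z k)\<^sup>2)" "1 / (4 * (\<nu> + 1)) \<le> (\<Sum>k. 1 / (z k)\<^sup>2)"
proof -
  have inc: "incseq (\<lambda>n. \<Prod>k<n. 1 + s / (z k)\<^sup>2)" if "s \<ge> 0" for s
  proof (rule incseq_SucI)
    fix n
    have "0 \<le> (\<Prod>k<n. 1 + s / (z k)\<^sup>2)" using that by (intro prod_nonneg) (auto intro!: add_nonneg_nonneg)
    hence "(\<Prod>k<n. 1 + s / (z k)\<^sup>2) * 1 \<le> (\<Prod>k<n. 1 + s / (z k)\<^sup>2) * (1 + s / (z n)\<^sup>2)"
      using that by (intro mult_left_mono) auto
    thus "(\<Prod>k<n. 1 + s / (z k)\<^sup>2) \<le> (\<Prod>k<Suc n. 1 + s / (z k)\<^sup>2)" by simp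
  qed
  have lim: "(\<lambda>n. \<Prod>k<n. 1 + s / (z k)\<^sup>2) \<longlonglongrightarrow> bessel_phi \<nu> (-s)" for s
    using product_real[of "-s"] by simp
  have sum_le_prod: "1 + (\<Sum>k<n. 1 / (z k)\<^sup>2) \<le> (\<Prod>k<n. 1 + 1 / (z k)\<^sup>2)" for n
  proof (induction n)
    case (Suc n)
    have "0 \<le> (\<Sum>k<n. 1 / (z k)\<^sup>2)" by (intro sum_nonneg) auto
    hence "1 \<le> (\<Prod>k<n. 1 + 1 / (z k)\<^sup>2)" using Suc by linarith
    hence "1 * (1 / (z n)\<^sup>2) \<le> (\<Prod>k<n. 1 + 1 / (z k)\<^sup>2) * (1 / (z n)\<^sup>2)" by (intro mult_right_mono) auto
    thus ?case using Suc by (simp add: algebra_simps)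
  qed simp
  show sm: "summable (\<lambda>k. 1 / (z k)\<^sup>2)"
  proof (rule summableI_nonneg_bounded)
    fix n show "(\<Sum>k<n. 1 / (z k)\<^sup>2) \<le> bessel_phi \<nu> (-1) "
      using sum_le_prod[of n] incseq_le[OF inc[of 1] lim[of 1], of n] by simp
  qed auto
  let ?S = "\<Sum>k. 1 / (z k)\<^sup>2"
  have up: "bessel_phi \<nu> (-s) \<le> exp (s * ?S)" if "s > 0" for s
  proof (rule LIMSEQ_le_const2[OF lim])
    have "(\<Prod>k<n. 1 + s / (z k)\<^sup>2) \<le> exp (s * ?S)" for n
    proof -
      have "(\<Prod>k<n. 1 + s / (z k)\<^sup>2) \<le> (\<Prod>k<n. exp (s / (z k)\<^sup>2))"
        using that by (intro prod_mono) (auto intro!: add_nonneg_nonneg)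
      also have "\<dots> = exp (s * (\<Sum>k<n. 1 / (z k)\<^sup>2))" by (simp add: exp_sum sum_distrib_left)
      also have "\<dots> \<le> exp (s * ?S)" using that sm by (auto intro!: mult_left_mono sum_le_suminf)
      finally show ?thesis .
    qed
    thus "\<exists>N. \<forall>n\<ge>N. (\<Prod>k<n. 1 + s / (z k)\<^sup>2) \<le> exp (s * ?S)" by blast
  qed
  have low: "1 + s / (4 * (\<nu> + 1)) \<le> bessel_phi \<nu> (-s)" if "s > 0" for s
  proof -
    have t: "bessel_coeff \<nu> k * (-s) ^ k = s ^ k / (4 ^ k * fact k * pochhammer (\<nu> + 1) k)" for k
    proof -
      have "(-1) ^ k * (-s) ^ k = ((-1) * (-s)) ^ k" by (rule power_mult_distrib[symmetric])
      hence "(-1) ^ k * (-s) ^ k = s ^ k" by simp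
      thus ?thesis unfolding bessel_coeff_def by (metis times_divide_eq_left)
    qed
    have "pochhammer (\<nu> + 1) k > 0" for k using nu by (intro pochhammer_pos) auto
    hence "0 \<le> bessel_coeff \<nu> k * (-s) ^ k" for k
      using that less_imp_le[OF \<open>\<And>k. pochhammer (\<nu> + 1) k > 0\<close>] unfolding t by simp
    moreover have "summable (\<lambda>k. bessel_coeff \<nu> k * (-s) ^ k)" using summable_bessel[OF nu, of "-s"] by simp
    ultimately have "(\<Sum>k<2. bessel_coeff \<nu> k * (-s) ^ k) \<le> (\<Sum>k. bessel_coeff \<nu> k * (-s) ^ k)"
      by (intro sum_le_suminf) auto
    also have "\<dots> = bessel_phi \<nu> (-s)" by (simp add: bessel_phi_def)
    finally show ?thesis unfolding t by (simp add: numeral_2_eq_2)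
  qed
  show "1 / (4 * (\<nu> + 1)) \<le> ?S"
  proof -
    \<comment> \<open>A difference quotient at 0, taken from the right because the two bounds are
      available for s > 0.\<close>
    have "((\<lambda>s. (exp (s * ?S) - 1) / s) \<longlongrightarrow> ?S) (at_right 0)"
    proof -
      have "((\<lambda>s. exp (s * ?S)) has_real_derivative exp (0 * ?S) * ?S) (at 0)"
        by (auto intro!: derivative_eq_intros)
      hence "((\<lambda>s. (exp (s * ?S) - 1) / s) \<longlongrightarrow> ?S) (at 0)" by (simp add: has_field_derivative_iff)
      thus ?thesis by (rule filterlim_mono) (auto simp: at_within_le_at)
    qed
    moreover have "eventually (\<lambda>s. 1 / (4 * (\<nu> + 1)) \<le> (exp (s * ?S) - 1) / s) (at_right 0)"
      using eventually_at_right_less[of 0]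
    proof eventually_elim
      case (elim s)
      have "1 + s * (1 / (4 * (\<nu> + 1))) \<le> exp (s * ?S)" using up[of s] low[of s] elim by simp
      thus ?case using elim by (simp add: pos_le_divide_eq mult.commute)
    qed
    ultimately show ?thesis by (intro tendsto_lowerbound) auto
  qed
qed

end

section \<open>Arcsine integrals and bounds from the differential equation\<close>

text \<open>For A = a - w and B = b - w the linear factor in the denominator is (b - a) (u - w), so
  this is the Cauchy transform of the arcsine law; A = B = 1 gives its total mass.\<close>

lemma arcsine_kernel_integral:
  fixes a b A B :: real
  assumes ab: "a < b" and AB: "0 < A" "0 < B"
  defines "f \<equiv> \<lambda>u. (b - a) / ((A * (b - u) + B * (u - a)) * sqrt ((u - a) * (b - u)))"
  shows "set_integrable lborel {a..b} f" "(LBINT u:{a..b}. f u) = pi / sqrt (A * B)"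
proof -
  define \<kappa> where "\<kappa> = sqrt (B / A)"
  \<comment> \<open>The substitution s = sqrt ((u - a) / (b - u)) turns the integrand into a
    multiple of 1 / (A + B s^2).\<close>
  define F where "F u = 2 / sqrt (A * B) * arctan (\<kappa> * sqrt ((u - a) / (b - u)))" for u
  have k: "\<kappa> > 0" "\<kappa>\<^sup>2 = B / A" using AB by (auto simp: \<kappa>_def)
  have sAB: "sqrt (A * B) = \<kappa> * A" using AB unfolding \<kappa>_def
    by (simp add: real_sqrt_divide real_sqrt_mult) (simp add: field_simps)
  have D: "(F has_real_derivative f u) (at u)" if u: "a < u" "u < b" for u
  proof -
    define r where "r = (u - a) / (b - u)"
    define s where "s = sqrt r"
    have r: "r > 0" using u by (simp add: r_def)
    have s: "s > 0" "s\<^sup>2 = r" using r by (auto simp: s_def)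
    have dr: "((\<lambda>u. (u - a) / (b - u)) has_real_derivative (b - a) / (b - u)\<^sup>2) (at u)"
      using u by (auto intro!: derivative_eq_intros simp: power2_eq_square)
    have "(F has_real_derivative 2 / sqrt (A * B) * (inverse (1 + (\<kappa> * s)\<^sup>2) * (\<kappa> * (inverse s / 2 * ((b - a) / (b - u)\<^sup>2))))) (at u)"
      unfolding F_def s_def r_def
      by (rule DERIV_cmult DERIV_chain2[OF DERIV_arctan] DERIV_chain2[OF DERIV_real_sqrt] dr | use r in \<open>simp add: r_def\<close>)+
    moreover have "2 / sqrt (A * B) * (inverse (1 + (\<kappa> * s)\<^sup>2) * (\<kappa> * (inverse s / 2 * ((b - a) / (b - u)\<^sup>2)))) = f u"
    proof -
      have e1: "1 + (\<kappa> * s)\<^sup>2 = (A * (b - u) + B * (u - a)) / (A * (b - u))"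
        using AB u unfolding power_mult_distrib k s r_def by (simp add: field_simps)
      have e2: "sqrt ((u - a) * (b - u)) = s * (b - u)"
      proof (rule real_sqrt_unique)
        have "(s * (b - u))\<^sup>2 = r * (b - u)\<^sup>2" using s by (simp add: power_mult_distrib)
        also have "\<dots> = (u - a) * (b - u)" using u by (simp add: r_def power2_eq_square)
        finally show "(s * (b - u))\<^sup>2 = (u - a) * (b - u)" .
      qed (use s u in simp)
      have pos: "A * (b - u) + B * (u - a) > 0" using AB u by (intro add_pos_pos mult_pos_pos) auto
      define X where "X = A * (b - u) + B * (u - a)"
      show ?thesis unfolding f_def e1 e2 sAB X_def[symmetric]
        using pos[folded X_def] k s AB u by (simp add: divide_simps power2_eq_square) (simp add: algebra_simps)
    qed
    ultimately show ?thesis by simp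
  qed
  have fc: "isCont f u" if u: "a < u" "u < b" for u
  proof -
    have "A * (b - u) + B * (u - a) > 0" using AB u by (intro add_pos_pos mult_pos_pos) auto
    thus ?thesis unfolding f_def using u by (intro continuous_intros) auto
  qed
  have nn: "0 \<le> f u" if u: "a < u" "u < b" for u unfolding f_def using AB u
    by (intro divide_nonneg_nonneg mult_nonneg_nonneg add_nonneg_nonneg) auto
  have L: "(F \<longlongrightarrow> 0) (at_right a)"
  proof -
    have "isCont F a" unfolding F_def using ab by (intro continuous_intros) auto
    hence "(F \<longlongrightarrow> F a) (at_right a)" by (simp add: isCont_def filterlim_at_split)
    thus ?thesis by (simp add: F_def)
  qed
  have U: "(F \<longlongrightarrow> 2 / sqrt (A * B) * (pi / 2)) (at_left b)"
  proof -
    have "filterlim (\<lambda>u. (u - a) / (b - u)) at_top (at_left b)"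
    proof (rule LIM_at_top_divide)
      show "((\<lambda>u. u - a) \<longlongrightarrow> b - a) (at_left b)" by (intro tendsto_intros)
      have "((\<lambda>u. b - u) \<longlongrightarrow> b - b) (at_left b)" by (intro tendsto_intros)
      thus "((\<lambda>u. b - u) \<longlongrightarrow> 0) (at_left b)" by simp
      show "\<forall>\<^sub>F x in at_left b. 0 < b - x" by (auto simp: eventually_at_filter)
    qed (use ab in simp)
    hence "filterlim (\<lambda>u. sqrt ((u - a) / (b - u))) at_top (at_left b)"
      by (rule filterlim_compose[OF sqrt_at_top])
    hence "filterlim (\<lambda>u. \<kappa> * sqrt ((u - a) / (b - u))) at_top (at_left b)"
      using k by (intro filterlim_tendsto_pos_mult_at_top[OF tendsto_const]) auto
    hence "((\<lambda>u. arctan (\<kappa> * sqrt ((u - a) / (b - u)))) \<longlongrightarrow> pi / 2) (at_left b)"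
      by (rule filterlim_compose[OF tendsto_arctan_at_top])
    thus ?thesis unfolding F_def by (intro tendsto_intros)
  qed
  have I: "set_integrable lborel (einterval a b) f"
    "(LBINT x=a..b. f x) = 2 / sqrt (A * B) * (pi / 2) - 0"
    by (rule interval_integral_FTC_nonneg[where F = F];
        use ab D fc nn L U in \<open>auto simp: ereal_tendsto_simps\<close>)+
  have ae: "AE u in lborel. indicator {a<..<b} u *\<^sub>R f u = indicator {a..b} u *\<^sub>R f u"
    using AE_lborel_singleton[of a] AE_lborel_singleton[of b] by eventually_elim (auto simp: indicator_def)
  have m: "f \<in> borel_measurable borel" unfolding f_def by measurable
  show "set_integrable lborel {a..b} f" using I(1)
    unfolding set_integrable_def einterval_eq
    by (rule integrable_cong_AE[THEN iffD1, OF _ _ ae, rotated 2]) (use m in measurable)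
  have "(LBINT u:{a..b}. f u) = (LBINT u:{a<..<b}. f u)"
    unfolding set_lebesgue_integral_def
    by (rule integral_cong_AE) (use m ae in \<open>auto elim: AE_mp\<close>)
  also have "\<dots> = (LBINT x=a..b. f x)" using ab by (simp add: interval_lebesgue_integral_def einterval_eq)
  also have "\<dots> = pi / sqrt (A * B)" using I(2) by simp
  finally show "(LBINT u:{a..b}. f u) = pi / sqrt (A * B)" .
qed

lemma arcsine_integral:
  fixes a b :: real
  assumes ab: "a < b"
  shows "set_integrable lborel {a..b} (\<lambda>u. 1 / sqrt ((u - a) * (b - u)))"
    "(LBINT u:{a..b}. 1 / sqrt ((u - a) * (b - u))) = pi"
proof -
  have e: "(b - a) / ((1 * (b - u) + 1 * (u - a)) * sqrt ((u - a) * (b - u))) = 1 / sqrt ((u - a) * (b - u))" for u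
    using ab by simp
  show "set_integrable lborel {a..b} (\<lambda>u. 1 / sqrt ((u - a) * (b - u)))"
    "(LBINT u:{a..b}. 1 / sqrt ((u - a) * (b - u))) = pi"
    using arcsine_kernel_integral[OF ab, of 1 1, unfolded e] by auto
qed

text \<open>The integrands of interest blow up like inverse square roots at both end points, which
  are null; hence a bound in the open interval is enough.\<close>

lemma arcsine_dominated:
  fixes a b C :: real and f :: "real \<Rightarrow> real"
  assumes ab: "a < b" and m: "f \<in> borel_measurable borel"
    and le: "\<And>u. a < u \<Longrightarrow> u < b \<Longrightarrow> \<bar>f u\<bar> \<le> C / sqrt ((u - a) * (b - u))"
  shows "set_integrable lborel {a..b} f" "\<bar>LBINT u:{a..b}. f u\<bar> \<le> C * pi"
proof -
  let ?g = "\<lambda>u. C / sqrt ((u - a) * (b - u))"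
  have g: "set_integrable lborel {a..b} ?g" "(LBINT u:{a..b}. ?g u) = C * pi"
    using set_integrable_mult_right[OF arcsine_integral(1)[OF ab], of C] arcsine_integral(2)[OF ab]
      set_integral_mult_right[where a = C and M = lborel and A = "{a..b}" and f = "\<lambda>u. 1 / sqrt ((u - a) * (b - u))"] by auto
  have ae: "AE u in lborel. norm (indicator {a..b} u *\<^sub>R f u) \<le> indicator {a..b} u *\<^sub>R ?g u"
    using AE_lborel_singleton[of a] AE_lborel_singleton[of b]
  proof eventually_elim
    case (elim u)
    thus ?case using le[of u] by (auto simp: indicator_def)
  qed
  show i: "set_integrable lborel {a..b} f" unfolding set_integrable_def
    by (rule Bochner_Integration.integrable_bound[OF g(1)[unfolded set_integrable_def]])
       (use m ae in \<open>auto elim!: eventually_mono intro: order_trans[OF _ abs_ge_self] simp del: abs_mult abs_divide\<close>)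
  have "\<bar>LBINT u:{a..b}. f u\<bar> \<le> (LBINT u:{a..b}. ?g u)"
    unfolding set_lebesgue_integral_def
    by (rule order_trans[OF integral_norm_bound[where 'a=real, unfolded real_norm_def]])
       (rule integral_mono_AE, use i g ae in \<open>auto simp: set_integrable_def\<close>)
  thus "\<bar>LBINT u:{a..b}. f u\<bar> \<le> C * pi" using g by simp
qed

section \<open>Sturm comparison and energy for v'' + (1 - \<beta>/t^2) v = 0\<close>

lemma ode_gap_le:
  fixes v v' :: "real \<Rightarrow> real"
  assumes a: "0 < a" "a < b" "2 * \<bar>\<beta>\<bar> \<le> a\<^sup>2"
    and v: "\<And>t. t \<in> {a..b} \<Longrightarrow> (v has_real_derivative v' t) (at t)"
    and v': "\<And>t. t \<in> {a..b} \<Longrightarrow> (v' has_real_derivative - (1 - \<beta> / t\<^sup>2) * v t) (at t)"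
    and pos: "\<And>t. a < t \<Longrightarrow> t < b \<Longrightarrow> 0 < v t" and va: "v a = 0"
  shows "b - a \<le> sqrt 2 * pi"
proof (rule ccontr)
  \<comment> \<open>The zero after a of sin ((t - a) / sqrt 2), a solution of y'' + y/2 = 0. The
    assumption on \<beta> makes the coefficient 1 - \<beta>/t^2 at least 1/2 from a on, so v must
    vanish no later.\<close>
  define d where "d = a + sqrt 2 * pi"
  assume "\<not> b - a \<le> sqrt 2 * pi"
  hence d: "a < d" "d < b" by (auto simp: d_def)
  define k :: real where "k = 1 / sqrt 2"
  have kk: "k * (sqrt 2 * pi) = pi" "k > 0" "k * k = 1 / 2" by (simp_all add: k_def)
  \<comment> \<open>The Wronskian of v and the comparison sine. It does not increase while the sine
    and v are nonnegative, yet it would rise from 0 at a to \<open>k * v d\<close> at d.\<close>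
  define W where "W t = v' t * sin (k * (t - a)) - v t * (k * cos (k * (t - a)))" for t
  have "W d \<le> W a"
  proof (rule DERIV_nonpos_imp_nonincreasing[OF less_imp_le[OF d(1)]])
    fix t assume t: "a \<le> t" "t \<le> d"
    have "k * (t - a) \<le> k * (sqrt 2 * pi)" using t kk(2) by (intro mult_left_mono) (auto simp: d_def)
    hence ang: "0 \<le> k * (t - a)" "k * (t - a) \<le> pi" using t kk by auto
    have "(W has_real_derivative
        (- (1 - \<beta> / t\<^sup>2) * v t) * sin (k * (t - a)) + (cos (k * (t - a)) * k) * v' t
        - (v' t * (k * cos (k * (t - a))) + (k * (- sin (k * (t - a)) * k)) * v t)) (at t)"
      unfolding W_def using t d v[of t] v'[of t] by (auto intro!: derivative_eq_intros)
    moreover have "(- (1 - \<beta> / t\<^sup>2) * v t) * sin (k * (t - a)) + (cos (k * (t - a)) * k) * v' t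
        - (v' t * (k * cos (k * (t - a))) + (k * (- sin (k * (t - a)) * k)) * v t)
      = (k * k - (1 - \<beta> / t\<^sup>2)) * (v t * sin (k * (t - a)))" by (simp add: algebra_simps)
    ultimately have "(W has_real_derivative (1/2 - (1 - \<beta> / t\<^sup>2)) * (v t * sin (k * (t - a)))) (at t)"
      unfolding kk by simp
    moreover have "v t \<ge> 0" using pos[of t] t d va by (cases "t = a") auto
    moreover have "sin (k * (t - a)) \<ge> 0" using ang by (rule sin_ge_zero)
    moreover have "1/2 - (1 - \<beta> / t\<^sup>2) \<le> 0"
    proof -
      have "a\<^sup>2 \<le> t\<^sup>2" using t a by (intro power_mono) auto
      hence "2 * \<beta> \<le> t\<^sup>2" using a by linarith
      moreover have "t\<^sup>2 > 0" using t a by auto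
      ultimately show ?thesis by (simp add: field_simps)
    qed
    ultimately show "\<exists>y. (W has_real_derivative y) (at t) \<and> y \<le> 0"
      by (intro exI conjI) (auto intro: mult_nonpos_nonneg)
  qed
  moreover have "W a = 0" using va by (simp add: W_def)
  moreover have "W d = v d * k" unfolding W_def d_def add_diff_cancel_left' kk(1) by simp
  moreover have "v d > 0" using pos[OF d] .
  ultimately show False using kk(2) by (simp add: mult_le_0_iff)
qed

text \<open>At the maximum m the derivative vanishes, so the energy there consists of the v term
  alone and bounds v m from below by sqrt (e/2) / b. Where v >= 0 the equation makes v concave,
  hence v lies above the tent with apex at m, and the tent lies above the parabola in the
  claim.\<close>

lemma ode_hump_lower_bound:
  fixes v v' :: "real \<Rightarrow> real"
  assumes a: "0 < a" "a < b" "2 * \<bar>\<beta>\<bar> \<le> a\<^sup>2"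
    and v: "\<And>t. t \<in> {a..b} \<Longrightarrow> (v has_real_derivative v' t) (at t)"
    and v': "\<And>t. t \<in> {a..b} \<Longrightarrow> (v' has_real_derivative - (1 - \<beta> / t\<^sup>2) * v t) (at t)"
    and pos: "\<And>t. a < t \<Longrightarrow> t < b \<Longrightarrow> 0 < v t" and va: "v a = 0" and vb: "v b = 0"
    and e: "0 < e" "\<And>t. t \<in> {a..b} \<Longrightarrow> e \<le> t\<^sup>2 * (v' t)\<^sup>2 + (t\<^sup>2 - \<beta>) * (v t)\<^sup>2"
    and u: "u \<in> {a..b}"
  shows "sqrt (e / 2) / b * ((u - a) * (b - u) / (b - a)\<^sup>2) \<le> v u"
proof -
  have vnn: "v t \<ge> 0" if "t \<in> {a..b}" for t
    using pos[of t] va vb that by (cases "t = a"; cases "t = b") auto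
  have tsq: "2 * \<bar>\<beta>\<bar> \<le> t\<^sup>2" "t > 0" if "t \<in> {a..b}" for t
  proof -
    have "a\<^sup>2 \<le> t\<^sup>2" using that a by (intro power_mono) auto
    thus "2 * \<bar>\<beta>\<bar> \<le> t\<^sup>2" using a by linarith
    show "t > 0" using a that by auto
  qed
  have cont: "continuous_on {a..b} v" using v by (meson DERIV_isCont continuous_at_imp_continuous_on)
  obtain m where m: "m \<in> {a..b}" "\<And>t. t \<in> {a..b} \<Longrightarrow> v t \<le> v m"
    using continuous_attains_sup[of "{a..b}" v] cont a by auto
  have "v ((a + b) / 2) > 0" using a by (intro pos) auto
  hence vm: "v m > 0" using m(2)[of "(a + b) / 2"] a by auto
  hence m': "a < m" "m < b" using m(1) va vb by (auto simp: less_le)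
  have "v' m = 0"
  proof (rule DERIV_local_max[OF v[OF m(1)]])
    show "0 < min (m - a) (b - m)" using m' by auto
    show "\<forall>y. \<bar>m - y\<bar> < min (m - a) (b - m) \<longrightarrow> v y \<le> v m" by (auto intro!: m(2))
  qed
  hence "e \<le> (m\<^sup>2 - \<beta>) * (v m)\<^sup>2" using e(2)[OF m(1)] by simp
  also have "\<dots> \<le> (2 * b\<^sup>2) * (v m)\<^sup>2"
  proof (rule mult_right_mono)
    have "m\<^sup>2 \<le> b\<^sup>2" using m' a by (intro power_mono) auto
    thus "m\<^sup>2 - \<beta> \<le> 2 * b\<^sup>2" using tsq[OF m(1)] by linarith
  qed simp
  finally have "e / 2 \<le> (b * v m)\<^sup>2" by (simp add: power_mult_distrib)
  hence "sqrt (e / 2) \<le> b * v m" using a vm by (intro real_le_lsqrt) auto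
  hence M: "sqrt (e / 2) / b \<le> v m" using a by (simp add: field_simps)
  have conc: "concave_on {a..b} v"
  proof (rule f''_le0_imp_concave)
    fix t assume t: "t \<in> {a..b}"
    have "\<beta> \<le> t\<^sup>2" using tsq[OF t] by linarith
    hence "0 \<le> 1 - \<beta> / t\<^sup>2" using tsq[OF t] by (simp add: field_simps)
    thus "- (1 - \<beta> / t\<^sup>2) * v t \<le> 0" using vnn[OF t] by (intro mult_nonpos_nonneg) auto
  qed (use v v' in auto)
  have key: "(u - a) * (b - u) / (b - a)\<^sup>2 * v m \<le> v u"
  proof (cases "u \<le> m")
    case True
    have "convex_on {a..m} (\<lambda>t. - v t)"
      using conc m' unfolding concave_on_def by (auto intro: convex_on_subset)
    from convex_onD_Icc'[OF this, of u] True u have "v m / (m - a) * (u - a) \<le> v u" by (simp add: va)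
    moreover have "(u - a) * (b - u) / (b - a)\<^sup>2 * v m \<le> v m / (m - a) * (u - a)"
    proof -
      have "(b - u) / (b - a)\<^sup>2 \<le> (b - a) / (b - a)\<^sup>2" using u by (intro divide_right_mono) auto
      also have "\<dots> = 1 / (b - a)" by (simp add: power2_eq_square)
      also have "\<dots> \<le> 1 / (m - a)" using m' by (intro divide_left_mono) auto
      finally have "(b - u) / (b - a)\<^sup>2 * (v m * (u - a)) \<le> 1 / (m - a) * (v m * (u - a))"
        using vm u by (intro mult_right_mono) auto
      thus ?thesis by (simp add: mult_ac)
    qed
    ultimately show ?thesis by linarith
  next
    case False
    have "convex_on {m..b} (\<lambda>t. - v t)"
      using conc m' unfolding concave_on_def by (auto intro: convex_on_subset)
    from convex_onD_Icc''[OF this, of u] False u have "v m / (b - m) * (b - u) \<le> v u" by (simp add: vb)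
    moreover have "(u - a) * (b - u) / (b - a)\<^sup>2 * v m \<le> v m / (b - m) * (b - u)"
    proof -
      have "(u - a) / (b - a)\<^sup>2 \<le> (b - a) / (b - a)\<^sup>2" using u by (intro divide_right_mono) auto
      also have "\<dots> = 1 / (b - a)" by (simp add: power2_eq_square)
      also have "\<dots> \<le> 1 / (b - m)" using m' by (intro divide_left_mono) auto
      finally have "(u - a) / (b - a)\<^sup>2 * (v m * (b - u)) \<le> 1 / (b - m) * (v m * (b - u))"
        using vm u by (intro mult_right_mono) auto
      thus ?thesis by (simp add: mult_ac)
    qed
    ultimately show ?thesis by linarith
  qed
  have "sqrt (e / 2) / b * ((u - a) * (b - u) / (b - a)\<^sup>2) \<le> v m * ((u - a) * (b - u) / (b - a)\<^sup>2)"
    using u by (intro mult_right_mono[OF M]) auto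
  thus ?thesis using key by (simp add: mult_ac)
qed

text \<open>The weight t^2 turns the coefficient 1 - \<beta>/t^2 into t^2 - \<beta>, so the mixed
  terms v v' cancel and the derivative is 2 t (v'^2 + v^2).\<close>

lemma ode_energy_mono:
  fixes v v' :: "real \<Rightarrow> real"
  assumes "0 < s" "s \<le> r"
    and v: "\<And>t. t \<in> {s..r} \<Longrightarrow> (v has_real_derivative v' t) (at t)"
    and v': "\<And>t. t \<in> {s..r} \<Longrightarrow> (v' has_real_derivative - (1 - \<beta> / t\<^sup>2) * v t) (at t)"
  shows "s\<^sup>2 * (v' s)\<^sup>2 + (s\<^sup>2 - \<beta>) * (v s)\<^sup>2 \<le> r\<^sup>2 * (v' r)\<^sup>2 + (r\<^sup>2 - \<beta>) * (v r)\<^sup>2"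
proof (rule DERIV_nonneg_imp_nondecreasing[OF assms(2), where f="\<lambda>t. t\<^sup>2 * (v' t)\<^sup>2 + (t\<^sup>2 - \<beta>) * (v t)\<^sup>2"])
  fix t assume t: "s \<le> t" "t \<le> r"
  hence t0: "t > 0" using assms by simp
  have "((\<lambda>t. t\<^sup>2 * (v' t)\<^sup>2 + (t\<^sup>2 - \<beta>) * (v t)\<^sup>2) has_real_derivative
     2 * t * (v' t)\<^sup>2 + t\<^sup>2 * (2 * v' t * (- (1 - \<beta> / t\<^sup>2) * v t)) + (2 * t * (v t)\<^sup>2 + (t\<^sup>2 - \<beta>) * (2 * v t * v' t))) (at t)"
    using t v[of t] v'[of t] by (auto intro!: derivative_eq_intros)
  moreover have "t\<^sup>2 * (2 * v' t * (- (1 - \<beta> / t\<^sup>2) * v t)) = - (t\<^sup>2 - \<beta>) * (2 * v t * v' t)"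
    using t0 by (simp add: field_simps)
  ultimately have "((\<lambda>t. t\<^sup>2 * (v' t)\<^sup>2 + (t\<^sup>2 - \<beta>) * (v t)\<^sup>2) has_real_derivative 2 * t * ((v' t)\<^sup>2 + (v t)\<^sup>2)) (at t)"
    by (simp add: algebra_simps)
  thus "\<exists>y. ((\<lambda>t. t\<^sup>2 * (v' t)\<^sup>2 + (t\<^sup>2 - \<beta>) * (v t)\<^sup>2) has_real_derivative y) (at t) \<and> 0 \<le> y"
    using t0 by (intro exI conjI) auto
qed


section \<open>Integrals between consecutive zeros of the Bessel function\<close>

context bessel_zeros
begin

text \<open>Up to a constant factor, $\sqrt t\, J_\nu(t)$ and its derivative.\<close>

definition "vfun t = t powr (\<nu> + 1/2) * bessel_phi \<nu> (t\<^sup>2)"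
definition "vder t = (\<nu> + 1/2) / t * vfun t
   - t powr (- (\<nu> + 1/2)) * (t powr (2 * \<nu> + 2) * bessel_phi (\<nu> + 1) (t\<^sup>2)) / (2 * (\<nu> + 1))"

text \<open>Bessel's equation in Liouville normal form, with \<beta> = \<nu>^2 - 1/4: the factor
  sqrt t removes the first order term.\<close>

lemma vfun_ode:
  assumes t: "0 < t"
  shows "(vfun has_real_derivative vder t) (at t)"
    and "(vder has_real_derivative - (1 - (\<nu> + 1/2) * (\<nu> - 1/2) / t\<^sup>2) * vfun t) (at t)"
proof -
  define \<alpha> where "\<alpha> = \<nu> + 1/2"
  have al: "2 * \<nu> + 1 = \<alpha> + \<alpha>" "2 * \<nu> + 2 = \<alpha> + \<alpha> + 1" "\<nu> + 1 \<noteq> 0" using nu by (auto simp: \<alpha>_def)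
  \<comment> \<open>The next order enters \<open>vder\<close> through U because the derivative of U
    is a multiple of t^\<alpha> \<open>vfun\<close>; differentiating again thus brings in no further
    order.\<close>
  define U where "U = (\<lambda>t. t powr (2 * \<nu> + 2) * bessel_phi (\<nu> + 1) (t\<^sup>2))"
  have d1: "((\<lambda>t. bessel_phi \<nu> (t\<^sup>2)) has_real_derivative - (t / (2 * (\<nu> + 1)) * bessel_phi (\<nu> + 1) (t\<^sup>2))) (at t)"
    using bessel_phi_real_derivs(1)[OF nu, of 1 t UNIV] by simp
  have d2: "((\<lambda>t. t powr (2 * \<nu> + 2) * bessel_phi (\<nu> + 1) (t\<^sup>2)) has_real_derivative
           2 * (\<nu> + 1) * t powr (2 * \<nu> + 1) * bessel_phi \<nu> (t\<^sup>2)) (at t)"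
    using bessel_phi_real_derivs(2)[OF nu t, of 1 UNIV] by simp
  have pw: "((\<lambda>t. t powr p) has_real_derivative p * t powr p / t) (at t)" for p
    using has_real_derivative_powr[OF t, of p] t by (simp add: powr_diff)
  show dv: "(vfun has_real_derivative vder t) (at t)"
  proof -
    have "(vfun has_real_derivative
       (\<alpha> * t powr \<alpha> / t) * bessel_phi \<nu> (t\<^sup>2) + (- (t / (2 * (\<nu> + 1)) * bessel_phi (\<nu> + 1) (t\<^sup>2))) * t powr \<alpha>) (at t)"
      unfolding vfun_def[abs_def] \<alpha>_def[symmetric] by (intro DERIV_mult pw d1)
    moreover have e: "t powr (- \<alpha>) * t powr (2 * \<nu> + 2) = t * t powr \<alpha>"
      using t unfolding al powr_add by (simp add: powr_minus)
    have "vder t = \<alpha> / t * (t powr \<alpha> * bessel_phi \<nu> (t\<^sup>2))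
        - (t powr (- \<alpha>) * t powr (2 * \<nu> + 2)) * bessel_phi (\<nu> + 1) (t\<^sup>2) / (2 * (\<nu> + 1))"
      unfolding vder_def vfun_def \<alpha>_def[symmetric] by (simp only: mult.assoc)
    ultimately show ?thesis unfolding e by (simp add: mult_ac)
  qed
  have dU: "(U has_real_derivative (2 * (\<nu> + 1)) * t powr \<alpha> * vfun t) (at t)"
    using d2 unfolding U_def vfun_def \<alpha>_def[symmetric] al(1) powr_add by (simp add: mult_ac)
  define c where "c = 2 * (\<nu> + 1)"
  have c: "c \<noteq> 0" using al(3) by (simp add: c_def)
  have vd: "vder t = \<alpha> / t * vfun t - t powr (- \<alpha>) * U t / c" for t
    by (simp add: vder_def U_def \<alpha>_def c_def)
  have "(vder has_real_derivative
      (- \<alpha> / t\<^sup>2) * vfun t + vder t * (\<alpha> / t)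
      - ((- \<alpha> * t powr (- \<alpha>) / t) * U t + (c * t powr \<alpha> * vfun t) * t powr (- \<alpha>)) / c) (at t)"
  proof -
    have "((\<lambda>t. \<alpha> / t) has_real_derivative - \<alpha> / t\<^sup>2) (at t)"
      using t by (auto intro!: derivative_eq_intros simp: power2_eq_square)
    hence "((\<lambda>t. \<alpha> / t * vfun t - t powr (- \<alpha>) * U t / c) has_real_derivative
      (- \<alpha> / t\<^sup>2) * vfun t + vder t * (\<alpha> / t)
      - ((- \<alpha> * t powr (- \<alpha>) / t) * U t + (c * t powr \<alpha> * vfun t) * t powr (- \<alpha>)) / c) (at t)"
      by (intro DERIV_diff DERIV_mult DERIV_cdivide dv pw dU[folded c_def])
    thus ?thesis by (simp only: vd[abs_def])
  qed
  moreover have "(- \<alpha> / t\<^sup>2) * vfun t + vder t * (\<alpha> / t)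
      - ((- \<alpha> * t powr (- \<alpha>) / t) * U t + (c * t powr \<alpha> * vfun t) * t powr (- \<alpha>)) / c
     = - (1 - \<alpha> * (\<alpha> - 1) / t\<^sup>2) * vfun t"
  proof -
    have "t powr \<alpha> * t powr (- \<alpha>) = 1" using t by (simp add: powr_minus)
    hence e: "(c * t powr \<alpha> * vfun t) * t powr (- \<alpha>) = c * vfun t" by (simp add: mult_ac)
    define Q where "Q = t powr (- \<alpha>) * U t / c"
    have e2: "((- \<alpha> * t powr (- \<alpha>) / t) * U t + c * vfun t) / c = - \<alpha> / t * Q + vfun t"
      using c t by (simp add: Q_def field_simps)
    thus ?thesis unfolding e e2 vd Q_def[symmetric] using t by (simp add: field_simps power2_eq_square)
  qed
  ultimately show "(vder has_real_derivative - (1 - (\<nu> + 1/2) * (\<nu> - 1/2) / t\<^sup>2) * vfun t) (at t)"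
    by (simp add: \<alpha>_def)
qed

lemma no_zero_between: "z n < u \<Longrightarrow> u < z (Suc n) \<Longrightarrow> bessel_phi \<nu> (u\<^sup>2) \<noteq> 0"
proof
  assume u: "z n < u" "u < z (Suc n)" and 0: "bessel_phi \<nu> (u\<^sup>2) = 0"
  have "u \<in> range z" unfolding range_z using u 0 z_pos[of n] by auto
  then obtain k where "u = z k" by auto
  thus False using u mono by (simp add: strict_mono_less)
qed

lemma z_at_top: "filterlim z at_top sequentially"
proof -
  have "filterlim (\<lambda>k. sqrt ((z k)\<^sup>2)) at_top sequentially"
    by (rule filterlim_compose[OF sqrt_at_top zsq_at_top])
  thus ?thesis using z_pos by (simp add: less_imp_le)
qed

lemma integrand_measurable: "(\<lambda>u. exp (- c * u\<^sup>2) / (u * sqrt \<bar>bessel_phi \<nu> (u\<^sup>2)\<bar>)) \<in> borel_measurable borel"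
proof -
  have "(\<lambda>u. bessel_phi \<nu> (u\<^sup>2) :: real) \<in> borel_measurable borel"
    by (intro borel_measurable_continuous_onI continuous_intros nu)
  thus ?thesis by measurable
qed

text \<open>The two end zeros are divided out of the entire function; the quotient has no zero on
  the closed interval, so its modulus has a positive minimum. The constant depends on n; uniformity
  in n is the task of the differential equation.\<close>

lemma phi_lower_bound:
  shows "\<exists>c>0. \<forall>u\<in>{z n..z (Suc n)}. c * ((u - z n) * (z (Suc n) - u)) \<le> \<bar>bessel_phi \<nu> (u\<^sup>2)\<bar>"
proof -
  let ?a = "z n" and ?b = "z (Suc n)"
  have ab: "0 < ?a" "?a < ?b" using z_pos mono by (auto simp: strict_mono_less)
  define A where "A = {complex_of_real (?a\<^sup>2), complex_of_real (?b\<^sup>2)}"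
  have "\<exists>g. g holomorphic_on UNIV \<and> (\<forall>w. bessel_phi \<nu> w = (\<Prod>a\<in>A. 1 - w / a) * g w)
            \<and> (\<forall>w. g w = 0 \<longrightarrow> bessel_phi \<nu> w = 0 \<and> w \<notin> A)"
  proof (rule simple_zeros_factor[OF _ phi_holomorphic])
    fix a assume "a \<in> A"
    then obtain k where a: "a = of_real ((z k)\<^sup>2)" by (auto simp: A_def)
    show "bessel_phi \<nu> a = 0 \<and> deriv (bessel_phi \<nu>) a \<noteq> 0 \<and> a \<noteq> 0"
      unfolding a using deriv_phi_z[of k] complex_zeros[of "of_real ((z k)\<^sup>2)"] z_pos[of k] by auto
  qed (simp add: A_def)
  then obtain g where g: "g holomorphic_on UNIV" "\<And>w. bessel_phi \<nu> w = (\<Prod>a\<in>A. 1 - w / a) * g w"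
    "\<And>w. g w = 0 \<Longrightarrow> bessel_phi \<nu> w = 0 \<and> w \<notin> A" by blast
  have gnz: "g (of_real (u\<^sup>2)) \<noteq> 0" if u: "u \<in> {?a..?b}" for u
  proof
    assume 0: "g (of_real (u\<^sup>2)) = 0"
    hence "bessel_phi \<nu> (u\<^sup>2) = 0" using g(3) of_real_bessel_phi[OF nu, of "u\<^sup>2"] by (metis of_real_eq_0_iff)
    hence "u = ?a \<or> u = ?b" using no_zero_between[of n u] u by fastforce
    thus False using g(3)[OF 0] by (auto simp: A_def)
  qed
  have "continuous_on {?a..?b} (\<lambda>u. norm (g (of_real (u\<^sup>2))))"
    by (intro continuous_on_norm continuous_on_compose2[OF holomorphic_on_imp_continuous_on[OF g(1)]]
        continuous_intros) auto
  then obtain m where m: "m \<in> {?a..?b}" "\<And>u. u \<in> {?a..?b} \<Longrightarrow> norm (g (of_real (m\<^sup>2))) \<le> norm (g (of_real (u\<^sup>2)))"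
    using continuous_attains_inf[of "{?a..?b}" "\<lambda>u. norm (g (of_real (u\<^sup>2)))"] ab by auto
  define c where "c = norm (g (of_real (m\<^sup>2)))"
  have c: "c > 0" using gnz[OF m(1)] by (simp add: c_def)
  \<comment> \<open>The denominators come from |1 - u^2/a^2| >= (u - a)/a and |1 - u^2/b^2| >= (b -
    u)/b.\<close>
  have "c / (?a * ?b) * ((u - ?a) * (?b - u)) \<le> \<bar>bessel_phi \<nu> (u\<^sup>2)\<bar>" if u: "u \<in> {?a..?b}" for u
  proof -
    have "complex_of_real (?a\<^sup>2) \<noteq> of_real (?b\<^sup>2)"
      using ab by (simp add: power2_eq_iff del: of_real_power)
    hence "bessel_phi \<nu> (complex_of_real (u\<^sup>2))
        = (1 - of_real (u\<^sup>2) / of_real (?a\<^sup>2)) * (1 - of_real (u\<^sup>2) / of_real (?b\<^sup>2)) * g (of_real (u\<^sup>2))"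
      unfolding g(2)[of "of_real (u\<^sup>2)"] A_def by simp
    also have "\<dots> = of_real ((1 - u\<^sup>2 / ?a\<^sup>2) * (1 - u\<^sup>2 / ?b\<^sup>2)) * g (of_real (u\<^sup>2))" by simp
    finally have "\<bar>bessel_phi \<nu> (u\<^sup>2)\<bar> = \<bar>(1 - u\<^sup>2 / ?a\<^sup>2) * (1 - u\<^sup>2 / ?b\<^sup>2)\<bar> * norm (g (of_real (u\<^sup>2)))"
      using of_real_bessel_phi[OF nu, of "u\<^sup>2"] by (metis norm_mult norm_of_real)
    moreover have "(u - ?a) * (?b - u) / (?a * ?b) \<le> \<bar>(1 - u\<^sup>2 / ?a\<^sup>2) * (1 - u\<^sup>2 / ?b\<^sup>2)\<bar>"
    proof -
      have "(u - ?a) / ?a \<le> \<bar>1 - u\<^sup>2 / ?a\<^sup>2\<bar>"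
      proof -
        have "\<bar>1 - u\<^sup>2 / ?a\<^sup>2\<bar> = (u - ?a) / ?a * ((u + ?a) / ?a)"
        proof -
          have "1 \<le> u\<^sup>2 / ?a\<^sup>2" using u ab by (simp add: power_mono)
          thus ?thesis using ab by (simp add: field_simps power2_eq_square)
        qed
        moreover have "1 \<le> (u + ?a) / ?a" using u ab by simp
        ultimately show ?thesis using u ab mult_left_mono[of 1 "(u + ?a) / ?a" "(u - ?a) / ?a"] by simp
      qed
      moreover have "(?b - u) / ?b \<le> \<bar>1 - u\<^sup>2 / ?b\<^sup>2\<bar>"
      proof -
        have "\<bar>1 - u\<^sup>2 / ?b\<^sup>2\<bar> = (?b - u) / ?b * ((u + ?b) / ?b)"
        proof -
          have "u\<^sup>2 / ?b\<^sup>2 \<le> 1" using u ab by (simp add: power_mono)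
          thus ?thesis using ab by (simp add: field_simps power2_eq_square)
        qed
        moreover have "1 \<le> (u + ?b) / ?b" using u ab by simp
        ultimately show ?thesis using u ab mult_left_mono[of 1 "(u + ?b) / ?b" "(?b - u) / ?b"] by simp
      qed
      ultimately have "(u - ?a) / ?a * ((?b - u) / ?b) \<le> \<bar>1 - u\<^sup>2 / ?a\<^sup>2\<bar> * \<bar>1 - u\<^sup>2 / ?b\<^sup>2\<bar>"
        using u ab by (intro mult_mono) auto
      thus ?thesis by (simp add: abs_mult)
    qed
    moreover have "c \<le> norm (g (of_real (u\<^sup>2)))" using m(2)[OF u] by (simp add: c_def)
    ultimately show ?thesis using c u ab mult_mono[of "(u - ?a) * (?b - u) / (?a * ?b)" "\<bar>(1 - u\<^sup>2 / ?a\<^sup>2) * (1 - u\<^sup>2 / ?b\<^sup>2)\<bar>" c "norm (g (of_real (u\<^sup>2)))"]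
      by (simp add: mult_ac)
  qed
  thus ?thesis using c ab by (intro exI[of _ "c / (?a * ?b)"]) auto
qed

lemma integrand_integrable:
  assumes c: "0 \<le> c"
  shows "set_integrable lborel {z n..z (Suc n)} (\<lambda>u. exp (- c * u\<^sup>2) / (u * sqrt \<bar>bessel_phi \<nu> (u\<^sup>2)\<bar>))"
proof -
  let ?a = "z n" and ?b = "z (Suc n)"
  have ab: "0 < ?a" "?a < ?b" using z_pos mono by (auto simp: strict_mono_less)
  obtain d where d: "d > 0" "\<And>u. u \<in> {?a..?b} \<Longrightarrow> d * ((u - ?a) * (?b - u)) \<le> \<bar>bessel_phi \<nu> (u\<^sup>2)\<bar>"
    using phi_lower_bound[of n] by auto
  show ?thesis
  proof (rule arcsine_dominated(1)[OF ab(2) integrand_measurable, where C = "1 / (?a * sqrt d)"])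
    fix u assume u: "?a < u" "u < ?b"
    let ?p = "(u - ?a) * (?b - u)"
    have p: "?p > 0" using u by simp
    have "sqrt d * sqrt ?p \<le> sqrt \<bar>bessel_phi \<nu> (u\<^sup>2)\<bar>"
      unfolding real_sqrt_mult[symmetric] using d(2)[of u] u by simp
    hence "?a * (sqrt d * sqrt ?p) \<le> u * sqrt \<bar>bessel_phi \<nu> (u\<^sup>2)\<bar>" using u ab d p by (intro mult_mono) auto
    moreover have "exp (- c * u\<^sup>2) \<le> 1" using c by simp
    moreover have "0 < ?a * (sqrt d * sqrt ?p)" using ab d p by (intro mult_pos_pos) auto
    ultimately have "exp (- c * u\<^sup>2) / (u * sqrt \<bar>bessel_phi \<nu> (u\<^sup>2)\<bar>) \<le> 1 / (?a * (sqrt d * sqrt ?p))"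
      by (intro frac_le) auto
    thus "\<bar>exp (- c * u\<^sup>2) / (u * sqrt \<bar>bessel_phi \<nu> (u\<^sup>2)\<bar>)\<bar> \<le> 1 / (?a * sqrt d) / sqrt ?p"
      using u ab by (simp add: mult_ac)
  qed
qed

lemma vfun_sign:
  obtains \<sigma> :: real where "\<bar>\<sigma>\<bar> = 1" "\<And>t. z n < t \<Longrightarrow> t < z (Suc n) \<Longrightarrow> 0 < \<sigma> * vfun t"
proof -
  let ?a = "z n" and ?b = "z (Suc n)"
  have ab: "0 < ?a" "?a < ?b" using z_pos mono by (auto simp: strict_mono_less)
  have nz: "vfun t \<noteq> 0" if "t \<in> {?a<..<?b}" for t
    using no_zero_between[of n t] that ab by (auto simp: vfun_def)
  define m where "m = (?a + ?b) / 2"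
  define \<sigma> where "\<sigma> = sgn (vfun m)"
  have m: "m \<in> {?a<..<?b}" using ab by (auto simp: m_def)
  have "connected ((\<lambda>t. \<sigma> * vfun t) ` {?a<..<?b})"
  proof (rule connected_continuous_image)
    show "continuous_on {?a<..<?b} (\<lambda>t. \<sigma> * vfun t)"
      by (intro continuous_intros continuous_at_imp_continuous_on ballI DERIV_isCont[OF vfun_ode(1)])
         (use ab in auto)
  qed simp
  moreover have "0 \<notin> (\<lambda>t. \<sigma> * vfun t) ` {?a<..<?b}" using nz m by (auto simp: \<sigma>_def sgn_zero_iff)
  ultimately have "\<not> (\<sigma> * vfun t \<le> 0 \<and> 0 \<le> \<sigma> * vfun m)" if "t \<in> {?a<..<?b}" for t
    using connectedD_interval[of "(\<lambda>t. \<sigma> * vfun t) ` {?a<..<?b}" "\<sigma> * vfun t" "\<sigma> * vfun m" 0] that m by blast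
  moreover have "0 \<le> \<sigma> * vfun m" by (simp add: \<sigma>_def sgn_if)
  ultimately have "0 < \<sigma> * vfun t" if "t \<in> {?a<..<?b}" for t using that by force
  moreover have "\<bar>\<sigma>\<bar> = 1" using nz[OF m] by (simp add: \<sigma>_def abs_sgn_eq)
  ultimately show ?thesis using that[of \<sigma>] by auto
qed

lemma vder_z_nonzero: "vder (z n) \<noteq> 0"
proof -
  have "bessel_phi (\<nu> + 1) (complex_of_real ((z n)\<^sup>2)) \<noteq> 0"
    by (rule bessel_phi_zero_simple[OF nu]) (use complex_zeros in blast)
  hence "bessel_phi (\<nu> + 1) ((z n)\<^sup>2) \<noteq> 0"
    using of_real_bessel_phi[of "\<nu> + 1" "(z n)\<^sup>2"] nu by auto
  thus ?thesis using nu z_pos[of n] phi_z[of n] by (auto simp: vder_def vfun_def)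
qed

lemma vfun_z: "vfun (z n) = 0"
  by (simp add: vfun_def phi_z)

text \<open>The target rate is chosen because the sum of 1/z_n^2 is already known to converge. The
  hump bound makes sqrt |phi| at least of order u^(-q) sqrt ((u - a) (b - u)), the Gaussian factor
  absorbs the power of u, and the arcsine integral contributes pi.\<close>

lemma integrand_integral_bound:
  assumes c: "0 < c"
  shows "\<exists>C N. \<forall>n\<ge>N. \<bar>LBINT u:{z n..z (Suc n)}. exp (- c * u\<^sup>2) / (u * sqrt \<bar>bessel_phi \<nu> (u\<^sup>2)\<bar>)\<bar> \<le> C / (z n)\<^sup>2"
proof -
  define \<beta> where "\<beta> = (\<nu> + 1/2) * (\<nu> - 1/2)"
  \<comment> \<open>Half of the exponent \<nu> + 1/2 + 1: the first part stems from
    \<open>vfun\<close>, the extra 1 from the factor 1/b in the hump bound, and the half from the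
    square root in the integrand.\<close>
  define q where "q = (\<nu> + 1/2 + 1) / 2"
  have "((\<lambda>u. u powr (q + 1) * exp (- c * u\<^sup>2)) \<longlongrightarrow> 0) at_top" using c by real_asymp
  hence "\<forall>\<^sub>F u in at_top. u powr (q + 1) * exp (- c * u\<^sup>2) < 1" by (rule order_tendstoD) simp
  moreover have "\<forall>\<^sub>F u in at_top. 1 \<le> (u::real)" "\<forall>\<^sub>F u in at_top. sqrt (2 * \<bar>\<beta>\<bar>) \<le> u"
    by (rule eventually_ge_at_top)+
  ultimately have "\<forall>\<^sub>F u in at_top. u powr (q + 1) * exp (- c * u\<^sup>2) < 1 \<and> 1 \<le> u \<and> sqrt (2 * \<bar>\<beta>\<bar>) \<le> u"
    by eventually_elim auto
  then obtain R where R: "\<And>u. R \<le> u \<Longrightarrow> u powr (q + 1) * exp (- c * u\<^sup>2) < 1 \<and> 1 \<le> u \<and> sqrt (2 * \<bar>\<beta>\<bar>) \<le> u"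
    by (auto simp: eventually_at_top_linorder)
  obtain N where N: "R \<le> z N"
    using z_at_top unfolding filterlim_at_top by (metis eventually_sequentially order_refl)
  \<comment> \<open>The energy at a zero, where only the derivative contributes. It is positive
    because zeros are simple, and by monotonicity it bounds the energy on all later
    intervals.\<close>
  define e where "e = (z N)\<^sup>2 * (vder (z N))\<^sup>2"
  have e: "e > 0" using vder_z_nonzero[of N] z_pos[of N] by (simp add: e_def)
  \<comment> \<open>150 = 6 * 5^2: consecutive zeros are at most 5 apart, hence b <= u + 5 <= 6 u
    once u >= 1.\<close>
  define \<kappa> where "\<kappa> = sqrt (e / 2) / 150"
  have kap: "\<kappa> > 0" using e by (simp add: \<kappa>_def)
  have "\<bar>LBINT u:{z n..z (Suc n)}. exp (- c * u\<^sup>2) / (u * sqrt \<bar>bessel_phi \<nu> (u\<^sup>2)\<bar>)\<bar> \<le> pi / sqrt \<kappa> / (z n)\<^sup>2"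
    if n: "n \<ge> N" for n
  proof -
    let ?a = "z n" and ?b = "z (Suc n)"
    have ab: "0 < ?a" "?a < ?b" using z_pos mono by (auto simp: strict_mono_less)
    have zN: "z N \<le> ?a" using mono n by (simp add: strict_mono_less_eq)
    have Ra: "R \<le> u" if "?a \<le> u" for u using that N zN by linarith
    have beta: "2 * \<bar>\<beta>\<bar> \<le> ?a\<^sup>2"
    proof -
      have "(sqrt (2 * \<bar>\<beta>\<bar>))\<^sup>2 \<le> ?a\<^sup>2" using R[OF Ra[of ?a]] by (intro power_mono) auto
      thus ?thesis by simp
    qed
    obtain \<sigma> :: real where \<sigma>: "\<bar>\<sigma>\<bar> = 1" "\<And>t. ?a < t \<Longrightarrow> t < ?b \<Longrightarrow> 0 < \<sigma> * vfun t"
      using vfun_sign[of n] by metis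
    have s2: "\<sigma>\<^sup>2 = 1" using \<sigma>(1) by (metis one_power2 power2_abs)
    have d1: "((\<lambda>t. \<sigma> * vfun t) has_real_derivative \<sigma> * vder t) (at t)" if "t \<in> {?a..?b}" for t
      using that ab vfun_ode(1)[of t] by (auto intro!: DERIV_cmult)
    have d2: "((\<lambda>t. \<sigma> * vder t) has_real_derivative - (1 - \<beta> / t\<^sup>2) * (\<sigma> * vfun t)) (at t)" if "t \<in> {?a..?b}" for t
      using that ab DERIV_cmult[OF vfun_ode(2)[of t], of \<sigma>] unfolding \<beta>_def by (auto simp: mult_ac)
    have en: "e \<le> t\<^sup>2 * (\<sigma> * vder t)\<^sup>2 + (t\<^sup>2 - \<beta>) * (\<sigma> * vfun t)\<^sup>2" if t: "t \<in> {?a..?b}" for t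
    proof -
      have "e = (z N)\<^sup>2 * (vder (z N))\<^sup>2 + ((z N)\<^sup>2 - \<beta>) * (vfun (z N))\<^sup>2" by (simp add: e_def vfun_z)
      also have "\<dots> \<le> t\<^sup>2 * (vder t)\<^sup>2 + (t\<^sup>2 - \<beta>) * (vfun t)\<^sup>2"
        by (rule ode_energy_mono; (rule vfun_ode[folded \<beta>_def])?; use z_pos[of N] zN t in force)
      finally show ?thesis by (simp add: power_mult_distrib s2)
    qed
    have gap: "?b - ?a \<le> 5"
    proof -
      have "?b - ?a \<le> sqrt 2 * pi"
        by (rule ode_gap_le[OF ab(1,2) beta d1 d2]) (use \<sigma>(2) vfun_z in auto)
      moreover have "sqrt 2 * pi \<le> (3/2) * (16/5)"
        using pi_less_4 pi_approx by (intro mult_mono real_le_lsqrt) (auto simp: power2_eq_square)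
      ultimately show ?thesis by simp
    qed
    have "\<bar>LBINT u:{?a..?b}. exp (- c * u\<^sup>2) / (u * sqrt \<bar>bessel_phi \<nu> (u\<^sup>2)\<bar>)\<bar> \<le> 1 / (?a\<^sup>2 * sqrt \<kappa>) * pi"
    proof (rule arcsine_dominated(2)[OF ab(2) integrand_measurable])
      fix u assume u: "?a < u" "u < ?b"
      define p where "p = (u - ?a) * (?b - u)"
      have p: "p > 0" using u by (simp add: p_def)
      have u1: "1 \<le> ?a" "u powr (q + 1) * exp (- c * u\<^sup>2) < 1" using R[OF Ra[of ?a]] R[OF Ra[of u]] u by auto
      have "sqrt (e / 2) / ?b * (p / (?b - ?a)\<^sup>2) \<le> \<sigma> * vfun u"
        unfolding p_def by (rule ode_hump_lower_bound[OF ab(1,2) beta d1 d2 _ _ _ e en])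
           (use \<sigma>(2) vfun_z u in auto)
      moreover have "\<sigma> * vfun u = \<bar>vfun u\<bar>" using \<sigma>(1) \<sigma>(2)[OF u] by (metis abs_mult abs_of_pos mult_1)
      moreover have "\<kappa> * p / u \<le> sqrt (e / 2) / ?b * (p / (?b - ?a)\<^sup>2)"
      proof -
        have "?b * (?b - ?a)\<^sup>2 \<le> (6 * u) * 5\<^sup>2"
          using gap ab u u1 by (intro mult_mono power_mono) auto
        hence "sqrt (e / 2) * p / ((6 * u) * 5\<^sup>2) \<le> sqrt (e / 2) * p / (?b * (?b - ?a)\<^sup>2)"
          using e p ab u by (intro divide_left_mono) auto
        thus ?thesis by (simp add: \<kappa>_def)
      qed
      ultimately have vf: "\<kappa> * p / u \<le> \<bar>vfun u\<bar>" by linarith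
      have upos: "u > 0" using u ab by simp
      have "\<bar>vfun u\<bar> = u powr (\<nu> + 1/2) * \<bar>bessel_phi \<nu> (u\<^sup>2)\<bar>" by (simp add: vfun_def abs_mult)
      hence "\<kappa> * p \<le> u powr (2 * q) * \<bar>bessel_phi \<nu> (u\<^sup>2)\<bar>"
      proof -
        have "2 * q = 1 + (\<nu> + 1/2)" by (simp add: q_def)
        hence "u powr (2 * q) = u * u powr (\<nu> + 1/2)" using upos by (simp only: powr_add) simp
        thus ?thesis using vf upos \<open>\<bar>vfun u\<bar> = _\<close> by (simp add: pos_divide_le_eq mult_ac)
      qed
      hence "sqrt (\<kappa> * p) \<le> sqrt (u powr (2 * q) * \<bar>bessel_phi \<nu> (u\<^sup>2)\<bar>)" by simp
      also have "\<dots> = u powr q * sqrt \<bar>bessel_phi \<nu> (u\<^sup>2)\<bar>"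
        using upos by (simp add: real_sqrt_mult powr_half_sqrt[symmetric] powr_powr)
      finally have low: "sqrt \<kappa> * sqrt p \<le> u powr q * sqrt \<bar>bessel_phi \<nu> (u\<^sup>2)\<bar>" by (simp add: real_sqrt_mult)
      define S where "S = sqrt \<bar>bessel_phi \<nu> (u\<^sup>2)\<bar>"
      have "0 < sqrt \<kappa> * sqrt p" using kap p by simp
      hence "0 < u powr q * S" using low[folded S_def] by linarith
      hence S: "S > 0" using upos by (simp add: zero_less_mult_iff)
      have "exp (- c * u\<^sup>2) * u powr q * u \<le> 1" using u1(2) upos by (simp add: powr_add mult_ac)
      hence "exp (- c * u\<^sup>2) * (u powr q * S) * u \<le> S"
        using S mult_right_mono[of "exp (- c * u\<^sup>2) * u powr q * u" 1 S] by (simp add: mult_ac)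
      moreover have "exp (- c * u\<^sup>2) * (sqrt \<kappa> * sqrt p) * u \<le> exp (- c * u\<^sup>2) * (u powr q * S) * u"
        using low[folded S_def] upos by (intro mult_right_mono mult_left_mono) auto
      ultimately have "exp (- c * u\<^sup>2) * (sqrt \<kappa> * sqrt p) * u \<le> S" by linarith
      hence "exp (- c * u\<^sup>2) * (sqrt \<kappa> * sqrt p) * u * u \<le> S * u" using upos by (intro mult_right_mono) auto
      moreover have "exp (- c * u\<^sup>2) * (sqrt \<kappa> * sqrt p) * (?a * ?a) \<le> exp (- c * u\<^sup>2) * (sqrt \<kappa> * sqrt p) * (u * u)"
        using u ab kap p by (intro mult_left_mono mult_mono) auto
      ultimately have "exp (- c * u\<^sup>2) * (?a\<^sup>2 * sqrt \<kappa> * sqrt p) \<le> u * S"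
        by (simp add: power2_eq_square mult_ac)
      hence "exp (- c * u\<^sup>2) / (u * S) \<le> 1 / (?a\<^sup>2 * sqrt \<kappa>) / sqrt p"
        using S upos ab kap p by (simp add: field_simps)
      thus "\<bar>exp (- c * u\<^sup>2) / (u * sqrt \<bar>bessel_phi \<nu> (u\<^sup>2)\<bar>)\<bar> \<le> 1 / (?a\<^sup>2 * sqrt \<kappa>) / sqrt ((u - ?a) * (?b - u))"
        using S upos by (simp add: S_def p_def)
    qed
    thus ?thesis by (simp add: mult_ac)
  qed
  thus ?thesis by blast
qed

lemma integrand_summable:
  assumes c: "0 < c"
  shows "summable (\<lambda>k. LBINT u:{z (2 * k)..z (Suc (2 * k))}. exp (- c * u\<^sup>2) / (u * sqrt \<bar>bessel_phi \<nu> (u\<^sup>2)\<bar>))"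
proof -
  obtain C N where CN: "\<And>n. n \<ge> N \<Longrightarrow> \<bar>LBINT u:{z n..z (Suc n)}. exp (- c * u\<^sup>2) / (u * sqrt \<bar>bessel_phi \<nu> (u\<^sup>2)\<bar>)\<bar> \<le> C / (z n)\<^sup>2"
    using integrand_integral_bound[OF c] by blast
  show ?thesis
  proof (rule summable_comparison_test')
    show "summable (\<lambda>k. \<bar>C\<bar> * (1 / (z k)\<^sup>2))" by (intro summable_mult rayleigh)
    fix k assume k: "k \<ge> N"
    have "C / (z (2 * k))\<^sup>2 \<le> \<bar>C\<bar> / (z (2 * k))\<^sup>2" by (intro divide_right_mono) auto
    \<comment> \<open>Passing from index 2k to k makes the majorant Rayleigh's series
      itself.\<close>
    also have "\<dots> \<le> \<bar>C\<bar> / (z k)\<^sup>2"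
    proof -
      have "z k \<le> z (2 * k)" using mono by (simp add: strict_mono_less_eq)
      hence "(z k)\<^sup>2 \<le> (z (2 * k))\<^sup>2" using z_pos[of k] by (intro power_mono) auto
      thus ?thesis using z_pos[of k] z_pos[of "2 * k"] by (intro divide_left_mono) auto
    qed
    finally show "norm (LBINT u:{z (2 * k)..z (Suc (2 * k))}. exp (- c * u\<^sup>2) / (u * sqrt \<bar>bessel_phi \<nu> (u\<^sup>2)\<bar>))
       \<le> \<bar>C\<bar> * (1 / (z k)\<^sup>2)"
      using CN[of "2 * k"] k by simp
  qed
qed

end

section \<open>Tails of finite quadratic forms\<close>

lemma integrable_mult_prod:
  fixes f g :: "real \<Rightarrow> real"
  assumes f: "integrable lborel f" and g: "integrable lborel g"
  shows "integrable (lborel \<Otimes>\<^sub>M lborel) (\<lambda>(x, y). f x * g y)"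
proof (rule lborel_pair.Fubini_integrable)
  have [measurable]: "f \<in> borel_measurable borel" "g \<in> borel_measurable borel"
    using borel_measurable_integrable[OF f] borel_measurable_integrable[OF g] by simp_all
  show "(\<lambda>(x, y). f x * g y) \<in> borel_measurable (lborel \<Otimes>\<^sub>M lborel)" by measurable
  show "integrable lborel (\<lambda>x. \<integral>y. norm (case (x, y) of (x, y) \<Rightarrow> f x * g y) \<partial>lborel)"
    using f by (simp add: abs_mult)
  show "AE x in lborel. integrable lborel (\<lambda>y. case (x, y) of (x, y) \<Rightarrow> f x * g y)"
    using g by simp
qed

lemma integrable_div_shift:
  fixes f :: "real \<Rightarrow> real"
  assumes f: "integrable lborel f" and supp: "\<forall>u. f u \<noteq> 0 \<longrightarrow> l \<le> u \<and> u \<le> h" and w: "w < l \<or> h < w"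
  shows "integrable lborel (\<lambda>u. f u / (u - w))"
proof -
  define d where "d = max (l - w) (w - h)"
  have d: "d > 0" using w by (auto simp: d_def)
  have [measurable]: "f \<in> borel_measurable borel" using borel_measurable_integrable[OF f] by simp
  show ?thesis
  proof (rule Bochner_Integration.integrable_bound[where f="\<lambda>u. f u / d"])
    show "AE u in lborel. norm (f u / (u - w)) \<le> norm (f u / d)"
    proof (intro AE_I2)
      fix u
      show "norm (f u / (u - w)) \<le> norm (f u / d)"
      proof (cases "f u = 0")
        case False
        hence "d \<le> \<bar>u - w\<bar>" using supp[rule_format, of u] w by (auto simp: d_def)
        thus ?thesis using d by (simp add: abs_divide) (intro divide_left_mono mult_pos_pos; simp)
      qed simp
    qed
  qed (use f in simp_all)
qed

text \<open>The identity behind it is $\frac{1}{v-u}\bigl(\frac1{u-w}-\frac1{v-w}\bigr)=\frac1{(u-w)(v-w)}$.\<close>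

lemma cauchy_kernel_product:
  fixes f g :: "real \<Rightarrow> real"
  assumes f: "integrable lborel f" and fs: "\<forall>u. f u \<noteq> 0 \<longrightarrow> l1 \<le> u \<and> u \<le> h1"
    and g: "integrable lborel g" and gs: "\<forall>v. g v \<noteq> 0 \<longrightarrow> l2 \<le> v \<and> v \<le> h2"
    and sep: "l1 \<le> h1" "h1 < l2" "l2 \<le> h2"
  shows "integrable lborel (\<lambda>u. f u * (LINT v|lborel. g v / (v - u)))" (is ?th1)
    and "integrable lborel (\<lambda>v. g v * (LINT u|lborel. f u / (u - v)))" (is ?th2)
    and "w < l1 \<or> h2 < w \<Longrightarrow>
        (LINT u|lborel. f u / (u - w) * (LINT v|lborel. g v / (v - u)))
      + (LINT v|lborel. g v / (v - w) * (LINT u|lborel. f u / (u - v)))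
      = (LINT u|lborel. f u / (u - w)) * (LINT v|lborel. g v / (v - w))" (is "?w \<Longrightarrow> ?th3")
proof -
  \<comment> \<open>Quantified anew over f and g, since it is applied to the given pair and to the
    pairs in which one function is divided by its distance from w.\<close>
  have J: "integrable (lborel \<Otimes>\<^sub>M lborel) (\<lambda>(u, v). f u * g v / (v - u))"
    if f: "integrable lborel f" and fs: "\<forall>u. f u \<noteq> 0 \<longrightarrow> l1 \<le> u \<and> u \<le> h1"
    and g: "integrable lborel g" and gs: "\<forall>v. g v \<noteq> 0 \<longrightarrow> l2 \<le> v \<and> v \<le> h2" for f g :: "real \<Rightarrow> real"
  proof (rule Bochner_Integration.integrable_bound)
    have [measurable]: "f \<in> borel_measurable borel" "g \<in> borel_measurable borel"
      using borel_measurable_integrable[OF f] borel_measurable_integrable[OF g] by simp_all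
    show "integrable (lborel \<Otimes>\<^sub>M lborel) (\<lambda>p. (case p of (u, v) \<Rightarrow> f u * g v) / (l2 - h1))"
      by (intro integrable_divide integrable_mult_prod f g)
    show "(\<lambda>(u, v). f u * g v / (v - u)) \<in> borel_measurable (lborel \<Otimes>\<^sub>M lborel)" by measurable
    show "AE p in lborel \<Otimes>\<^sub>M lborel. norm (case p of (u, v) \<Rightarrow> f u * g v / (v - u))
        \<le> norm ((case p of (u, v) \<Rightarrow> f u * g v) / (l2 - h1))"
    proof (intro AE_I2, clarify)
      fix u v
      show "norm (f u * g v / (v - u)) \<le> norm (f u * g v / (l2 - h1))"
      proof (cases "f u * g v = 0")
        case False
        hence "l2 - h1 \<le> \<bar>v - u\<bar>" using fs[rule_format, of u] gs[rule_format, of v] by auto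
        thus ?thesis unfolding norm_divide using sep by (intro divide_left_mono) auto
      qed auto
    qed
  qed
  have e1: "(LINT v|lborel. f u * g v / (v - u)) = f u * (LINT v|lborel. g v / (v - u))" for f g :: "real \<Rightarrow> real" and u
    by (subst integral_mult_right_zero[symmetric]) simp
  \<comment> \<open>The minus sign arises because the inner transform is taken with u - v and not v
    - u; it turns the difference of double integrals into the sum in the claim.\<close>
  have e2: "(LINT u|lborel. f u * g v / (v - u)) = - (g v * (LINT u|lborel. f u / (u - v)))" for f g :: "real \<Rightarrow> real" and v
  proof -
    have "f u * g v / (v - u) = - (g v * (f u / (u - v)))" for u
      by (metis minus_diff_eq minus_divide_right mult.commute times_divide_eq_right)
    thus ?thesis by (simp only: integral_minus integral_mult_right_zero)
  qed
  show ?th1 using lborel_pair.integrable_fst[OF J[OF f fs g gs]] by (simp only: e1)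
  show ?th2 using lborel_pair.integrable_snd[OF J[OF f fs g gs]] by (simp only: e2) simp
  assume w: ?w
  define fw where "fw u = f u / (u - w)" for u
  define gw where "gw v = g v / (v - w)" for v
  have fw: "integrable lborel fw" unfolding fw_def using f fs by (rule integrable_div_shift) (use w sep in auto)
  have gw: "integrable lborel gw" unfolding gw_def using g gs by (rule integrable_div_shift) (use w sep in auto)
  have fws: "\<forall>u. fw u \<noteq> 0 \<longrightarrow> l1 \<le> u \<and> u \<le> h1" using fs by (auto simp: fw_def)
  have gws: "\<forall>u. gw u \<noteq> 0 \<longrightarrow> l2 \<le> u \<and> u \<le> h2" using gs by (auto simp: gw_def)
  note A = J[OF fw fws g gs] and B = J[OF f fs gw gws]
  have "(LINT u|lborel. fw u * (LINT v|lborel. g v / (v - u))) + (LINT v|lborel. gw v * (LINT u|lborel. f u / (u - v)))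
      = (LINT p|(lborel \<Otimes>\<^sub>M lborel). (case p of (u, v) \<Rightarrow> fw u * g v / (v - u)))
        - (LINT p|(lborel \<Otimes>\<^sub>M lborel). (case p of (u, v) \<Rightarrow> f u * gw v / (v - u)))"
    unfolding lborel_pair.integral_fst[OF A, symmetric] lborel_pair.integral_snd[OF B, symmetric] e1 e2 by simp
  also have "\<dots> = (LINT p|(lborel \<Otimes>\<^sub>M lborel). (case p of (u, v) \<Rightarrow> fw u * g v / (v - u)) - (case p of (u, v) \<Rightarrow> f u * gw v / (v - u)))"
    by (rule Bochner_Integration.integral_diff[OF A B, symmetric])
  also have "\<dots> = (LINT p|(lborel \<Otimes>\<^sub>M lborel). (case p of (u, v) \<Rightarrow> fw u * gw v))"
  proof (intro Bochner_Integration.integral_cong refl, clarify)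
    fix u v
    show "fw u * g v / (v - u) - f u * gw v / (v - u) = fw u * gw v"
    proof (cases "f u = 0 \<or> g v = 0")
      case False
      hence "u - w \<noteq> 0" "v - w \<noteq> 0" "v - u \<noteq> 0" using fs[rule_format, of u] gs[rule_format, of v] w sep by auto
      thus ?thesis unfolding fw_def gw_def by (simp add: divide_simps) (simp add: algebra_simps)
    qed (auto simp: fw_def gw_def)
  qed
  also have "\<dots> = (LINT u|lborel. fw u) * (LINT v|lborel. gw v)"
    unfolding lborel_pair.integral_fst[OF integrable_mult_prod[OF fw gw], symmetric] by simp
  finally show ?th3 unfolding fw_def gw_def .
qed

section \<open>Partial fractions for reciprocal square roots with interlacing zeros\<close>

definition pair_density :: "real \<Rightarrow> real \<Rightarrow> real \<Rightarrow> real" where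
  "pair_density a b u = indicator {a..b} u / (pi * sqrt \<bar>(1 - u / a) * (1 - u / b)\<bar>)"

text \<open>Divided by u, the function has total mass 1, which is the case w = 0. The transform is
  needed on both sides of the interval: the Laplace variable lies to the left, later intervals to
  the right, and the sign differs.\<close>

lemma pair_density:
  assumes ab: "0 < a" "a < b"
  shows "integrable lborel (pair_density a b)"
    and "w < a \<Longrightarrow> (LINT u|lborel. pair_density a b u / (u - w)) = 1 / sqrt \<bar>(1 - w / a) * (1 - w / b)\<bar>"
    and "b < w \<Longrightarrow> (LINT u|lborel. pair_density a b u / (u - w)) = - (1 / sqrt \<bar>(1 - w / a) * (1 - w / b)\<bar>)"
proof -
  have sq: "sqrt \<bar>(1 - u / a) * (1 - u / b)\<bar> = sqrt \<bar>(u - a) * (b - u)\<bar> / sqrt (a * b)" for u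
  proof -
    have "(1 - u / a) * (1 - u / b) = - ((u - a) * (b - u) / (a * b))" using ab by (simp add: field_simps)
    thus ?thesis using ab by (simp add: abs_mult real_sqrt_divide real_sqrt_mult)
  qed
  have pd: "pair_density a b u = sqrt (a * b) / pi * (indicator {a..b} u * (1 / sqrt ((u - a) * (b - u))))" for u
  proof (cases "u \<in> {a..b}")
    case True
    hence "\<bar>(u - a) * (b - u)\<bar> = (u - a) * (b - u)" by (intro abs_of_nonneg mult_nonneg_nonneg) auto
    thus ?thesis unfolding pair_density_def sq using True by simp
  qed (simp add: pair_density_def)
  show "integrable lborel (pair_density a b)"
    using arcsine_integral(1)[OF ab(2)] unfolding pd[abs_def] set_integrable_def
    by (intro integrable_mult_right) simp
  show "(LINT u|lborel. pair_density a b u / (u - w)) = 1 / sqrt \<bar>(1 - w / a) * (1 - w / b)\<bar>" if w: "w < a"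
  proof -
    have lin: "(a - w) * (b - u) + (b - w) * (u - a) = (b - a) * (u - w)" for u by (simp add: algebra_simps)
    have "pair_density a b u / (u - w) = sqrt (a * b) / pi * (indicator {a..b} u *\<^sub>R
       ((b - a) / (((a - w) * (b - u) + (b - w) * (u - a)) * sqrt ((u - a) * (b - u)))))" for u
      unfolding lin pd using ab by simp
    hence "(LINT u|lborel. pair_density a b u / (u - w)) = sqrt (a * b) / pi * (LBINT u:{a..b}.
       (b - a) / (((a - w) * (b - u) + (b - w) * (u - a)) * sqrt ((u - a) * (b - u))))"
      by (simp only: set_lebesgue_integral_def integral_mult_right_zero)
    also have "\<dots> = sqrt (a * b) / pi * (pi / sqrt ((a - w) * (b - w)))"
      using arcsine_kernel_integral(2)[OF ab(2), of "a - w" "b - w"] w ab by simp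
    also have "\<dots> = 1 / sqrt \<bar>(1 - w / a) * (1 - w / b)\<bar>"
    proof -
      have "\<bar>(w - a) * (b - w)\<bar> = (a - w) * (b - w)" using w ab by (simp add: abs_mult)
      thus ?thesis unfolding sq by simp
    qed
    finally show ?thesis .
  qed
  show "(LINT u|lborel. pair_density a b u / (u - w)) = - (1 / sqrt \<bar>(1 - w / a) * (1 - w / b)\<bar>)" if w: "b < w"
  proof -
    have lin: "(w - a) * (b - u) + (w - b) * (u - a) = (b - a) * (w - u)" for u by (simp add: algebra_simps)
    have "pair_density a b u / (u - w) = - (sqrt (a * b) / pi) * (indicator {a..b} u *\<^sub>R
       ((b - a) / (((w - a) * (b - u) + (w - b) * (u - a)) * sqrt ((u - a) * (b - u)))))" for u
    proof -
      have "1 / (u - w) = - (1 / (w - u))" by (metis minus_diff_eq minus_divide_right)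
      thus ?thesis unfolding lin pd using ab by simp (metis divide_divide_eq_left' divide_inverse inverse_eq_divide minus_diff_eq minus_divide_right mult.commute)
    qed
    hence "(LINT u|lborel. pair_density a b u / (u - w)) = - (sqrt (a * b) / pi) * (LBINT u:{a..b}.
       (b - a) / (((w - a) * (b - u) + (w - b) * (u - a)) * sqrt ((u - a) * (b - u))))"
      by (simp only: set_lebesgue_integral_def integral_mult_right_zero)
    also have "\<dots> = - (sqrt (a * b) / pi) * (pi / sqrt ((w - a) * (w - b)))"
      using arcsine_kernel_integral(2)[OF ab(2), of "w - a" "w - b"] w ab by simp
    also have "\<dots> = - (1 / sqrt \<bar>(1 - w / a) * (1 - w / b)\<bar>)"
    proof -
      have "\<bar>(w - a) * (b - w)\<bar> = (w - a) * (w - b)" using w ab by (simp add: abs_mult)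
      thus ?thesis unfolding sq by simp
    qed
    finally show ?thesis .
  qed
qed

locale interlacing =
  fixes a b :: "nat \<Rightarrow> real"
  assumes a0: "0 < a 0" and ab: "\<And>k. a k < b k" and ba: "\<And>k. b k < a (Suc k)"
begin

definition "F m u = (\<Prod>k<m. (1 - u / a k) * (1 - u / b k))"
definition "\<rho> m k u = indicator {a k..b k} u / (pi * sqrt \<bar>F m u\<bar>)"
text \<open>On the plane cut along the intervals, the branch of 1 / sqrt F that is positive to the
  left changes sign from one gap to the next; the factors (-1)^k record this.\<close>

definition "S m w = (\<Sum>k<m. (-1) ^ k * (LINT u|lborel. \<rho> m k u / (u - w)))"

lemma F_0 [simp]: "F 0 u = 1" and F_Suc: "F (Suc m) u = F m u * ((1 - u / a m) * (1 - u / b m))"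
  by (simp_all add: F_def)

lemma a_mono: "i \<le> j \<Longrightarrow> a i \<le> a j"
proof (induction j rule: dec_induct)
  case (step n) thus ?case using ab[of n] ba[of n] by linarith
qed simp

lemma a_pos: "0 < a k"
  using a0 a_mono[of 0 k] by simp

lemma b_less_a: "i < j \<Longrightarrow> b i < a j"
  using ba[of i] a_mono[of "Suc i" j] by simp

lemma \<rho>_supp: "\<forall>u. \<rho> m k u \<noteq> 0 \<longrightarrow> a k \<le> u \<and> u \<le> b k"
  by (auto simp: \<rho>_def indicator_def)

text \<open>Adding a pair multiplies the transform by that of \<open>pair_density\<close>. By
  \<open>cauchy_kernel_product\<close> each product of transforms splits into a part carried by the
  old interval and a part carried by the new one, and these parts are the densities of the next
  stage. The value to the right of all intervals is proved along, because the new density is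
  \<open>g\<close> times the old transform evaluated there.\<close>

lemma stieltjes_formula:
  shows "k \<le> m \<Longrightarrow> integrable lborel (\<rho> (Suc m) k)"
    and "w < a 0 \<Longrightarrow> S (Suc m) w = 1 / sqrt \<bar>F (Suc m) w\<bar>"
    and "b m < w \<Longrightarrow> S (Suc m) w = (-1) ^ Suc m / sqrt \<bar>F (Suc m) w\<bar>"
proof (induction m arbitrary: k w)
  case 0
  have eq: "\<rho> (Suc 0) 0 = pair_density (a 0) (b 0)" by (rule ext) (simp add: \<rho>_def pair_density_def F_Suc)
  {
    case 1 thus ?case using pair_density(1)[OF a0 ab] by (simp add: eq)
  next
    case 2 thus ?case using pair_density(2)[OF a0 ab, of w] by (simp add: S_def eq F_Suc)
  next
    case 3 thus ?case using pair_density(3)[OF a0 ab, of w] by (simp add: S_def eq F_Suc)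
  }
next
  case (Suc m)
  define n where "n = Suc m"
  define g where "g = pair_density (a n) (b n)"
  have g: "integrable lborel g" unfolding g_def by (rule pair_density(1)[OF a_pos ab])
  have gs: "\<forall>v. g v \<noteq> 0 \<longrightarrow> a n \<le> v \<and> v \<le> b n"
    by (auto simp: g_def pair_density_def indicator_def)
  have ri: "integrable lborel (\<rho> n k)" if "k < n" for k using Suc.IH(1)[of k] that by (simp add: n_def)
  have sep: "a k \<le> b k" "b k < a n" "a n \<le> b n" if "k < n" for k
    using ab[of k] ab[of n] b_less_a[OF that] by auto
  \<comment> \<open>An old interval lies left of the support of g, where its transform is positive
    and equals the missing factor.\<close>
  have r1: "\<rho> (Suc n) k u = \<rho> n k u * (LINT v|lborel. g v / (v - u))" if k: "k < n" for k u
  proof (cases "u \<in> {a k..b k}")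
    case True
    hence "u < a n" using sep[OF k] by auto
    hence "(LINT v|lborel. g v / (v - u)) = 1 / sqrt \<bar>(1 - u / a n) * (1 - u / b n)\<bar>"
      unfolding g_def by (rule pair_density(2)[OF a_pos ab])
    thus ?thesis by (simp add: \<rho>_def F_Suc abs_mult real_sqrt_mult)
  qed (simp add: \<rho>_def)
  have Sn: "S n v = (\<Sum>k<n. (-1) ^ k * (LINT u|lborel. \<rho> n k u / (u - v)))" for v by (simp add: S_def)
  \<comment> \<open>The new interval lies right of all old ones, so the third claim applies; its
    sign (-1)^n is the sign of the new summand of S.\<close>
  have r2: "\<rho> (Suc n) n v = (-1) ^ n * (g v * S n v)" for v
  proof (cases "v \<in> {a n..b n}")
    case True
    hence "b m < v" using b_less_a[of m n] by (auto simp: n_def)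
    hence "S n v = (-1) ^ n / sqrt \<bar>F n v\<bar>" unfolding n_def by (rule Suc.IH(3))
    hence "(-1) ^ n * (g v * S n v) = ((-1) ^ n * (-1) ^ n) * (g v / sqrt \<bar>F n v\<bar>)" by simp
    also have "(-1) ^ n * (-1) ^ n = (1::real)" by (simp flip: power_mult_distrib)
    finally show ?thesis by (simp add: \<rho>_def g_def pair_density_def F_Suc abs_mult real_sqrt_mult)
  qed (simp add: \<rho>_def g_def pair_density_def)
  have r2': "\<rho> (Suc n) n v = (-1) ^ n * (\<Sum>k<n. (-1) ^ k * (g v * (LINT u|lborel. \<rho> n k u / (u - v))))" for v
    unfolding r2 Sn by (simp add: sum_distrib_left mult_ac)
  have int1: "integrable lborel (\<rho> (Suc n) k)" if k: "k < n" for k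
    unfolding r1[OF k, abs_def]
    by (rule cauchy_kernel_product(1)[OF ri[OF k] \<rho>_supp g gs sep[OF k]])
  have int2: "integrable lborel (\<rho> (Suc n) n)"
    unfolding r2'[abs_def]
    by (intro integrable_mult_right Bochner_Integration.integrable_sum)
       (use cauchy_kernel_product(2)[OF ri \<rho>_supp g gs sep] in auto)
  have main: "S (Suc n) w = S n w * (LINT v|lborel. g v / (v - w))" if w: "w < a 0 \<or> b n < w" for w
  proof -
    have wk: "w < a k \<or> b n < w" for k using w a_mono[of 0 k] by auto
    have wn: "w < a n \<or> b n < w" using wk .
    have gw: "integrable lborel (\<lambda>v. g v / (v - w))" using g gs by (rule integrable_div_shift) (use wn in auto)
    have gws: "\<forall>v. g v / (v - w) \<noteq> 0 \<longrightarrow> a n \<le> v \<and> v \<le> b n" using gs by auto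
    have "\<rho> (Suc n) n v / (v - w) = (-1) ^ n * (\<Sum>k<n. (-1) ^ k * (g v / (v - w) * (LINT u|lborel. \<rho> n k u / (u - v))))" for v
      unfolding r2' times_divide_eq_right[symmetric] sum_divide_distrib by simp
    hence "(LINT v|lborel. \<rho> (Suc n) n v / (v - w)) =
       (LINT v|lborel. (-1) ^ n * (\<Sum>k<n. (-1) ^ k * (g v / (v - w) * (LINT u|lborel. \<rho> n k u / (u - v)))))"
      by (simp only:)
    also have "\<dots> = (-1) ^ n * (\<Sum>k<n. (-1) ^ k * (LINT v|lborel. g v / (v - w) * (LINT u|lborel. \<rho> n k u / (u - v))))"
    proof -
      have "(LINT v|lborel. (\<Sum>k<n. (-1) ^ k * (g v / (v - w) * (LINT u|lborel. \<rho> n k u / (u - v)))))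
        = (\<Sum>k<n. LINT v|lborel. (-1) ^ k * (g v / (v - w) * (LINT u|lborel. \<rho> n k u / (u - v))))"
        using cauchy_kernel_product(2)[OF ri \<rho>_supp gw gws sep]
        by (intro Bochner_Integration.integral_sum integrable_mult_right) auto
      thus ?thesis by (simp only: integral_mult_right_zero)
    qed
    finally have last: "(-1) ^ n * (LINT v|lborel. \<rho> (Suc n) n v / (v - w))
        = (\<Sum>k<n. (-1) ^ k * (LINT v|lborel. g v / (v - w) * (LINT u|lborel. \<rho> n k u / (u - v))))"
      by (simp add: mult.assoc[symmetric] flip: power_mult_distrib)
    have "S (Suc n) w = (\<Sum>k<n. (-1) ^ k * ((LINT u|lborel. \<rho> n k u / (u - w) * (LINT v|lborel. g v / (v - u)))
       + (LINT v|lborel. g v / (v - w) * (LINT u|lborel. \<rho> n k u / (u - v)))))"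
      unfolding S_def sum.lessThan_Suc last by (simp add: r1 sum.distrib[symmetric] distrib_left)
    also have "\<dots> = (\<Sum>k<n. (-1) ^ k * ((LINT u|lborel. \<rho> n k u / (u - w)) * (LINT v|lborel. g v / (v - w))))"
      by (intro sum.cong refl arg_cong2[where f="(*)"] cauchy_kernel_product(3)[OF ri \<rho>_supp g gs sep wk]) auto
    also have "\<dots> = S n w * (LINT v|lborel. g v / (v - w))" unfolding Sn sum_distrib_right by (simp only: mult.assoc)
    finally show ?thesis .
  qed
  {
    case 1
    thus ?case using int1[of k] int2 by (cases "k < n") (auto simp: n_def le_Suc_eq)
  next
    case 2
    have "w < a n" using 2 a_mono[of 0 n] by simp
    hence "S (Suc n) w = 1 / sqrt \<bar>F n w\<bar> * (1 / sqrt \<bar>(1 - w / a n) * (1 - w / b n)\<bar>)"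
      using main[of w] 2 Suc.IH(2)[OF 2] pair_density(2)[OF a_pos ab, of w n] by (simp add: g_def n_def)
    thus ?case unfolding n_def[symmetric] F_Suc by (simp add: abs_mult real_sqrt_mult)
  next
    case 3
    have "b m < w" using 3 b_less_a[of m n] ab[of n] by (auto simp: n_def)
    hence "S (Suc n) w = (-1) ^ n / sqrt \<bar>F n w\<bar> * - (1 / sqrt \<bar>(1 - w / a n) * (1 - w / b n)\<bar>)"
      using main[of w] 3 Suc.IH(3)[of w] pair_density(3)[OF a_pos ab, of n w] by (simp add: g_def n_def)
    thus ?case unfolding n_def[symmetric] F_Suc by (simp add: abs_mult real_sqrt_mult)
  }
qed

end


section \<open>From Stieltjes transforms to tails of distributions\<close>

lemma exp_tail_integral:
  fixes s x :: real
  assumes "0 < s"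
  shows "set_integrable lborel {x..} (\<lambda>y. exp (- s * y))" "(LBINT y:{x..}. exp (- s * y)) = exp (- s * x) / s"
proof -
  have "(\<integral>\<^sup>+y. ennreal (exp (- s * y)) * indicator {x..} y \<partial>lborel) = ennreal (0 - (- exp (- s * x) / s))"
  proof (rule nn_integral_FTC_atLeast)
    show "((\<lambda>y. - exp (- s * y) / s) \<longlongrightarrow> 0) at_top" using assms by real_asymp
    show "((\<lambda>y. - exp (- s * y) / s) has_real_derivative exp (- s * y)) (at y)" for y
      using assms by (auto intro!: derivative_eq_intros)
  qed auto
  hence "(\<integral>\<^sup>+y. ennreal (indicator {x..} y *\<^sub>R exp (- s * y)) \<partial>lborel) = ennreal (exp (- s * x) / s)"
    by (simp add: ennreal_mult' ennreal_indicator mult.commute)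
  hence "has_bochner_integral lborel (\<lambda>y. indicator {x..} y *\<^sub>R exp (- s * y)) (exp (- s * x) / s)"
    using assms by (intro has_bochner_integral_nn_integral) auto
  thus "set_integrable lborel {x..} (\<lambda>y. exp (- s * y))" "(LBINT y:{x..}. exp (- s * y)) = exp (- s * x) / s"
    by (auto simp: set_integrable_def set_lebesgue_integral_def has_bochner_integral_iff)
qed

text \<open>Mixtures of exponential laws with rates u/2. The two parameters serve two ends: x = 0
  gives the Laplace transform at c, and c = 0 the tail beyond x.\<close>

lemma exp_mixture_integral:
  fixes \<rho> :: "real \<Rightarrow> real"
  assumes \<rho>: "integrable lborel \<rho>" and supp: "\<forall>u. \<rho> u \<noteq> 0 \<longrightarrow> l \<le> u" and l: "0 < l" and c: "0 \<le> c" and x: "0 \<le> x"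
  shows "set_integrable lborel {x..} (\<lambda>y. exp (- c * y) * (LINT u|lborel. \<rho> u * exp (- u * y / 2) / 2))" (is ?th1)
    and "(LBINT y:{x..}. exp (- c * y) * (LINT u|lborel. \<rho> u * exp (- u * y / 2) / 2))
         = (LINT u|lborel. \<rho> u * exp (- (c + u / 2) * x) / (u + 2 * c))" (is ?th2)
proof -
  have [measurable]: "\<rho> \<in> borel_measurable borel" using borel_measurable_integrable[OF \<rho>] by simp
  define f where "f u y = \<rho> u / 2 * (indicator {x..} y * exp (- (c + u / 2) * y))" for u y
  have inner: "integrable lborel (\<lambda>y. indicator {x..} y * exp (- (c + u / 2) * y))"
    "(LINT y|lborel. indicator {x..} y * exp (- (c + u / 2) * y)) = exp (- (c + u / 2) * x) / (c + u / 2)"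
    if "l \<le> u" for u
    using exp_tail_integral[of "c + u / 2" x] l c that
    by (auto simp: set_integrable_def set_lebesgue_integral_def)
  have fy: "(LINT y|lborel. f u y) = \<rho> u * exp (- (c + u / 2) * x) / (u + 2 * c)" for u
  proof (cases "\<rho> u = 0")
    case False
    hence u: "l \<le> u" using supp by auto
    have "(LINT y|lborel. f u y) = \<rho> u / 2 * (exp (- (c + u / 2) * x) / (c + u / 2))"
      unfolding f_def using inner(2)[OF u] by simp
    moreover have "\<rho> u / 2 * (E / (c + u / 2)) = \<rho> u * E / (u + 2 * c)" for E
      using u l c by (simp add: field_simps)
    ultimately show ?thesis by simp
  qed (simp add: f_def)
  have "integrable (lborel \<Otimes>\<^sub>M lborel) (case_prod f)"
  proof (rule lborel_pair.Fubini_integrable)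
    show "case_prod f \<in> borel_measurable (lborel \<Otimes>\<^sub>M lborel)" unfolding f_def by measurable
    show "AE u in lborel. integrable lborel (\<lambda>y. case (u, y) of (u, y) \<Rightarrow> f u y)"
    proof (intro AE_I2)
      fix u show "integrable lborel (\<lambda>y. case (u, y) of (u, y) \<Rightarrow> f u y)"
        using inner(1)[of u] supp by (cases "\<rho> u = 0") (auto simp: f_def)
    qed
    have "(LINT y|lborel. norm (case (u, y) of (u, y) \<Rightarrow> f u y)) = \<bar>\<rho> u * exp (- (c + u / 2) * x) / (u + 2 * c)\<bar>" for u
    proof -
      \<comment> \<open>For fixed u the function of y has the constant sign of
        \<open>\<rho> u\<close>, so the integral of its modulus is the modulus of the integral
        already computed.\<close>
      have "norm (case (u, y) of (u, y) \<Rightarrow> f u y) = (if 0 \<le> \<rho> u then f u y else - f u y)" for y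
        by (auto simp: f_def abs_mult indicator_def)
      hence "(LINT y|lborel. norm (case (u, y) of (u, y) \<Rightarrow> f u y)) = (if 0 \<le> \<rho> u then 1 else -1) * (LINT y|lborel. f u y)"
        by (cases "0 \<le> \<rho> u") simp_all
      also have "\<dots> = \<bar>\<rho> u * exp (- (c + u / 2) * x) / (u + 2 * c)\<bar>"
        using supp l c unfolding fy by (cases "\<rho> u = 0") (auto simp: abs_mult abs_divide)
      finally show ?thesis .
    qed
    moreover have "integrable lborel (\<lambda>u. \<bar>\<rho> u * exp (- (c + u / 2) * x) / (u + 2 * c)\<bar>)"
    proof (rule Bochner_Integration.integrable_bound[where f = "\<lambda>u. \<rho> u / l"])
      show "AE u in lborel. norm \<bar>\<rho> u * exp (- (c + u / 2) * x) / (u + 2 * c)\<bar> \<le> norm (\<rho> u / l)"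
      proof (intro AE_I2)
        fix u
        show "norm \<bar>\<rho> u * exp (- (c + u / 2) * x) / (u + 2 * c)\<bar> \<le> norm (\<rho> u / l)"
        proof (cases "\<rho> u = 0")
          case False
          hence u: "l \<le> u" using supp by auto
          have "(c + u / 2) * x \<ge> 0" using u l c x by (intro mult_nonneg_nonneg) auto
          hence "exp (- (c + u / 2) * x) \<le> 1" by (simp add: algebra_simps)
          hence "\<bar>\<rho> u\<bar> * exp (- (c + u / 2) * x) \<le> \<bar>\<rho> u\<bar> * 1" by (rule mult_left_mono) simp
          hence "\<bar>\<rho> u\<bar> * exp (- (c + u / 2) * x) / (u + 2 * c) \<le> \<bar>\<rho> u\<bar> / l"
            using u l c by (intro frac_le) auto
          thus ?thesis using u l c by (simp add: abs_mult)
        qed simp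
      qed
    qed (use \<rho> in simp_all)
    ultimately show "integrable lborel (\<lambda>u. LINT y|lborel. norm (case (u, y) of (u, y) \<Rightarrow> f u y))" by simp
  qed
  note J = this
  have fu: "(LINT u|lborel. f u y) = indicator {x..} y *\<^sub>R (exp (- c * y) * (LINT u|lborel. \<rho> u * exp (- u * y / 2) / 2))" for y
  proof -
    have "f u y = indicator {x..} y * exp (- c * y) * (\<rho> u * exp (- u * y / 2) / 2)" for u
    proof -
      have "- (c + u / 2) * y = - c * y + - u * y / 2" by (simp add: algebra_simps)
      hence "exp (- (c + u / 2) * y) = exp (- c * y) * exp (- u * y / 2)" by (simp only: exp_add)
      thus ?thesis by (simp add: f_def)
    qed
    thus ?thesis by (simp only: integral_mult_right_zero real_scaleR_def mult.assoc)
  qed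
  show ?th1 using lborel_pair.integrable_snd[OF J] unfolding set_integrable_def fu .
  have "(LBINT y:{x..}. exp (- c * y) * (LINT u|lborel. \<rho> u * exp (- u * y / 2) / 2)) = (LINT y|lborel. LINT u|lborel. f u y)"
    unfolding set_lebesgue_integral_def fu ..
  also have "\<dots> = (LINT u|lborel. LINT y|lborel. f u y)" by (rule lborel_pair.Fubini_integral[OF J])
  finally show ?th2 unfolding fy .
qed

text \<open>Under t = exp (-y) the Laplace transform at j is the j-th moment on [0,1], so the
  hypothesis fixes the integrals of polynomials and, by Weierstrass, of continuous functions. As
  \<open>p\<close> may change sign, the approximation error is measured against the integral of its
  modulus.\<close>

lemma (in prob_space) laplace_tail_unique:
  fixes Q :: "'a \<Rightarrow> real" and p :: "real \<Rightarrow> real"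
  assumes Q[measurable]: "Q \<in> borel_measurable M" and Qnn: "\<And>\<omega>. \<omega> \<in> space M \<Longrightarrow> 0 \<le> Q \<omega>"
    and p: "set_integrable lborel {0..} p"
    and eq: "\<And>j::nat. expectation (\<lambda>\<omega>. exp (- real j * Q \<omega>)) = (LBINT y:{0..}. exp (- real j * y) * p y)"
    and x: "0 \<le> x"
  shows "prob {\<omega> \<in> space M. x < Q \<omega>} = (LBINT y:{x<..}. p y)"
proof -
  define P where "P y = indicator {0..} y * p y" for y
  have P: "integrable lborel P" using p by (simp add: set_integrable_def P_def[abs_def])
  have [measurable]: "P \<in> borel_measurable borel" using borel_measurable_integrable[OF P] by simp
  have Psupp: "P y = 0" if "y < 0" for y using that by (simp add: P_def)
  have exp_in: "exp (- y) \<in> {0..1}" if "0 \<le> y" for y :: real using that by simp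
  have pow: "integrable M (\<lambda>\<omega>. exp (- Q \<omega>) ^ j)" "integrable lborel (\<lambda>y. exp (- y) ^ j * P y)"
    "(LINT \<omega>|M. exp (- Q \<omega>) ^ j) = (LINT y|lborel. exp (- y) ^ j * P y)" for j :: nat
  proof -
    show "integrable M (\<lambda>\<omega>. exp (- Q \<omega>) ^ j)"
      by (rule integrable_const_bound[where B = 1]) (use Qnn in \<open>auto intro!: AE_I2 power_le_one\<close>)
    show "integrable lborel (\<lambda>y. exp (- y) ^ j * P y)"
    proof (rule Bochner_Integration.integrable_bound[OF P])
      show "AE y in lborel. norm (exp (- y) ^ j * P y) \<le> norm (P y)"
      proof (intro AE_I2)
        fix y show "norm (exp (- y) ^ j * P y) \<le> norm (P y)"
          using Psupp[of y] mult_right_mono[of "exp (- y) ^ j" 1 "\<bar>P y\<bar>"]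
          by (cases "0 \<le> y") (auto simp: abs_mult power_le_one)
      qed
    qed measurable
    have e: "exp (- real j * y) = exp (- y) ^ j" for y :: real using exp_of_nat_mult[of j "- y"] by simp
    show "(LINT \<omega>|M. exp (- Q \<omega>) ^ j) = (LINT y|lborel. exp (- y) ^ j * P y)"
      using eq[of j] unfolding e set_lebesgue_integral_def P_def by (simp add: mult_ac)
  qed
  have bdd: "integrable M (\<lambda>\<omega>. g (exp (- Q \<omega>)))" "integrable lborel (\<lambda>y. g (exp (- y)) * P y)"
    if [measurable]: "g \<in> borel_measurable borel" and gb: "\<And>t. t \<in> {0..1} \<Longrightarrow> \<bar>g t\<bar> \<le> B" for g :: "real \<Rightarrow> real" and B
  proof -
    show "integrable M (\<lambda>\<omega>. g (exp (- Q \<omega>)))"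
      by (rule integrable_const_bound[where B = B]) (use Qnn gb in \<open>auto intro!: AE_I2\<close>)
    show "integrable lborel (\<lambda>y. g (exp (- y)) * P y)"
    proof (rule Bochner_Integration.integrable_bound[where f="\<lambda>y. B * P y"])
      show "AE y in lborel. norm (g (exp (- y)) * P y) \<le> norm (B * P y)"
      proof (intro AE_I2)
        fix y show "norm (g (exp (- y)) * P y) \<le> norm (B * P y)"
          using Psupp[of y] gb[OF exp_in[of y]] by (cases "0 \<le> y") (auto simp: abs_mult intro!: mult_right_mono)
      qed
    qed (use P in auto)
  qed
  have cont: "(LINT \<omega>|M. g (exp (- Q \<omega>))) = (LINT y|lborel. g (exp (- y)) * P y)"
    if g: "continuous_on UNIV g" for g :: "real \<Rightarrow> real"
  proof (rule ccontr)
    have [measurable]: "g \<in> borel_measurable borel" using g by (rule borel_measurable_continuous_onI)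
    define D where "D = \<bar>(LINT \<omega>|M. g (exp (- Q \<omega>))) - (LINT y|lborel. g (exp (- y)) * P y)\<bar>"
    define N where "N = (LINT y|lborel. \<bar>P y\<bar>)"
    assume "(LINT \<omega>|M. g (exp (- Q \<omega>))) \<noteq> (LINT y|lborel. g (exp (- y)) * P y)"
    hence D: "D > 0" by (simp add: D_def)
    have N: "N \<ge> 0" by (simp add: N_def)
    \<comment> \<open>The error is at most e under M and e N against |P|, together D / 2.\<close>
    define e where "e = D / (2 * (1 + N))"
    have e: "e > 0" using D N by (simp add: e_def)
    have "compact {0..1::real}" "continuous_on {0..1} g" using g continuous_on_subset by auto
    then obtain h where h: "real_polynomial_function h" "\<And>t. t \<in> {0..1} \<Longrightarrow> \<bar>g t - h t\<bar> < e"
      using Stone_Weierstrass_real_polynomial_function[of "{0..1::real}" g e] e by blast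
    obtain a n where han: "h = (\<lambda>t. \<Sum>i\<le>n. a i * t ^ i)" using real_polynomial_function_imp_sum[OF h(1)] by blast
    have hint: "(LINT \<omega>|M. h (exp (- Q \<omega>))) = (LINT y|lborel. h (exp (- y)) * P y)"
      unfolding han sum_distrib_right using pow by (simp add: mult.assoc)
    have [measurable]: "h \<in> borel_measurable borel" unfolding han by measurable
    have gc: "\<exists>B. \<forall>t\<in>{0..1}. \<bar>g t\<bar> \<le> B"
      using compact_imp_bounded[OF compact_continuous_image[OF \<open>continuous_on {0..1} g\<close> \<open>compact {0..1}\<close>]]
      by (auto simp: bounded_iff)
    then obtain B where B: "\<And>t. t \<in> {0..1} \<Longrightarrow> \<bar>g t\<bar> \<le> B" by blast
    have B': "\<bar>h t\<bar> \<le> B + e" if "t \<in> {0..1}" for t using B[OF that] h(2)[OF that] by linarith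
    note ig = bdd[of g, OF _ B] and ih = bdd[of h, OF _ B']
    have "\<bar>(LINT \<omega>|M. g (exp (- Q \<omega>))) - (LINT \<omega>|M. h (exp (- Q \<omega>)))\<bar> \<le> e"
    proof -
      have "\<bar>LINT \<omega>|M. g (exp (- Q \<omega>)) - h (exp (- Q \<omega>))\<bar> \<le> (LINT \<omega>|M. \<bar>g (exp (- Q \<omega>)) - h (exp (- Q \<omega>))\<bar>)"
        by (rule integral_abs_bound)
      also have "\<dots> \<le> (LINT \<omega>|M. e)"
        using ig(1) ih(1) Qnn h(2)[OF exp_in] by (intro integral_mono) (auto intro!: less_imp_le)
      finally show ?thesis using ig(1) ih(1) by (simp add: prob_space)
    qed
    moreover have "\<bar>(LINT y|lborel. g (exp (- y)) * P y) - (LINT y|lborel. h (exp (- y)) * P y)\<bar> \<le> e * N"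
    proof -
      have "\<bar>LINT y|lborel. g (exp (- y)) * P y - h (exp (- y)) * P y\<bar> \<le> (LINT y|lborel. \<bar>g (exp (- y)) * P y - h (exp (- y)) * P y\<bar>)"
        by (rule integral_abs_bound)
      also have "\<dots> \<le> (LINT y|lborel. e * \<bar>P y\<bar>)"
      proof (rule integral_mono)
        fix y
        have "\<bar>g (exp (- y)) * P y - h (exp (- y)) * P y\<bar> = \<bar>g (exp (- y)) - h (exp (- y))\<bar> * \<bar>P y\<bar>"
          by (simp add: left_diff_distrib flip: abs_mult)
        thus "\<bar>g (exp (- y)) * P y - h (exp (- y)) * P y\<bar> \<le> e * \<bar>P y\<bar>"
          using Psupp[of y] h(2)[OF exp_in, of y] by (cases "0 \<le> y") (auto intro!: mult_right_mono)
      qed (use ig(2) ih(2) P in auto)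
      finally show ?thesis using ig(2) ih(2) by (simp add: N_def)
    qed
    ultimately have "D \<le> e * (1 + N)" unfolding D_def using hint by (simp add: algebra_simps)
    also have "\<dots> = D / 2" using N by (simp add: e_def field_simps)
    finally show False using D by simp
  qed
  \<comment> \<open>Continuous ramps converging pointwise to the indicator of t < exp (-x), which is
    the event y > x.\<close>
  define g where "g n t = max 0 (min 1 (real n * (exp (- x) - t)))" for n and t :: real
  have gm[measurable]: "g n \<in> borel_measurable borel" for n unfolding g_def by measurable
  have gb: "\<bar>g n t\<bar> \<le> 1" for n t by (auto simp: g_def)
  have glim: "(\<lambda>n. g n t) \<longlonglongrightarrow> indicator {..<exp (- x)} t" for t
  proof (cases "t < exp (- x)")
    case True
    have "filterlim (\<lambda>n. real n * (exp (- x) - t)) at_top sequentially" using True by real_asymp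
    hence "\<forall>\<^sub>F n in sequentially. 1 \<le> real n * (exp (- x) - t)" by (auto simp: filterlim_at_top)
    hence "\<forall>\<^sub>F n in sequentially. g n t = indicator {..<exp (- x)} t"
      by eventually_elim (use True in \<open>auto simp: g_def\<close>)
    thus ?thesis by (rule tendsto_eventually)
  next
    case False
    hence "real n * (exp (- x) - t) \<le> 0" for n by (intro mult_nonneg_nonpos) auto
    hence "g n t = 0" for n by (simp add: g_def min.coboundedI2 max_absorb1)
    thus ?thesis using False by simp
  qed
  have "(\<lambda>n. LINT \<omega>|M. g n (exp (- Q \<omega>))) \<longlonglongrightarrow> (LINT \<omega>|M. indicator {..<exp (- x)} (exp (- Q \<omega>)))"
    by (rule integral_dominated_convergence[where w="\<lambda>_. 1"]) (use glim gb in auto)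
  moreover have "(\<lambda>n. LINT \<omega>|M. g n (exp (- Q \<omega>))) \<longlonglongrightarrow> (LINT y|lborel. indicator {..<exp (- x)} (exp (- y)) * P y)"
  proof -
    have "(\<lambda>n. LINT y|lborel. g n (exp (- y)) * P y) \<longlonglongrightarrow> (LINT y|lborel. indicator {..<exp (- x)} (exp (- y)) * P y)"
    proof (rule integral_dominated_convergence[where w="\<lambda>y. \<bar>P y\<bar>"])
      show "AE y in lborel. (\<lambda>n. g n (exp (- y)) * P y) \<longlonglongrightarrow> indicator {..<exp (- x)} (exp (- y)) * P y"
        by (intro AE_I2 tendsto_mult glim tendsto_const)
      show "AE y in lborel. norm (g n (exp (- y)) * P y) \<le> \<bar>P y\<bar>" for n
        using gb mult_right_mono[of "\<bar>g n (exp (- y))\<bar>" 1 "\<bar>P y\<bar>" for y] by (auto simp: abs_mult)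
    qed (use P in auto)
    moreover have "continuous_on UNIV (g n)" for n unfolding g_def by (intro continuous_intros)
    ultimately show ?thesis using cont by simp
  qed
  ultimately have "(LINT \<omega>|M. indicator {..<exp (- x)} (exp (- Q \<omega>)))
      = (LINT y|lborel. indicator {..<exp (- x)} (exp (- y)) * P y)" by (rule LIMSEQ_unique)
  moreover have "(LINT \<omega>|M. indicator {..<exp (- x)} (exp (- Q \<omega>))) = (LINT \<omega>|M. indicator {\<omega> \<in> space M. x < Q \<omega>} \<omega> :: real)"
    by (intro Bochner_Integration.integral_cong) (auto simp: indicator_def)
  moreover have "(LINT y|lborel. indicator {..<exp (- x)} (exp (- y)) * P y) = (LBINT y:{x<..}. p y)"
    unfolding set_lebesgue_integral_def P_def using x
    by (intro Bochner_Integration.integral_cong) (auto simp: indicator_def)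
  ultimately show ?thesis by simp
qed

text \<open>The hypothesis is the Laplace transform of a sum of independent squared centred normals
  with variances 1 / a k and 1 / b k. At s = j, \<open>S (Suc m)\<close> at -2j is at once this
  transform and that of the signed mixture \<open>p\<close>.\<close>

theorem (in interlacing) smirnov_finite:
  fixes M :: "'a measure" and Q :: "'a \<Rightarrow> real"
  assumes "prob_space M" and Q: "Q \<in> borel_measurable M" "\<And>\<omega>. \<omega> \<in> space M \<Longrightarrow> 0 \<le> Q \<omega>"
    and laplace: "\<And>s. 0 \<le> s \<Longrightarrow> (LINT \<omega>|M. exp (- s * Q \<omega>)) = 1 / sqrt (F (Suc m) (- 2 * s))"
    and x: "0 \<le> x"
  shows "measure M {\<omega> \<in> space M. x < Q \<omega>} = (\<Sum>k<Suc m. (-1) ^ k * (LINT u|lborel. \<rho> (Suc m) k u * exp (- u * x / 2) / u))"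
proof -
  interpret prob_space M by fact
  define p where "p y = (\<Sum>k<Suc m. (-1) ^ k * (LINT u|lborel. \<rho> (Suc m) k u * exp (- u * y / 2) / 2))" for y
  have r: "integrable lborel (\<rho> (Suc m) k)" "\<forall>u. \<rho> (Suc m) k u \<noteq> 0 \<longrightarrow> a k \<le> u" "0 < a k" if "k < Suc m" for k
    using stieltjes_formula(1)[of k m] \<rho>_supp[of "Suc m" k] a_pos that by auto
  have mix: "(LBINT y:{t..}. exp (- c * y) * p y)
      = (\<Sum>k<Suc m. (-1) ^ k * (LINT u|lborel. \<rho> (Suc m) k u * exp (- (c + u / 2) * t) / (u + 2 * c)))"
    and mixi: "set_integrable lborel {t..} (\<lambda>y. exp (- c * y) * p y)" if ct: "0 \<le> c" "0 \<le> t" for c t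
  proof -
    define h where "h k y = indicator {t..} y *\<^sub>R (exp (- c * y) * (LINT u|lborel. \<rho> (Suc m) k u * exp (- u * y / 2) / 2))" for k y
    have hi: "integrable lborel (h k)" if "k < Suc m" for k
      using exp_mixture_integral(1)[OF r[OF that] ct] unfolding set_integrable_def h_def .
    have hl: "(LINT y|lborel. h k y) = (LINT u|lborel. \<rho> (Suc m) k u * exp (- (c + u / 2) * t) / (u + 2 * c))" if "k < Suc m" for k
      using exp_mixture_integral(2)[OF r[OF that] ct] unfolding set_lebesgue_integral_def h_def .
    have e: "indicator {t..} y *\<^sub>R (exp (- c * y) * p y) = (\<Sum>k<Suc m. (-1) ^ k * h k y)" for y
      unfolding p_def h_def sum_distrib_left scaleR_sum_right by (intro sum.cong) (auto simp: mult_ac)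
    show "set_integrable lborel {t..} (\<lambda>y. exp (- c * y) * p y)"
      unfolding set_integrable_def e using hi
      by (intro Bochner_Integration.integrable_sum integrable_mult_right) auto
    have "(LBINT y:{t..}. exp (- c * y) * p y) = (\<Sum>k<Suc m. LINT y|lborel. (-1) ^ k * h k y)"
      unfolding set_lebesgue_integral_def e using hi
      by (intro Bochner_Integration.integral_sum integrable_mult_right) auto
    also have "\<dots> = (\<Sum>k<Suc m. (-1) ^ k * (LINT u|lborel. \<rho> (Suc m) k u * exp (- (c + u / 2) * t) / (u + 2 * c)))"
      by (intro sum.cong refl) (simp add: hl)
    finally show "(LBINT y:{t..}. exp (- c * y) * p y)
      = (\<Sum>k<Suc m. (-1) ^ k * (LINT u|lborel. \<rho> (Suc m) k u * exp (- (c + u / 2) * t) / (u + 2 * c)))" .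
  qed
  have "prob {\<omega> \<in> space M. x < Q \<omega>} = (LBINT y:{x<..}. p y)"
  proof (rule laplace_tail_unique[OF Q _ _ x])
    show "set_integrable lborel {0..} p" using mixi[of 0 0] by simp
    fix j :: nat
    have Fpos: "0 < F (Suc m) (- 2 * real j)" unfolding F_def
    proof (intro prod_pos mult_pos_pos)
      fix k
      have "0 \<le> 2 * real j / a k" "0 \<le> 2 * real j / b k" using a_pos[of k] ab[of k] by auto
      thus "0 < 1 - - 2 * real j / a k" "0 < 1 - - 2 * real j / b k" by auto
    qed
    have "(LBINT y:{0..}. exp (- real j * y) * p y) = S (Suc m) (- 2 * real j)"
      using mix[of "real j" 0] by (simp add: S_def)
    also have "\<dots> = 1 / sqrt (F (Suc m) (- 2 * real j))"
      using stieltjes_formula(2)[of "- 2 * real j" m] a0 Fpos by simp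
    finally show "expectation (\<lambda>\<omega>. exp (- real j * Q \<omega>)) = (LBINT y:{0..}. exp (- real j * y) * p y)"
      using laplace[of "real j"] by simp
  qed
  \<comment> \<open>The mixture formula is stated on closed half lines; the added point is
    null.\<close>
  also have "\<dots> = (LBINT y:{x..}. p y)"
    unfolding set_lebesgue_integral_def
  proof (rule integral_cong_AE)
    have "set_borel_measurable lborel {0..} p" using mixi[of 0 0] by (simp add: set_integrable_def set_borel_measurable_def)
    hence m: "(\<lambda>y. indicator {0..} y *\<^sub>R p y) \<in> borel_measurable borel" by (simp add: set_borel_measurable_def)
    have e1: "(\<lambda>y. indicator {x<..} y *\<^sub>R p y) = (\<lambda>y. indicator {x<..} y *\<^sub>R (indicator {0..} y *\<^sub>R p y))"
      and e2: "(\<lambda>y. indicator {x..} y *\<^sub>R p y) = (\<lambda>y. indicator {x..} y *\<^sub>R (indicator {0..} y *\<^sub>R p y))"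
      using x by (auto simp: indicator_def fun_eq_iff)
    show "(\<lambda>y. indicator {x<..} y *\<^sub>R p y) \<in> borel_measurable lborel" unfolding e1 using m by measurable
    show "(\<lambda>y. indicator {x..} y *\<^sub>R p y) \<in> borel_measurable lborel" unfolding e2 using m by measurable
    show "AE y in lborel. indicator {x<..} y *\<^sub>R p y = indicator {x..} y *\<^sub>R p y"
      using AE_lborel_singleton[of x] by eventually_elim (auto simp: indicator_def)
  qed
  also have "\<dots> = (\<Sum>k<Suc m. (-1) ^ k * (LINT u|lborel. \<rho> (Suc m) k u * exp (- u * x / 2) / u))"
    using mix[of 0 x] x by simp
  finally show ?thesis .
qed

section \<open>Gaussian functionals of the Wiener process\<close>

text \<open>Lists of possibly overlapping intervals make sums and multiples of step functions
  immediate, by concatenation and mapping; disjointness is restored by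
  \<open>common_refinement\<close> only where independence is used.\<close>

definition step_sum :: "(real \<times> real \<times> real) list \<Rightarrow> real \<Rightarrow> real" where
  "step_sum L u = (\<Sum>(c, s, t)\<leftarrow>L. c * indicator {s<..t} u)"

definition incr_sum :: "(real \<Rightarrow> 'a \<Rightarrow> real) \<Rightarrow> (real \<times> real \<times> real) list \<Rightarrow> 'a \<Rightarrow> real" where
  "incr_sum B L \<omega> = (\<Sum>(c, s, t)\<leftarrow>L. c * (B t \<omega> - B s \<omega>))"

definition ordered_times :: "(real \<times> real \<times> real) list \<Rightarrow> bool" where
  "ordered_times L \<longleftrightarrow> (\<forall>(c, s, t)\<in>set L. 0 \<le> s \<and> s \<le> t)"

lemma telescope_between:
  fixes f :: "nat \<Rightarrow> real"
  assumes "i \<le> j" "j \<le> n"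
  shows "(\<Sum>l<n. (if i \<le> l \<and> l < j then 1 else 0) * (f (Suc l) - f l)) = f j - f i"
proof -
  have "(\<Sum>l<n. (if i \<le> l \<and> l < j then 1 else 0) * (f (Suc l) - f l)) = (\<Sum>l\<in>{i..<j}. f (Suc l) - f l)"
    using assms by (intro sum.mono_neutral_cong_right) auto
  also have "\<dots> = f j - f i" using assms(1) by (rule sum_Suc_diff')
  finally show ?thesis .
qed

text \<open>Quantified over \<open>f\<close> to serve both the increments of the process and the indicators of the intervals.\<close>

lemma common_refinement:
  assumes L: "ordered_times L"
  shows "\<exists>n (\<tau> :: nat \<Rightarrow> real) d. 0 \<le> \<tau> 0 \<and> strict_mono_on {..n} \<tau> \<and>
    (\<forall>f :: real \<Rightarrow> real. (\<Sum>(c, s, t)\<leftarrow>L. c * (f t - f s)) = (\<Sum>l<n. d l * (f (\<tau> (Suc l)) - f (\<tau> l))))"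
proof -
  define A where "A = insert 0 ((\<lambda>(c, s, t). s) ` set L \<union> (\<lambda>(c, s, t). t) ` set L)"
  have A: "finite A" "A \<noteq> {}" by (auto simp: A_def)
  have Ann: "x \<ge> 0" if "x \<in> A" for x using that L by (auto simp: A_def ordered_times_def)
  define xs where "xs = sorted_list_of_set A"
  have xs: "set xs = A" "sorted_wrt (<) xs" "xs \<noteq> []" using A by (auto simp: xs_def)
  define n where "n = length xs - 1"
  define \<tau> where "\<tau> i = xs ! i" for i
  have len: "i \<le> n \<longleftrightarrow> i < length xs" for i using xs(3) by (cases xs) (auto simp: n_def)
  have sm: "strict_mono_on {..n} \<tau>"
    unfolding strict_mono_on_def \<tau>_def using xs(2) by (auto simp: sorted_wrt_iff_nth_less len)
  have ex: "\<exists>i\<le>n. x = \<tau> i" if "x \<in> A" for x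
    using that xs(1) len unfolding \<tau>_def by (metis in_set_conv_nth)
  have "\<exists>d. \<forall>f :: real \<Rightarrow> real. (\<Sum>(c, s, t)\<leftarrow>K. c * (f t - f s)) = (\<Sum>l<n. d l * (f (\<tau> (Suc l)) - f (\<tau> l)))"
    if "set K \<subseteq> set L" for K
    using that
  proof (induction K)
    case Nil
    show ?case by (intro exI[of _ "\<lambda>_. 0"]) simp
  next
    case (Cons k K)
    then obtain d where d: "\<And>f :: real \<Rightarrow> real. (\<Sum>(c, s, t)\<leftarrow>K. c * (f t - f s)) = (\<Sum>l<n. d l * (f (\<tau> (Suc l)) - f (\<tau> l)))"
      by auto
    obtain c s t where k: "k = (c, s, t)" by (cases k) auto
    have kL: "(c, s, t) \<in> set L" using Cons.prems k by auto
    hence "s \<in> A" "t \<in> A" by (force simp: A_def)+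
    then obtain i j where ij: "i \<le> n" "s = \<tau> i" "j \<le> n" "t = \<tau> j" using ex by metis
    have "s \<le> t" using kL L by (auto simp: ordered_times_def)
    hence "i \<le> j" using sm ij unfolding strict_mono_on_def by (metis atMost_iff not_le)
    have "(\<Sum>(c, s, t)\<leftarrow>k # K. c * (f t - f s)) =
       (\<Sum>l<n. (c * (if i \<le> l \<and> l < j then 1 else 0) + d l) * (f (\<tau> (Suc l)) - f (\<tau> l)))" for f :: "real \<Rightarrow> real"
      using telescope_between[OF \<open>i \<le> j\<close> ij(3), of "\<lambda>l. f (\<tau> l)"] d[of f]
      by (simp add: k ij distrib_right sum.distrib sum_distrib_left[symmetric] mult.assoc)
    thus ?case by (intro exI[of _ "\<lambda>l. c * (if i \<le> l \<and> l < j then 1 else 0) + d l"]) blast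
  qed
  then obtain d where "\<forall>f :: real \<Rightarrow> real. (\<Sum>(c, s, t)\<leftarrow>L. c * (f t - f s)) = (\<Sum>l<n. d l * (f (\<tau> (Suc l)) - f (\<tau> l)))"
    by blast
  moreover have "0 \<le> \<tau> 0" using Ann[of "\<tau> 0"] xs(1,3) by (auto simp: \<tau>_def)
  ultimately show ?thesis using sm by (intro exI[of _ n] exI[of _ \<tau>] exI[of _ d] conjI)
qed

lemma (in prob_space) char_scaled_normal:
  assumes D: "distributed M lborel X (normal_density 0 \<sigma>)" and s: "0 < \<sigma>"
  shows "char (distr M borel (\<lambda>\<omega>. d * X \<omega>)) 1 = of_real (exp (- (d\<^sup>2 * \<sigma>\<^sup>2) / 2))"
proof -
  have [measurable]: "X \<in> borel_measurable M" using distributed_measurable[OF D] by simp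
  have "distributed M lborel (\<lambda>x. X x / \<sigma>) std_normal_density"
    using D normal_standard_normal_convert[OF s, of X 0] by simp
  hence eq: "distr M lborel (\<lambda>x. X x / \<sigma>) = std_normal_distribution" by (rule distributed_distr_eq_density)
  have "char (distr M borel (\<lambda>\<omega>. d * X \<omega>)) 1 = (CLINT \<omega>|M. iexp (d * \<sigma> * (X \<omega> / \<sigma>)))"
    using s by (simp add: char_def integral_distr)
  also have "\<dots> = char (distr M lborel (\<lambda>x. X x / \<sigma>)) (d * \<sigma>)"
    unfolding char_def by (subst integral_distr) auto
  also have "\<dots> = of_real (exp (- (d\<^sup>2 * \<sigma>\<^sup>2) / 2))"
    unfolding eq char_std_normal_distribution by (simp add: power_mult_distrib)
  finally show ?thesis .
qed

lemma step_sum_measurable [measurable]: "step_sum L \<in> borel_measurable borel"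
proof (induction L)
  case (Cons k L)
  obtain c s t where k: "k = (c, s, t)" by (cases k) auto
  have "step_sum (k # L) = (\<lambda>u. c * indicator {s<..t} u + step_sum L u)"
    by (auto simp: step_sum_def k)
  thus ?case using Cons by simp
qed (simp add: step_sum_def[abs_def])

lemma nn_integral_square_add_le:
  fixes f g :: "'b \<Rightarrow> real"
  assumes [measurable]: "f \<in> borel_measurable N" "g \<in> borel_measurable N"
  shows "(\<integral>\<^sup>+x. ennreal ((f x + g x)\<^sup>2) \<partial>N) \<le> 2 * (\<integral>\<^sup>+x. ennreal ((f x)\<^sup>2) \<partial>N) + 2 * (\<integral>\<^sup>+x. ennreal ((g x)\<^sup>2) \<partial>N)"
proof -
  have "(f x + g x)\<^sup>2 \<le> 2 * (f x)\<^sup>2 + 2 * (g x)\<^sup>2" for x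
    using sum_squares_ge_zero[of "f x - g x" 0] by (simp add: power2_eq_square algebra_simps)
  have "ennreal ((f x + g x)\<^sup>2) \<le> 2 * ennreal ((f x)\<^sup>2) + 2 * ennreal ((g x)\<^sup>2)" for x
  proof -
    have "ennreal (2 * (f x)\<^sup>2 + 2 * (g x)\<^sup>2) = 2 * ennreal ((f x)\<^sup>2) + 2 * ennreal ((g x)\<^sup>2)"
      by (simp add: ennreal_mult)
    thus ?thesis using ennreal_leI[OF \<open>\<And>x. (f x + g x)\<^sup>2 \<le> 2 * (f x)\<^sup>2 + 2 * (g x)\<^sup>2\<close>[of x]] by simp
  qed
  hence "(\<integral>\<^sup>+x. ennreal ((f x + g x)\<^sup>2) \<partial>N) \<le> (\<integral>\<^sup>+x. 2 * ennreal ((f x)\<^sup>2) + 2 * ennreal ((g x)\<^sup>2) \<partial>N)"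
    by (intro nn_integral_mono) auto
  also have "\<dots> = 2 * (\<integral>\<^sup>+x. ennreal ((f x)\<^sup>2) \<partial>N) + 2 * (\<integral>\<^sup>+x. ennreal ((g x)\<^sup>2) \<partial>N)"
    by (simp add: nn_integral_add nn_integral_cmult)
  finally show ?thesis .
qed

lemma young_abs: "0 < \<delta> \<Longrightarrow> 2 * \<bar>x * y\<bar> \<le> \<delta> * x\<^sup>2 + y\<^sup>2 / (\<delta>::real)"
proof -
  assume d: "0 < \<delta>"
  have "0 \<le> (\<delta> * \<bar>x\<bar> - \<bar>y\<bar>)\<^sup>2 / \<delta>" using d by simp
  also have "\<dots> = \<delta> * x\<^sup>2 - 2 * \<bar>x * y\<bar> + y\<^sup>2 / \<delta>"
    using d by (simp add: power2_diff field_simps abs_mult power2_eq_square)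
  finally show ?thesis by simp
qed

text \<open>Young's inequality with weight \<delta>, where e bounds the squared distance; the
  condition e <= \<delta>^2 turns the term e / \<delta> into \<delta>.\<close>

lemma integral_square_diff_le:
  fixes f g :: "'b \<Rightarrow> real"
  assumes f: "integrable N (\<lambda>x. (f x)\<^sup>2)" and fm[measurable]: "f \<in> borel_measurable N" "g \<in> borel_measurable N"
    and d: "(\<integral>\<^sup>+x. ennreal ((f x - g x)\<^sup>2) \<partial>N) \<le> ennreal e" "0 \<le> e" and g: "integrable N (\<lambda>x. (g x)\<^sup>2)"
    and delta: "0 < \<delta>" "e \<le> \<delta>\<^sup>2"
  shows "\<bar>(LINT x|N. (g x)\<^sup>2) - (LINT x|N. (f x)\<^sup>2)\<bar> \<le> e + \<delta> + \<delta> * (LINT x|N. (f x)\<^sup>2)"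
proof -
  have di: "integrable N (\<lambda>x. (f x - g x)\<^sup>2)"
    using d by (intro integrableI_bounded) (auto simp: le_less_trans)
  have dle: "(LINT x|N. (f x - g x)\<^sup>2) \<le> e"
    using d nn_integral_eq_integral[OF di] by simp
  have "\<bar>(LINT x|N. (g x)\<^sup>2) - (LINT x|N. (f x)\<^sup>2)\<bar> = \<bar>LINT x|N. (g x)\<^sup>2 - (f x)\<^sup>2\<bar>"
    using f g by simp
  also have "\<dots> \<le> (LINT x|N. \<bar>(g x)\<^sup>2 - (f x)\<^sup>2\<bar>)" by (rule integral_abs_bound)
  also have "\<dots> \<le> (LINT x|N. \<delta> * (f x)\<^sup>2 + (1 + 1 / \<delta>) * (f x - g x)\<^sup>2)"
  proof (rule integral_mono)
    fix x
    have "(g x)\<^sup>2 - (f x)\<^sup>2 = (f x - g x)\<^sup>2 - 2 * (f x * (f x - g x))" by (simp add: power2_eq_square algebra_simps)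
    hence "\<bar>(g x)\<^sup>2 - (f x)\<^sup>2\<bar> \<le> (f x - g x)\<^sup>2 + 2 * \<bar>f x * (f x - g x)\<bar>"
      using abs_triangle_ineq4[of "(f x - g x)\<^sup>2" "2 * (f x * (f x - g x))"] by (simp add: abs_mult)
    also have "\<dots> \<le> (f x - g x)\<^sup>2 + (\<delta> * (f x)\<^sup>2 + (f x - g x)\<^sup>2 / \<delta>)"
      using young_abs[OF delta(1), of "f x" "f x - g x"] by simp
    finally show "\<bar>(g x)\<^sup>2 - (f x)\<^sup>2\<bar> \<le> \<delta> * (f x)\<^sup>2 + (1 + 1 / \<delta>) * (f x - g x)\<^sup>2"
      by (simp add: algebra_simps)
  qed (use f g di in auto)
  also have "\<dots> = \<delta> * (LINT x|N. (f x)\<^sup>2) + (1 + 1 / \<delta>) * (LINT x|N. (f x - g x)\<^sup>2)"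
    using f di by simp
  also have "\<dots> \<le> \<delta> * (LINT x|N. (f x)\<^sup>2) + (1 + 1 / \<delta>) * e"
    using delta dle by (intro add_left_mono mult_left_mono) auto
  also have "(1 + 1 / \<delta>) * e \<le> e + \<delta>" using delta by (simp add: field_simps power2_eq_square)
  finally show ?thesis by simp
qed

lemma iexp_diff_le: "norm (iexp x - iexp y) \<le> \<bar>x - y\<bar>"
proof -
  have "norm (iexp x - iexp y) = norm (iexp y) * norm (iexp (x - y) - 1)"
  proof -
    have "iexp y * iexp (x - y) = iexp x" unfolding exp_add[symmetric] by (simp add: algebra_simps)
    hence "iexp x - iexp y = iexp y * (iexp (x - y) - 1)" by (simp only: right_diff_distrib mult_1_right)
    thus ?thesis by (simp only: norm_mult)
  qed
  also have "\<dots> \<le> \<bar>x - y\<bar>"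
    using iexp_approx1[of "x - y" 0] by simp
  finally show ?thesis .
qed

lemma exp_minus_lipschitz:
  fixes x y :: real
  assumes "0 \<le> x" "0 \<le> y"
  shows "\<bar>exp (- x) - exp (- y)\<bar> \<le> \<bar>x - y\<bar>"
proof -
  have *: "exp (- a) - exp (- b) \<le> b - a" if "0 \<le> a" "a \<le> b" for a b :: real
  proof -
    define E where "E = exp (a - b)"
    have "exp (- a) * (1 - E) \<le> 1 * (1 - E)" using that by (intro mult_right_mono) (auto simp: E_def)
    moreover have "1 + (a - b) \<le> E" unfolding E_def by (rule exp_ge_add_one_self)
    moreover have "exp (- a) * E = exp (- b)" by (simp add: E_def flip: exp_add)
    ultimately show ?thesis by (simp add: right_diff_distrib)
  qed
  show ?thesis using *[of x y] *[of y x] assms by (cases "x \<le> y") auto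
qed

section \<open>The law of Wiener integrals\<close>

locale wiener = prob_space M for M :: "'a measure" +
  fixes B :: "real \<Rightarrow> 'a \<Rightarrow> real"
  assumes B_meas: "\<And>t. 0 \<le> t \<Longrightarrow> B t \<in> borel_measurable M"
    and B_indep: "\<And>n t. 0 \<le> t 0 \<Longrightarrow> strict_mono_on {..n} t \<Longrightarrow>
      indep_vars (\<lambda>_. borel) (\<lambda>i \<omega>. B (t (Suc i)) \<omega> - B (t i) \<omega>) {..<n}"
    and B_normal: "\<And>s t. 0 \<le> s \<Longrightarrow> s < t \<Longrightarrow>
      distributed M lborel (\<lambda>\<omega>. B t \<omega> - B s \<omega>) (normal_density 0 (sqrt (t - s)))"
begin

lemma incr_sum_measurable:
  assumes "ordered_times L"
  shows "incr_sum B L \<in> borel_measurable M"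
  using assms
proof (induction L)
  case (Cons k L)
  obtain c s t where k: "k = (c, s, t)" by (cases k) auto
  have [measurable]: "B s \<in> borel_measurable M" "B t \<in> borel_measurable M" "incr_sum B L \<in> borel_measurable M"
    using Cons k by (auto simp: ordered_times_def intro!: B_meas)
  have "incr_sum B (k # L) = (\<lambda>\<omega>. c * (B t \<omega> - B s \<omega>) + incr_sum B L \<omega>)"
    by (auto simp: incr_sum_def k)
  thus ?case by simp
qed (simp add: incr_sum_def[abs_def])

text \<open>After refinement the intervals are disjoint: the increments are independent, so the
  characteristic function factorises, and the squares of the step function add up to the same
  exponent.\<close>

lemma incr_sum_char:
  assumes L: "ordered_times L"
  shows "integrable lborel (\<lambda>u. (step_sum L u)\<^sup>2)"
    and "(CLINT \<omega>|M. iexp (incr_sum B L \<omega>)) = of_real (exp (- (LINT u|lborel. (step_sum L u)\<^sup>2) / 2))"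
proof -
  obtain n and \<tau> :: "nat \<Rightarrow> real" and d where *: "0 \<le> \<tau> 0 \<and> strict_mono_on {..n} \<tau> \<and>
    (\<forall>f :: real \<Rightarrow> real. (\<Sum>(c, s, t)\<leftarrow>L. c * (f t - f s)) = (\<Sum>l<n. d l * (f (\<tau> (Suc l)) - f (\<tau> l))))"
    using common_refinement[OF L] by (elim exE)
  note \<tau> = conjunct1[OF *] conjunct1[OF conjunct2[OF *]] and ref = conjunct2[OF conjunct2[OF *]]
  have lt: "\<tau> i < \<tau> j" if "i < j" "j \<le> n" for i j
    using \<tau>(2) that unfolding strict_mono_on_def by auto
  have le: "\<tau> i \<le> \<tau> j" if "i \<le> j" "j \<le> n" for i j
    using lt[of i j] that by (cases "i = j") auto
  have ind: "indicator {s<..t} u = indicator {..t} u - (indicator {..s} u :: real)" if "s \<le> t" for s t u :: real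
    using that by (auto simp: indicator_def)
  \<comment> \<open>Writing the indicator of (s,t] as a difference of indicators of half lines
    brings it into the form f t - f s of the refinement identity.\<close>
  have "step_sum L u = (\<Sum>(c, s, t)\<leftarrow>L. c * (indicator {..t} u - indicator {..s} u))" for u
    unfolding step_sum_def using L ind
    by (intro arg_cong[where f=sum_list] map_cong refl) (auto simp: ordered_times_def)
  hence step: "step_sum L u = (\<Sum>l<n. d l * indicator {\<tau> l<..\<tau> (Suc l)} u)" for u
    using ref[rule_format, of "\<lambda>t. indicator {..t} u"] lt ind by (simp add: less_imp_le)
  have incr: "incr_sum B L \<omega> = (\<Sum>l<n. d l * (B (\<tau> (Suc l)) \<omega> - B (\<tau> l) \<omega>))" for \<omega>
    unfolding incr_sum_def by (rule ref[rule_format])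
  have disj: "indicator {\<tau> k<..\<tau> (Suc k)} u * indicator {\<tau> l<..\<tau> (Suc l)} u = (0::real)"
    if "k < n" "l < n" "k \<noteq> l" for k l u
  proof (cases "k < l")
    case True
    hence "\<tau> (Suc k) \<le> \<tau> l" using that by (intro le) auto
    thus ?thesis by (auto simp: indicator_def)
  next
    case False
    hence "\<tau> (Suc l) \<le> \<tau> k" using that by (intro le) auto
    thus ?thesis by (auto simp: indicator_def)
  qed
  have sq: "(step_sum L u)\<^sup>2 = (\<Sum>l<n. (d l)\<^sup>2 * indicator {\<tau> l<..\<tau> (Suc l)} u)" for u
  proof -
    have "(step_sum L u)\<^sup>2 = (\<Sum>k<n. \<Sum>l<n. d k * d l * (indicator {\<tau> k<..\<tau> (Suc k)} u * indicator {\<tau> l<..\<tau> (Suc l)} u))"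
      unfolding step power2_eq_square sum_product by (simp add: mult_ac)
    also have "\<dots> = (\<Sum>k<n. \<Sum>l<n. if l = k then (d k)\<^sup>2 * indicator {\<tau> k<..\<tau> (Suc k)} u else 0)"
      using disj by (intro sum.cong refl) (auto simp: power2_eq_square indicator_def)
    finally show ?thesis by simp
  qed
  have ii: "integrable lborel (\<lambda>u. (d l)\<^sup>2 * indicator {\<tau> l<..\<tau> (Suc l)} u)" if "l < n" for l
    using lt[of l "Suc l"] that by (intro integrable_mult_right integrable_real_indicator) (auto simp: less_imp_le)
  show "integrable lborel (\<lambda>u. (step_sum L u)\<^sup>2)"
    unfolding sq using ii by (intro Bochner_Integration.integrable_sum) auto
  have I: "(LINT u|lborel. (step_sum L u)\<^sup>2) = (\<Sum>l<n. (d l)\<^sup>2 * (\<tau> (Suc l) - \<tau> l))"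
    unfolding sq using ii lt by (subst Bochner_Integration.integral_sum) (auto simp: less_imp_le)
  have "incr_sum B L \<in> borel_measurable M" by (rule incr_sum_measurable[OF L])
  hence "(CLINT \<omega>|M. iexp (incr_sum B L \<omega>)) = char (distr M borel (\<lambda>\<omega>. \<Sum>l<n. d l * (B (\<tau> (Suc l)) \<omega> - B (\<tau> l) \<omega>))) 1"
    unfolding incr[abs_def] by (simp add: char_def integral_distr)
  also have "\<dots> = (\<Prod>l<n. char (distr M borel (\<lambda>\<omega>. d l * (B (\<tau> (Suc l)) \<omega> - B (\<tau> l) \<omega>))) 1)"
    by (rule char_distr_sum, rule indep_vars_compose2[OF B_indep[OF \<tau>], where Y="\<lambda>l x. d l * x"]) auto
  also have "\<dots> = (\<Prod>l<n. of_real (exp (- ((d l)\<^sup>2 * (\<tau> (Suc l) - \<tau> l)) / 2)))"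
  proof (intro prod.cong refl)
    fix l assume l: "l \<in> {..<n}"
    have "\<tau> l < \<tau> (Suc l)" "0 \<le> \<tau> l" using l lt le[of 0 l] \<tau>(1) by auto
    thus "char (distr M borel (\<lambda>\<omega>. d l * (B (\<tau> (Suc l)) \<omega> - B (\<tau> l) \<omega>))) 1 = of_real (exp (- ((d l)\<^sup>2 * (\<tau> (Suc l) - \<tau> l)) / 2))"
      using char_scaled_normal[OF B_normal, of "\<tau> l" "\<tau> (Suc l)" "d l"] by simp
  qed
  also have "\<dots> = of_real (exp (\<Sum>l<n. - ((d l)\<^sup>2 * (\<tau> (Suc l) - \<tau> l)) / 2))"
    by (simp add: exp_sum)
  also have "(\<Sum>l<n. - ((d l)\<^sup>2 * (\<tau> (Suc l) - \<tau> l)) / 2) = - (LINT u|lborel. (step_sum L u)\<^sup>2) / 2"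
    unfolding I by (simp add: sum_divide_distrib sum_negf)
  finally show "(CLINT \<omega>|M. iexp (incr_sum B L \<omega>)) = of_real (exp (- (LINT u|lborel. (step_sum L u)\<^sup>2) / 2))" .
qed

text \<open>\<open>Y\<close> is a version of $\int_0^\infty g\,dB$.\<close>

definition wiener_rep :: "('a \<Rightarrow> real) \<Rightarrow> (real \<Rightarrow> real) \<Rightarrow> bool" where
  "wiener_rep Y g \<longleftrightarrow> Y \<in> borel_measurable M \<and> g \<in> borel_measurable borel \<and>
     (\<exists>L. (\<forall>m. ordered_times (L m)) \<and>
        (\<lambda>m. \<integral>\<^sup>+u. ennreal ((g u - step_sum (L m) u)\<^sup>2) \<partial>lborel) \<longlonglongrightarrow> 0 \<and>
        (\<lambda>m. \<integral>\<^sup>+\<omega>. ennreal ((Y \<omega> - incr_sum B (L m) \<omega>)\<^sup>2) \<partial>M) \<longlonglongrightarrow> 0)"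

lemma wiener_rep_of_integral:
  assumes "has_wiener_integral M B f t I"
  shows "wiener_rep I (\<lambda>s. indicator {0..t} s * f s)"
proof -
  obtain n p c where p: "\<And>m. 0 \<le> p m 0 \<and> mono_on {..n m} (p m) \<and> p m (n m) \<le> t"
    and f: "(\<lambda>m. \<integral>\<^sup>+s\<in>{0..t}. ennreal ((f s - step_function (n m) (p m) (c m) s)\<^sup>2) \<partial>lborel) \<longlonglongrightarrow> 0"
    and I: "(\<lambda>m. \<integral>\<^sup>+\<omega>. ennreal ((I \<omega> - step_integral B (n m) (p m) (c m) \<omega>)\<^sup>2) \<partial>M) \<longlonglongrightarrow> 0"
    using assms unfolding has_wiener_integral_def by blast
  define L where "L m = map (\<lambda>i. (c m i, p m i, p m (Suc i))) [0..<n m]" for m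
  have le: "p m i \<le> p m j" if "i \<le> j" "j \<le> n m" for m i j
    using p[of m] that unfolding mono_on_def by auto
  have ord: "ordered_times (L m)" for m
  proof -
    have "0 \<le> p m i \<and> p m i \<le> p m (Suc i)" if "i < n m" for i
      using le[of 0 i m] le[of i "Suc i" m] p[of m] that by auto
    thus ?thesis by (auto simp: ordered_times_def L_def)
  qed
  have step: "step_sum (L m) = step_function (n m) (p m) (c m)" for m
    by (simp add: fun_eq_iff step_sum_def step_function_def L_def o_def interv_sum_list_conv_sum_set_nat atLeast0LessThan)
  have incr: "incr_sum B (L m) = step_integral B (n m) (p m) (c m)" for m
    by (simp add: fun_eq_iff incr_sum_def step_integral_def L_def o_def interv_sum_list_conv_sum_set_nat atLeast0LessThan)
  \<comment> \<open>All partition points lie in [0,t], so approximation in L^2[0,t] is approximation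
    on the whole line of f cut off outside [0,t].\<close>
  have out: "step_function (n m) (p m) (c m) s = 0" if "s \<notin> {0..t}" for m s
  proof -
    have "s \<notin> {p m i<..p m (Suc i)}" if "i < n m" for i
      using le[of 0 i m] le[of "Suc i" "n m" m] p[of m] that \<open>s \<notin> {0..t}\<close> by auto
    thus ?thesis by (auto simp: step_function_def)
  qed
  have "ennreal ((indicator {0..t} s * f s - step_sum (L m) s)\<^sup>2)
      = ennreal ((f s - step_function (n m) (p m) (c m) s)\<^sup>2) * indicator {0..t} s" for m s
    unfolding step using out[of s m] by (cases "s \<in> {0..t}") auto
  moreover have "(\<lambda>s. indicator {0..t} s * f s) \<in> borel_measurable borel"
    using assms by (simp add: has_wiener_integral_def set_borel_measurable_def)
  ultimately show ?thesis unfolding wiener_rep_def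
    using f I ord assms by (intro conjI exI[of _ L]) (simp_all add: incr has_wiener_integral_def)
qed

lemma wiener_rep_measurable:
  assumes "wiener_rep Y g"
  shows "Y \<in> borel_measurable M" "g \<in> borel_measurable borel"
  using assms by (auto simp: wiener_rep_def)

lemma wiener_rep_cong_AE:
  assumes Y: "wiener_rep Y g" and Z: "Z \<in> borel_measurable M" "AE \<omega> in M. Y \<omega> = Z \<omega>"
  shows "wiener_rep Z g"
proof -
  have "(\<integral>\<^sup>+\<omega>. ennreal ((Z \<omega> - incr_sum B K \<omega>)\<^sup>2) \<partial>M) = (\<integral>\<^sup>+\<omega>. ennreal ((Y \<omega> - incr_sum B K \<omega>)\<^sup>2) \<partial>M)" for K
    by (rule nn_integral_cong_AE) (use Z(2) in \<open>auto elim!: eventually_mono\<close>)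
  thus ?thesis using Y Z(1) unfolding wiener_rep_def by simp
qed

lemma wiener_rep_scale:
  assumes "wiener_rep Y g"
  shows "wiener_rep (\<lambda>\<omega>. a * Y \<omega>) (\<lambda>u. a * g u)"
proof -
  obtain L where L: "\<And>m. ordered_times (L m)"
    and g: "(\<lambda>m. \<integral>\<^sup>+u. ennreal ((g u - step_sum (L m) u)\<^sup>2) \<partial>lborel) \<longlonglongrightarrow> 0"
    and Y: "(\<lambda>m. \<integral>\<^sup>+\<omega>. ennreal ((Y \<omega> - incr_sum B (L m) \<omega>)\<^sup>2) \<partial>M) \<longlonglongrightarrow> 0"
    using assms unfolding wiener_rep_def by blast
  note [measurable] = wiener_rep_measurable[OF assms] incr_sum_measurable[OF L]
  define K where "K m = map (\<lambda>(c, s, t). (a * c, s, t)) (L m)" for m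
  have ord: "ordered_times (K m)" for m using L[of m] by (auto simp: K_def ordered_times_def)
  have step: "step_sum (K m) u = a * step_sum (L m) u" for m u
    by (simp add: step_sum_def K_def o_def case_prod_beta sum_list_const_mult[symmetric] mult.assoc)
  have incr: "incr_sum B (K m) \<omega> = a * incr_sum B (L m) \<omega>" for m \<omega>
    by (simp add: incr_sum_def K_def o_def case_prod_beta sum_list_const_mult[symmetric] mult.assoc)
  have sq: "ennreal ((a * x - a * y)\<^sup>2) = ennreal (a\<^sup>2) * ennreal ((x - y)\<^sup>2)" for x y
    by (simp add: right_diff_distrib[symmetric] power_mult_distrib ennreal_mult)
  show ?thesis unfolding wiener_rep_def
  proof (intro conjI exI[of _ K] allI)
    show "(\<lambda>m. \<integral>\<^sup>+u. ennreal ((a * g u - step_sum (K m) u)\<^sup>2) \<partial>lborel) \<longlonglongrightarrow> 0"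
      unfolding step sq using ennreal_tendsto_cmult[OF _ g, of "ennreal (a\<^sup>2)"]
      by (simp add: nn_integral_cmult)
    show "(\<lambda>m. \<integral>\<^sup>+\<omega>. ennreal ((a * Y \<omega> - incr_sum B (K m) \<omega>)\<^sup>2) \<partial>M) \<longlonglongrightarrow> 0"
      unfolding incr sq using ennreal_tendsto_cmult[OF _ Y, of "ennreal (a\<^sup>2)"]
      by (simp add: nn_integral_cmult)
  qed (use ord in auto)
qed

lemma wiener_rep_add:
  assumes "wiener_rep Y g" "wiener_rep Z h"
  shows "wiener_rep (\<lambda>\<omega>. Y \<omega> + Z \<omega>) (\<lambda>u. g u + h u)"
proof -
  obtain L where L: "\<And>m. ordered_times (L m)"
    and g: "(\<lambda>m. \<integral>\<^sup>+u. ennreal ((g u - step_sum (L m) u)\<^sup>2) \<partial>lborel) \<longlonglongrightarrow> 0"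
    and Y: "(\<lambda>m. \<integral>\<^sup>+\<omega>. ennreal ((Y \<omega> - incr_sum B (L m) \<omega>)\<^sup>2) \<partial>M) \<longlonglongrightarrow> 0"
    using assms unfolding wiener_rep_def by blast
  obtain K where K: "\<And>m. ordered_times (K m)"
    and h: "(\<lambda>m. \<integral>\<^sup>+u. ennreal ((h u - step_sum (K m) u)\<^sup>2) \<partial>lborel) \<longlonglongrightarrow> 0"
    and Z: "(\<lambda>m. \<integral>\<^sup>+\<omega>. ennreal ((Z \<omega> - incr_sum B (K m) \<omega>)\<^sup>2) \<partial>M) \<longlonglongrightarrow> 0"
    using assms unfolding wiener_rep_def by blast
  note [measurable] = wiener_rep_measurable[OF assms(1)] wiener_rep_measurable[OF assms(2)]
    incr_sum_measurable[OF L] incr_sum_measurable[OF K]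
  have step: "step_sum (L m @ K m) u = step_sum (L m) u + step_sum (K m) u" for m u by (simp add: step_sum_def)
  have incr: "incr_sum B (L m @ K m) \<omega> = incr_sum B (L m) \<omega> + incr_sum B (K m) \<omega>" for m \<omega> by (simp add: incr_sum_def)
  have lim: "(\<lambda>m. 2 * x m + 2 * y m) \<longlonglongrightarrow> 0" if "x \<longlonglongrightarrow> 0" "y \<longlonglongrightarrow> 0" for x y :: "nat \<Rightarrow> ennreal"
    using tendsto_add[OF ennreal_tendsto_cmult[OF _ that(1), of 2] ennreal_tendsto_cmult[OF _ that(2), of 2]] by simp
  show ?thesis unfolding wiener_rep_def
  proof (intro conjI exI[of _ "\<lambda>m. L m @ K m"] allI)
    show "(\<lambda>m. \<integral>\<^sup>+u. ennreal ((g u + h u - step_sum (L m @ K m) u)\<^sup>2) \<partial>lborel) \<longlonglongrightarrow> 0"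
    proof (rule tendsto_sandwich[OF _ _ tendsto_const lim[OF g h]])
      show "\<forall>\<^sub>F m in sequentially. (\<integral>\<^sup>+u. ennreal ((g u + h u - step_sum (L m @ K m) u)\<^sup>2) \<partial>lborel)
          \<le> 2 * (\<integral>\<^sup>+u. ennreal ((g u - step_sum (L m) u)\<^sup>2) \<partial>lborel) + 2 * (\<integral>\<^sup>+u. ennreal ((h u - step_sum (K m) u)\<^sup>2) \<partial>lborel)"
      proof (intro always_eventually allI)
        fix m
        have e: "g u + h u - step_sum (L m @ K m) u = (g u - step_sum (L m) u) + (h u - step_sum (K m) u)" for u
          by (simp add: step)
        show "(\<integral>\<^sup>+u. ennreal ((g u + h u - step_sum (L m @ K m) u)\<^sup>2) \<partial>lborel)
          \<le> 2 * (\<integral>\<^sup>+u. ennreal ((g u - step_sum (L m) u)\<^sup>2) \<partial>lborel) + 2 * (\<integral>\<^sup>+u. ennreal ((h u - step_sum (K m) u)\<^sup>2) \<partial>lborel)"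
          unfolding e by (rule nn_integral_square_add_le) auto
      qed
    qed auto
    show "(\<lambda>m. \<integral>\<^sup>+\<omega>. ennreal ((Y \<omega> + Z \<omega> - incr_sum B (L m @ K m) \<omega>)\<^sup>2) \<partial>M) \<longlonglongrightarrow> 0"
    proof (rule tendsto_sandwich[OF _ _ tendsto_const lim[OF Y Z]])
      show "\<forall>\<^sub>F m in sequentially. (\<integral>\<^sup>+\<omega>. ennreal ((Y \<omega> + Z \<omega> - incr_sum B (L m @ K m) \<omega>)\<^sup>2) \<partial>M)
          \<le> 2 * (\<integral>\<^sup>+\<omega>. ennreal ((Y \<omega> - incr_sum B (L m) \<omega>)\<^sup>2) \<partial>M) + 2 * (\<integral>\<^sup>+\<omega>. ennreal ((Z \<omega> - incr_sum B (K m) \<omega>)\<^sup>2) \<partial>M)"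
      proof (intro always_eventually allI)
        fix m
        have e: "Y \<omega> + Z \<omega> - incr_sum B (L m @ K m) \<omega> = (Y \<omega> - incr_sum B (L m) \<omega>) + (Z \<omega> - incr_sum B (K m) \<omega>)" for \<omega>
          by (simp add: incr)
        show "(\<integral>\<^sup>+\<omega>. ennreal ((Y \<omega> + Z \<omega> - incr_sum B (L m @ K m) \<omega>)\<^sup>2) \<partial>M)
          \<le> 2 * (\<integral>\<^sup>+\<omega>. ennreal ((Y \<omega> - incr_sum B (L m) \<omega>)\<^sup>2) \<partial>M) + 2 * (\<integral>\<^sup>+\<omega>. ennreal ((Z \<omega> - incr_sum B (K m) \<omega>)\<^sup>2) \<partial>M)"
          unfolding e by (rule nn_integral_square_add_le) auto
      qed
    qed auto
    show "ordered_times (L m @ K m)" for m using L[of m] K[of m] by (auto simp: ordered_times_def)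
  qed auto
qed

lemma wiener_rep_sum:
  assumes "\<And>j. j < (n::nat) \<Longrightarrow> wiener_rep (Y j) (g j)"
  shows "wiener_rep (\<lambda>\<omega>. \<Sum>j<n. a j * Y j \<omega>) (\<lambda>u. \<Sum>j<n. a j * g j u)"
  using assms
proof (induction n)
  case 0
  have "ordered_times []" "step_sum [] u = 0" "incr_sum B [] \<omega> = 0" for u \<omega>
    by (simp_all add: ordered_times_def step_sum_def incr_sum_def)
  thus ?case unfolding wiener_rep_def by (intro conjI exI[of _ "\<lambda>_. []"]) auto
next
  case (Suc n)
  thus ?case by (simp add: wiener_rep_add wiener_rep_scale)
qed


lemma char_diff_le:
  assumes [measurable]: "Y \<in> borel_measurable M" "Z \<in> borel_measurable M"
    and d: "(\<integral>\<^sup>+\<omega>. ennreal ((Y \<omega> - Z \<omega>)\<^sup>2) \<partial>M) \<le> ennreal e" "0 \<le> e" and delta: "0 < \<delta>" "e \<le> \<delta>\<^sup>2"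
  shows "norm ((CLINT \<omega>|M. iexp (Y \<omega>)) - (CLINT \<omega>|M. iexp (Z \<omega>))) \<le> \<delta>"
proof -
  have di: "integrable M (\<lambda>\<omega>. (Y \<omega> - Z \<omega>)\<^sup>2)"
    using d by (intro integrableI_bounded) (auto simp: le_less_trans)
  have dle: "(LINT x|M. (Y x - Z x)\<^sup>2) \<le> e" using d nn_integral_eq_integral[OF di] by simp
  have i: "integrable M (\<lambda>\<omega>. iexp (Y \<omega>))" "integrable M (\<lambda>\<omega>. iexp (Z \<omega>))"
    by (auto intro!: integrable_iexp)
  have "norm ((CLINT \<omega>|M. iexp (Y \<omega>)) - (CLINT \<omega>|M. iexp (Z \<omega>))) = norm (CLINT \<omega>|M. iexp (Y \<omega>) - iexp (Z \<omega>))"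
    using i by simp
  also have "\<dots> \<le> (LINT \<omega>|M. norm (iexp (Y \<omega>) - iexp (Z \<omega>)))" by (rule integral_norm_bound)
  also have "\<dots> \<le> (LINT \<omega>|M. \<delta> / 2 + (Y \<omega> - Z \<omega>)\<^sup>2 / (2 * \<delta>))"
  proof (rule integral_mono)
    fix \<omega>
    have "2 * \<bar>Y \<omega> - Z \<omega>\<bar> \<le> \<delta> + (Y \<omega> - Z \<omega>)\<^sup>2 / \<delta>" using young_abs[OF delta(1), of 1 "Y \<omega> - Z \<omega>"] by simp
    thus "norm (iexp (Y \<omega>) - iexp (Z \<omega>)) \<le> \<delta> / 2 + (Y \<omega> - Z \<omega>)\<^sup>2 / (2 * \<delta>)"
      using iexp_diff_le[of "Y \<omega>" "Z \<omega>"] by simp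
  qed (use i di in auto)
  also have "\<dots> = \<delta> / 2 + (LINT x|M. (Y x - Z x)\<^sup>2) / (2 * \<delta>)" using di by (simp add: prob_space)
  also have "\<dots> \<le> \<delta> / 2 + \<delta>\<^sup>2 / (2 * \<delta>)" using dle delta by (intro add_left_mono divide_right_mono) auto
  also have "\<dots> = \<delta>" using delta by (simp add: power2_eq_square)
  finally show ?thesis .
qed

text \<open>Both sides are continuous under the two L^2 limits: the left by the Lipschitz bound for
  iexp, the right because exp (-x) is Lipschitz for x >= 0. All errors are controlled by one
  \<delta> tending to 0.\<close>

lemma wiener_rep_char:
  assumes "wiener_rep Y g"
  shows "integrable lborel (\<lambda>u. (g u)\<^sup>2)"
    and "(CLINT \<omega>|M. iexp (Y \<omega>)) = of_real (exp (- (LINT u|lborel. (g u)\<^sup>2) / 2))"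
proof -
  obtain L where L: "\<And>m. ordered_times (L m)"
    and g: "(\<lambda>m. \<integral>\<^sup>+u. ennreal ((g u - step_sum (L m) u)\<^sup>2) \<partial>lborel) \<longlonglongrightarrow> 0"
    and Y: "(\<lambda>m. \<integral>\<^sup>+\<omega>. ennreal ((Y \<omega> - incr_sum B (L m) \<omega>)\<^sup>2) \<partial>M) \<longlonglongrightarrow> 0"
    using assms unfolding wiener_rep_def by blast
  note [measurable] = wiener_rep_measurable[OF assms] incr_sum_measurable[OF L]
  note si = incr_sum_char(1)[OF L]
  have ex: "\<exists>m. (\<integral>\<^sup>+u. ennreal ((g u - step_sum (L m) u)\<^sup>2) \<partial>lborel) \<le> ennreal (\<delta>\<^sup>2) \<and>
    (\<integral>\<^sup>+\<omega>. ennreal ((Y \<omega> - incr_sum B (L m) \<omega>)\<^sup>2) \<partial>M) \<le> ennreal (\<delta>\<^sup>2)" if "0 < \<delta>" for \<delta>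
  proof -
    have "0 < ennreal (\<delta>\<^sup>2)" using that by simp
    from eventually_conj[OF order_tendstoD(2)[OF g this] order_tendstoD(2)[OF Y this]]
    show ?thesis by (auto simp: eventually_sequentially intro: less_imp_le)
  qed
  show gi: "integrable lborel (\<lambda>u. (g u)\<^sup>2)"
  proof -
    obtain m where m: "(\<integral>\<^sup>+u. ennreal ((g u - step_sum (L m) u)\<^sup>2) \<partial>lborel) \<le> ennreal (1\<^sup>2)" using ex[of 1] by auto
    have "(\<integral>\<^sup>+u. ennreal ((g u)\<^sup>2) \<partial>lborel) = (\<integral>\<^sup>+u. ennreal (((g u - step_sum (L m) u) + step_sum (L m) u)\<^sup>2) \<partial>lborel)" by simp
    also have "\<dots> \<le> 2 * (\<integral>\<^sup>+u. ennreal ((g u - step_sum (L m) u)\<^sup>2) \<partial>lborel) + 2 * (\<integral>\<^sup>+u. ennreal ((step_sum (L m) u)\<^sup>2) \<partial>lborel)"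
      by (rule nn_integral_square_add_le) auto
    also have "\<dots> \<le> 2 * ennreal (1\<^sup>2) + 2 * ennreal (LINT u|lborel. (step_sum (L m) u)\<^sup>2)"
      using nn_integral_eq_integral[OF si[of m]] m by (intro add_mono mult_left_mono) auto
    also have "\<dots> < \<infinity>" by (simp add: ennreal_mult_less_top)
    finally show ?thesis by (intro integrableI_bounded) auto
  qed
  define I where "I = (LINT u|lborel. (g u)\<^sup>2)"
  have Inn: "0 \<le> I" by (simp add: I_def)
  have bound: "norm ((CLINT \<omega>|M. iexp (Y \<omega>)) - of_real (exp (- I / 2))) \<le> \<delta> + (\<delta>\<^sup>2 + \<delta> + \<delta> * I)" if d: "0 < \<delta>" for \<delta>
  proof -
    obtain m where m: "(\<integral>\<^sup>+u. ennreal ((g u - step_sum (L m) u)\<^sup>2) \<partial>lborel) \<le> ennreal (\<delta>\<^sup>2)"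
      "(\<integral>\<^sup>+\<omega>. ennreal ((Y \<omega> - incr_sum B (L m) \<omega>)\<^sup>2) \<partial>M) \<le> ennreal (\<delta>\<^sup>2)" using ex[OF d] by auto
    define J where "J = (LINT u|lborel. (step_sum (L m) u)\<^sup>2)"
    have Jnn: "0 \<le> J" by (simp add: J_def)
    have 1: "norm ((CLINT \<omega>|M. iexp (Y \<omega>)) - of_real (exp (- J / 2))) \<le> \<delta>"
      using char_diff_le[OF _ _ m(2) _ d] by (simp add: incr_sum_char(2)[OF L] J_def)
    have 2: "\<bar>J - I\<bar> \<le> \<delta>\<^sup>2 + \<delta> + \<delta> * I"
      using integral_square_diff_le[OF gi _ _ m(1) _ si d] by (simp add: I_def J_def)
    have 3: "\<bar>exp (- J / 2) - exp (- I / 2)\<bar> \<le> \<bar>J - I\<bar>"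
    proof -
      from exp_minus_lipschitz[of "J / 2" "I / 2"] Inn Jnn show ?thesis by simp
    qed
    have "norm (of_real (exp (- J / 2)) - of_real (exp (- I / 2)) :: complex) \<le> \<delta>\<^sup>2 + \<delta> + \<delta> * I"
      using 2 3 by (simp add: norm_of_real flip: of_real_diff del: of_real_exp)
    thus ?thesis using 1 norm_triangle_ineq[of "(CLINT \<omega>|M. iexp (Y \<omega>)) - of_real (exp (- J / 2))"
        "of_real (exp (- J / 2)) - of_real (exp (- I / 2))"] by simp
  qed
  have "((\<lambda>\<delta>. \<delta> + (\<delta>\<^sup>2 + \<delta> + \<delta> * I)) \<longlongrightarrow> 0 + (0\<^sup>2 + 0 + 0 * I)) (at_right (0::real))"
    by (intro tendsto_intros)
  hence "norm ((CLINT \<omega>|M. iexp (Y \<omega>)) - of_real (exp (- I / 2))) \<le> 0 + (0\<^sup>2 + 0 + 0 * I)"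
    by (rule tendsto_lowerbound) (use bound in \<open>auto simp: eventually_at_right_less eventually_at_filter\<close>)
  thus "(CLINT \<omega>|M. iexp (Y \<omega>)) = of_real (exp (- (LINT u|lborel. (g u)\<^sup>2) / 2))"
    by (simp add: I_def)
qed

end

text \<open>By Levy uniqueness the law is that of sqrt v times a standard normal variable, whose
  even moments are known.\<close>

lemma (in prob_space) gaussian_second_moment:
  assumes [measurable]: "Y \<in> borel_measurable M" and v: "0 < v"
    and ch: "\<And>a. (CLINT \<omega>|M. iexp (a * Y \<omega>)) = of_real (exp (- (a\<^sup>2 * v) / 2))"
  shows "(\<integral>\<^sup>+\<omega>. ennreal ((Y \<omega>)\<^sup>2) \<partial>M) = ennreal v"
proof -
  define N where "N = distr std_normal_distribution borel (\<lambda>x. sqrt v * x)"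
  interpret S: real_distribution std_normal_distribution by (rule real_dist_normal_dist)
  have sq: "(\<lambda>x. sqrt v * x) \<in> borel_measurable std_normal_distribution" by simp
  have "distr M borel Y = N"
  proof (rule Levy_uniqueness)
    show "real_distribution (distr M borel Y)" by (rule real_distribution_distr) simp
    show "real_distribution N" unfolding N_def by (rule S.real_distribution_distr) simp
    show "char (distr M borel Y) = char N"
    proof
      fix t
      have "char N t = char std_normal_distribution (t * sqrt v)"
        unfolding char_def N_def by (subst integral_distr) (auto simp: mult.assoc)
      also have "\<dots> = of_real (exp (- (t\<^sup>2 * v) / 2))"
        using v by (simp add: char_std_normal_distribution power_mult_distrib)
      also have "\<dots> = char (distr M borel Y) t"
        using ch[of t] by (simp add: char_def integral_distr)
      finally show "char (distr M borel Y) t = char N t" by simp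
    qed
  qed
  moreover have "(\<integral>\<^sup>+x. ennreal (x\<^sup>2) \<partial>distr M borel Y) = (\<integral>\<^sup>+\<omega>. ennreal ((Y \<omega>)\<^sup>2) \<partial>M)"
    by (rule nn_integral_distr) auto
  ultimately have "(\<integral>\<^sup>+\<omega>. ennreal ((Y \<omega>)\<^sup>2) \<partial>M) = (\<integral>\<^sup>+x. ennreal (x\<^sup>2) \<partial>N)" by simp
  also have "\<dots> = (\<integral>\<^sup>+x. ennreal ((sqrt v * x)\<^sup>2) \<partial>std_normal_distribution)"
    unfolding N_def by (rule nn_integral_distr) auto
  also have "\<dots> = (\<integral>\<^sup>+x. ennreal v * ennreal (x ^ (2 * 1)) \<partial>std_normal_distribution)"
    using v by (simp add: power_mult_distrib ennreal_mult)
  also have "\<dots> = ennreal v * (\<integral>\<^sup>+x. ennreal (x ^ (2 * 1)) \<partial>std_normal_distribution)"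
    by (rule nn_integral_cmult) simp
  also have "(\<integral>\<^sup>+x. ennreal (x ^ (2 * 1)) \<partial>std_normal_distribution) = ennreal 1"
    using nn_integral_eq_integral[OF std_normal_distribution_even_moments(2)[of 1]] std_normal_distribution_even_moments(1)[of 1]
    by simp
  finally show ?thesis by simp
qed

section \<open>Linear functionals of the bridge\<close>

text \<open>Rounding down keeps the grid point in [0,T) and never beyond t, so a sample approaches t
  from the left.\<close>

definition grid :: "real \<Rightarrow> nat \<Rightarrow> real \<Rightarrow> real" where
  "grid T n t = of_int \<lfloor>real n * t / T\<rfloor> * T / real n"

lemma grid_bounds:
  assumes "0 < T" "0 < n" "t \<in> {0..<T}"
  shows "0 \<le> grid T n t" "grid T n t \<le> t" "t - T / n \<le> grid T n t"
proof -
  have f: "of_int \<lfloor>real n * t / T\<rfloor> \<le> real n * t / T" "real n * t / T < of_int \<lfloor>real n * t / T\<rfloor> + 1"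
    by linarith+
  have "0 \<le> real n * t / T" using assms by auto
  hence "0 \<le> \<lfloor>real n * t / T\<rfloor>" by simp
  thus "0 \<le> grid T n t" using assms by (simp add: grid_def)
  have "of_int \<lfloor>real n * t / T\<rfloor> * T \<le> real n * t" using f(1) assms(1) by (simp only: pos_le_divide_eq)
  thus "grid T n t \<le> t" using assms by (simp add: grid_def pos_divide_le_eq mult.commute)
  have "real n * t \<le> (of_int \<lfloor>real n * t / T\<rfloor> + 1) * T" using f(2) assms by (simp add: field_simps)
  hence "t \<le> (of_int \<lfloor>real n * t / T\<rfloor> + 1) * T / real n" using assms by (simp add: pos_le_divide_eq mult.commute)
  thus "t - T / n \<le> grid T n t" by (simp add: grid_def distrib_right add_divide_distrib)
qed

lemma grid_tendsto:
  assumes "0 < T" "t \<in> {0..<T}"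
  shows "(\<lambda>n. grid T (Suc n) t) \<longlonglongrightarrow> t"
proof (rule tendsto_sandwich)
  show "\<forall>\<^sub>F n in sequentially. t - T / real (Suc n) \<le> grid T (Suc n) t"
    "\<forall>\<^sub>F n in sequentially. grid T (Suc n) t \<le> t"
    by (intro always_eventually allI grid_bounds[OF assms(1) _ assms(2)] zero_less_Suc)+
  show "(\<lambda>n. t - T / real (Suc n)) \<longlonglongrightarrow> t" by real_asymp
qed simp

lemma grid_sum:
  fixes F :: "real \<Rightarrow> real"
  assumes "0 < T" "0 < n"
  shows "(\<Sum>j<n. indicator {real j * T / n..<(real j + 1) * T / n} t * F (real j * T / n)) = indicator {0..<T} t * F (grid T n t)"
proof (cases "t \<in> {0..<T}")
  case True
  define i where "i = nat \<lfloor>real n * t / T\<rfloor>"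
  have nn: "0 \<le> real n * t / T" using True assms by auto
  have i: "real i \<le> real n * t / T" "real n * t / T < real i + 1"
    using nn unfolding i_def by (auto simp: of_nat_nat)
  have "real n * t / T < real n" using True assms by (simp add: field_simps)
  hence "i < n" using i by linarith
  have g: "grid T n t = real i * T / n" using nn by (simp add: grid_def i_def)
  have "indicator {real j * T / n..<(real j + 1) * T / n} t = (if j = i then 1 else 0 :: real)" for j
  proof -
    have "t \<in> {real j * T / n..<(real j + 1) * T / n} \<longleftrightarrow> real j \<le> real n * t / T \<and> real n * t / T < real j + 1"
      using assms by (simp add: field_simps)
    also have "\<dots> \<longleftrightarrow> j = i" using i by auto
    finally show ?thesis by (simp add: indicator_def)
  qed
  thus ?thesis using \<open>i < n\<close> True by (simp add: g if_distrib[of "\<lambda>x. x * _"] cong: if_cong)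
next
  case False
  have "t \<notin> {real j * T / n..<(real j + 1) * T / n}" if "j < n" for j
  proof
    assume t: "t \<in> {real j * T / n..<(real j + 1) * T / n}"
    have "(real j + 1) * T / n \<le> real n * T / n"
      using that assms by (intro divide_right_mono mult_right_mono) auto
    hence "t < T" using t assms by auto
    moreover have "0 \<le> real j * T / n" using assms by auto
    ultimately show False using t False by auto
  qed
  thus ?thesis using False by (auto intro!: sum.neutral)
qed

text \<open>Convergence of the samples is asked almost everywhere only, because one application is
  to the kernel, which jumps at t = s. The sum is the integral of a step function, and dominated
  convergence applies.\<close>

lemma riemann_sum_tendsto:
  fixes F :: "real \<Rightarrow> real"
  assumes T: "0 < T" and [measurable]: "F \<in> borel_measurable borel" and C: "\<And>t. \<bar>F t\<bar> \<le> C"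
    and out: "\<And>t. t \<notin> {0..<T} \<Longrightarrow> F t = 0"
    and lim: "AE t in lborel. t \<in> {0..<T} \<longrightarrow> (\<lambda>n. F (grid T (Suc n) t)) \<longlonglongrightarrow> F t"
  shows "(\<lambda>n. \<Sum>j<Suc n. T / real (Suc n) * F (real j * T / real (Suc n))) \<longlonglongrightarrow> (LINT t|lborel. F t)"
proof -
  define f where "f n t = indicator {0..<T} t * F (grid T (Suc n) t)" for n t
  have "(\<Sum>j<Suc n. T / real (Suc n) * F (real j * T / real (Suc n))) = (LINT t|lborel. f n t)" for n
  proof -
    let ?I = "\<lambda>j. {real j * T / real (Suc n)..<(real j + 1) * T / real (Suc n)}"
    have le: "real j * T / real (Suc n) \<le> (real j + 1) * T / real (Suc n)" for j
      using T by (intro divide_right_mono mult_right_mono) auto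
    have "(LINT t|lborel. f n t) = (LINT t|lborel. (\<Sum>j<Suc n. indicator (?I j) t * F (real j * T / real (Suc n))))"
      unfolding f_def using T by (subst grid_sum[symmetric]) auto
    also have "\<dots> = (\<Sum>j<Suc n. LINT t|lborel. indicator (?I j) t * F (real j * T / real (Suc n)))"
      using le by (intro Bochner_Integration.integral_sum integrable_mult_left integrable_real_indicator) auto
    also have "\<dots> = (\<Sum>j<Suc n. T / real (Suc n) * F (real j * T / real (Suc n)))"
      using le by (intro sum.cong refl) (auto simp: field_simps simp del: of_nat_Suc)
    finally show ?thesis by simp
  qed
  moreover have "(\<lambda>n. LINT t|lborel. f n t) \<longlonglongrightarrow> (LINT t|lborel. F t)"
  proof (rule integral_dominated_convergence[where w="\<lambda>t. C * indicator {0..<T} t"])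
    show "(\<lambda>t. f n t) \<in> borel_measurable lborel" for n unfolding f_def grid_def by measurable
    show "AE t in lborel. (\<lambda>n. f n t) \<longlonglongrightarrow> F t"
      using lim
    proof eventually_elim
      case (elim t)
      thus ?case using out[of t] by (cases "t \<in> {0..<T}") (auto simp: f_def)
    qed
    show "AE t in lborel. norm (f n t) \<le> C * indicator {0..<T} t" for n
      using C by (auto simp: f_def indicator_def)
  qed (use T in auto)
  ultimately show ?thesis by simp
qed

section \<open>Regular paths of the bridge and the law of its linear functionals\<close>

locale wiener_bridge = wiener +
  fixes X :: "real \<Rightarrow> 'a \<Rightarrow> real" and \<alpha> T :: real and N :: "'a set"
  assumes T: "0 < T" and \<alpha>: "0 < \<alpha>"
    and X_int: "\<And>t. t \<in> {0..<T} \<Longrightarrow> has_wiener_integral M B (\<lambda>s. ((T - t) / (T - s)) powr \<alpha>) t (X t)"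
    and N: "N \<in> null_sets M"
    and X_cont: "\<And>\<omega>. \<omega> \<in> space M - N \<Longrightarrow> continuous_on {0..<T} (\<lambda>t. X t \<omega>)"
begin

definition kern :: "real \<Rightarrow> real \<Rightarrow> real" where
  "kern t s = (if 0 \<le> s \<and> s \<le> t \<and> t < T then ((T - t) / (T - s)) powr \<alpha> else 0)"

text \<open>The bridge set to 0 on the exceptional null set and outside [0,T). Every path is then
  continuous on [0,T), which gives joint measurability without exceptions.\<close>

definition Y :: "real \<Rightarrow> 'a \<Rightarrow> real" where
  "Y t \<omega> = (if t \<in> {0..<T} \<and> \<omega> \<in> space M - N then X t \<omega> else 0)"

lemma kern_measurable [measurable]: "(\<lambda>(t, s). kern t s) \<in> borel_measurable (borel \<Otimes>\<^sub>M borel)"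
  unfolding kern_def by measurable

lemma kern_le_1: "0 \<le> kern t s" "kern t s \<le> 1"
proof -
  show "kern t s \<le> 1"
  proof (cases "0 \<le> s \<and> s \<le> t \<and> t < T")
    case True
    hence "0 \<le> (T - t) / (T - s)" "(T - t) / (T - s) \<le> 1" by (auto simp: field_simps)
    hence "((T - t) / (T - s)) powr \<alpha> \<le> 1 powr \<alpha>" using \<alpha> by (intro powr_mono2) auto
    thus ?thesis by (simp add: kern_def)
  qed (auto simp: kern_def)
qed (simp add: kern_def)

lemma X_measurable: "t \<in> {0..<T} \<Longrightarrow> X t \<in> borel_measurable M"
  using X_int by (simp add: has_wiener_integral_def)

lemma Y_measurable [measurable]: "Y t \<in> borel_measurable M"
proof (cases "t \<in> {0..<T}")
  case True
  have [measurable]: "X t \<in> borel_measurable M" "N \<in> sets M" using X_measurable[OF True] N by auto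
  have "(\<lambda>\<omega>. indicator (space M - N) \<omega> * X t \<omega>) \<in> borel_measurable M" by measurable
  moreover have "Y t = (\<lambda>\<omega>. indicator (space M - N) \<omega> * X t \<omega>)" using True by (auto simp: Y_def)
  ultimately show ?thesis by simp
next
  case False
  hence "Y t = (\<lambda>_. 0)" by (auto simp: Y_def)
  thus ?thesis by simp
qed

lemma Y_out: "t \<notin> {0..<T} \<Longrightarrow> Y t \<omega> = 0"
  by (auto simp: Y_def)

lemma Y_cont: "continuous_on {0..<T} (\<lambda>t. Y t \<omega>)"
proof (cases "\<omega> \<in> space M - N")
  case True
  show ?thesis using X_cont[OF True] by (rule continuous_on_eq) (use True in \<open>auto simp: Y_def\<close>)
next
  case False
  hence "Y t \<omega> = 0" for t by (auto simp: Y_def)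
  thus ?thesis by (simp only: continuous_on_const)
qed

lemma Y_grid: "t \<in> {0..<T} \<Longrightarrow> (\<lambda>n. Y (grid T (Suc n) t) \<omega>) \<longlonglongrightarrow> Y t \<omega>"
proof -
  assume t: "t \<in> {0..<T}"
  have "continuous (at t within {0..<T}) (\<lambda>t. Y t \<omega>)"
    using Y_cont t by (simp add: continuous_on_eq_continuous_within)
  moreover have "grid T (Suc n) t \<in> {0..<T}" for n
    using grid_bounds[OF T _ t, of "Suc n"] t by auto
  ultimately show ?thesis using grid_tendsto[OF T t] by (rule continuous_within_tendsto_compose')
qed

text \<open>Pointwise limit of the step processes that freeze Y at grid points; these are measurable
  as finite sums of products.\<close>

lemma Y_joint [measurable]: "(\<lambda>(t, \<omega>). Y t \<omega>) \<in> borel_measurable ((borel :: real measure) \<Otimes>\<^sub>M M)"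
proof (rule borel_measurable_LIMSEQ_real)
  define u where "u n p = (\<Sum>j<Suc n. indicator {real j * T / real (Suc n)..<(real j + 1) * T / real (Suc n)} (fst p) * Y (real j * T / real (Suc n)) (snd p))"
    for n :: nat and p :: "real \<times> 'a"
  show "u n \<in> borel_measurable (borel \<Otimes>\<^sub>M M)" for n unfolding u_def by measurable
  fix p :: "real \<times> 'a" assume "p \<in> space (borel \<Otimes>\<^sub>M M)"
  obtain t \<omega> where p: "p = (t, \<omega>)" by (cases p)
  have "u n p = indicator {0..<T} t * Y (grid T (Suc n) t) \<omega>" for n
    unfolding u_def p fst_conv snd_conv using T by (intro grid_sum) auto
  thus "(\<lambda>n. u n p) \<longlonglongrightarrow> (case p of (t, \<omega>) \<Rightarrow> Y t \<omega>)"
    using Y_grid[of t \<omega>] Y_out[of t \<omega>] by (cases "t \<in> {0..<T}") (auto simp: p)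
qed

lemma Y_rep:
  assumes t: "t \<in> {0..<T}"
  shows "wiener_rep (Y t) (kern t)"
proof -
  have "wiener_rep (X t) (\<lambda>s. indicator {0..t} s * ((T - t) / (T - s)) powr \<alpha>)"
    by (rule wiener_rep_of_integral[OF X_int[OF t]])
  moreover have "(\<lambda>s. indicator {0..t} s * ((T - t) / (T - s)) powr \<alpha>) = kern t"
    using t by (auto simp: kern_def indicator_def)
  moreover have "AE \<omega> in M. X t \<omega> = Y t \<omega>"
    using AE_not_in[OF N] AE_space by eventually_elim (use t in \<open>auto simp: Y_def\<close>)
  ultimately show ?thesis by (auto intro: wiener_rep_cong_AE)
qed

definition Z :: "(real \<Rightarrow> real) \<Rightarrow> 'a \<Rightarrow> real" where
  "Z h \<omega> = (LINT t|lborel. h t * Y t \<omega>)"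

text \<open>Interchanging the two integrals, \<open>Z h\<close> has the law of the Wiener integral
  of \<open>G h\<close>; the lemmas \<open>Z_char_aux\<close> and \<open>Z_char\<close> establish
  this through characteristic functions.\<close>

definition G :: "(real \<Rightarrow> real) \<Rightarrow> real \<Rightarrow> real" where
  "G h s = (LINT t|lborel. h t * kern t s)"

lemma Z_measurable [measurable]:
  assumes [measurable]: "h \<in> borel_measurable borel"
  shows "Z h \<in> borel_measurable M"
  unfolding Z_def by measurable

lemma G_measurable [measurable]:
  assumes [measurable]: "h \<in> borel_measurable borel"
  shows "G h \<in> borel_measurable borel"
  unfolding G_def by measurable

lemma G_le:
  assumes [measurable]: "h \<in> borel_measurable borel" and C: "\<And>t. t \<in> {0..<T} \<Longrightarrow> \<bar>h t\<bar> \<le> C"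
  shows "integrable lborel (\<lambda>t. h t * kern t s)" "\<bar>G h s\<bar> \<le> C * T * indicator {0..T} s"
proof -
  have bd: "norm (h t * kern t s) \<le> C * indicator {0..<T} t" for t
    using C[of t] kern_le_1[of t s] mult_mono[of "\<bar>h t\<bar>" C "kern t s" 1]
    by (cases "t \<in> {0..<T}") (auto simp: abs_mult kern_def)
  have ii: "integrable lborel (\<lambda>t. C * indicator {0..<T} t)" using T by simp
  show i: "integrable lborel (\<lambda>t. h t * kern t s)"
    by (rule Bochner_Integration.integrable_bound[OF ii]) (use bd in \<open>auto intro!: AE_I2 order_trans[OF _ abs_ge_self]\<close>)
  show "\<bar>G h s\<bar> \<le> C * T * indicator {0..T} s"
  proof (cases "s \<in> {0..T}")
    case True
    have "\<bar>G h s\<bar> \<le> (LINT t|lborel. \<bar>h t * kern t s\<bar>)" unfolding G_def by (rule integral_abs_bound)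
    also have "\<dots> \<le> (LINT t|lborel. C * indicator {0..<T} t)"
      using i ii bd by (intro integral_mono) auto
    finally show ?thesis using True T by simp
  next
    case False
    hence "kern t s = 0" for t by (auto simp: kern_def)
    thus ?thesis using False by (simp add: G_def)
  qed
qed

text \<open>Cutting at b < T makes the integrand bounded along each path. The Riemann sums of
  \<open>Z\<close> are finite combinations of values of Y and hence represented by the corresponding
  sums of kernels; both characteristic functions and variances pass to the limit.\<close>

lemma Z_char_aux:
  assumes h[measurable]: "h \<in> borel_measurable borel" and hc: "continuous_on {0..T} h"
    and b: "0 \<le> b" "b < T"
  defines "hb \<equiv> \<lambda>t. indicator {..b} t * h t"
  shows "(CLINT \<omega>|M. iexp (Z hb \<omega>)) = of_real (exp (- (LINT s|lborel. (G hb s)\<^sup>2) / 2))"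
proof -
  have hbm[measurable]: "hb \<in> borel_measurable borel" unfolding hb_def by measurable
  have "bounded (h ` {0..T})" by (intro compact_imp_bounded compact_continuous_image hc) auto
  then obtain C where "\<forall>t\<in>{0..T}. \<bar>h t\<bar> \<le> C" by (auto simp: bounded_iff)
  hence C: "\<bar>h t\<bar> \<le> C" if "t \<in> {0..T}" for t using that by blast
  have hbC: "\<bar>hb t\<bar> \<le> C" if "t \<in> {0..<T}" for t
    using C[of t] that by (auto simp: hb_def indicator_def)
  have C0: "C \<ge> 0" using C[of 0] T by auto
  \<comment> \<open>The cut function jumps at b, but the grid approaches from the left, so the
    samples converge there too.\<close>
  have hgrid: "(\<lambda>n. hb (grid T (Suc n) t)) \<longlonglongrightarrow> hb t" if t: "t \<in> {0..<T}" for t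
  proof (cases "t \<le> b")
    case True
    have gi: "grid T (Suc n) t \<in> {0..T}" "grid T (Suc n) t \<le> b" for n
      using grid_bounds[OF T _ t, of "Suc n"] t True by auto
    have "continuous (at t within {0..T}) h" using hc t by (simp add: continuous_on_eq_continuous_within)
    hence "(\<lambda>n. h (grid T (Suc n) t)) \<longlonglongrightarrow> h t"
      by (rule continuous_within_tendsto_compose'[OF _ gi(1) grid_tendsto[OF T t]])
    thus ?thesis using gi(2) True by (simp add: hb_def)
  next
    case False
    hence "\<forall>\<^sub>F n in sequentially. b < grid T (Suc n) t"
      by (intro order_tendstoD[OF grid_tendsto[OF T t]]) auto
    hence "\<forall>\<^sub>F n in sequentially. hb (grid T (Suc n) t) = hb t"
      by eventually_elim (use False in \<open>auto simp: hb_def\<close>)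
    thus ?thesis by (rule tendsto_eventually)
  qed
  define w where "w n j = T / real (Suc n) * hb (real j * T / real (Suc n))" for n j
  define R where "R n \<omega> = (\<Sum>j<Suc n. w n j * Y (real j * T / real (Suc n)) \<omega>)" for n \<omega>
  define r where "r n s = (\<Sum>j<Suc n. w n j * kern (real j * T / real (Suc n)) s)" for n s
  have tj: "real j * T / real (Suc n) \<in> {0..<T}" if "j < Suc n" for j n
  proof -
    have "real j * T < real (Suc n) * T" using that T by (intro mult_strict_right_mono) auto
    thus ?thesis using T by (simp add: pos_divide_less_eq mult.commute)
  qed
  have rep: "wiener_rep (R n) (r n)" for n
    unfolding R_def r_def by (intro wiener_rep_sum Y_rep tj)
  have Rlim: "(\<lambda>n. R n \<omega>) \<longlonglongrightarrow> Z hb \<omega>" for \<omega>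
  proof -
    have "continuous_on {0..b} (\<lambda>t. h t * Y t \<omega>)"
      using b by (intro continuous_intros continuous_on_subset[OF hc] continuous_on_subset[OF Y_cont]) auto
    hence "bounded ((\<lambda>t. h t * Y t \<omega>) ` {0..b})" by (intro compact_imp_bounded compact_continuous_image) auto
    then obtain D where "\<forall>t\<in>{0..b}. \<bar>h t * Y t \<omega>\<bar> \<le> D" by (auto simp: bounded_iff)
    hence D: "\<bar>h t * Y t \<omega>\<bar> \<le> D" if "t \<in> {0..b}" for t using that by blast
    have D0: "D \<ge> 0" using D[of 0] b by auto
    have "(\<lambda>n. \<Sum>j<Suc n. T / real (Suc n) * (hb (real j * T / real (Suc n)) * Y (real j * T / real (Suc n)) \<omega>))
       \<longlonglongrightarrow> (LINT t|lborel. hb t * Y t \<omega>)"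
    proof (rule riemann_sum_tendsto[OF T, where F="\<lambda>t. hb t * Y t \<omega>" and C=D])
      have "(\<lambda>t. Y t \<omega>) \<in> borel_measurable borel"
      proof (cases "\<omega> \<in> space M")
        case True
        thus ?thesis using measurable_compose[OF measurable_Pair2' Y_joint] by simp
      next
        case False
        hence "Y t \<omega> = 0" for t by (auto simp: Y_def)
        thus ?thesis by (simp only: borel_measurable_const)
      qed
      thus "(\<lambda>t. hb t * Y t \<omega>) \<in> borel_measurable borel" by measurable
      show "\<bar>hb t * Y t \<omega>\<bar> \<le> D" for t
        using D[of t] D0 Y_out[of t \<omega>] by (cases "t \<in> {0..b}") (auto simp: hb_def indicator_def)
      show "AE t in lborel. t \<in> {0..<T} \<longrightarrow> (\<lambda>n. hb (grid T (Suc n) t) * Y (grid T (Suc n) t) \<omega>) \<longlonglongrightarrow> hb t * Y t \<omega>"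
        by (intro AE_I2 impI tendsto_mult hgrid Y_grid)
    qed (auto simp: Y_out)
    thus ?thesis by (simp add: R_def w_def Z_def mult.assoc)
  qed
  have rlim: "(\<lambda>n. r n s) \<longlonglongrightarrow> G hb s" for s
  proof -
    have "(\<lambda>n. \<Sum>j<Suc n. T / real (Suc n) * (hb (real j * T / real (Suc n)) * kern (real j * T / real (Suc n)) s))
       \<longlonglongrightarrow> (LINT t|lborel. hb t * kern t s)"
    proof (rule riemann_sum_tendsto[OF T, where F="\<lambda>t. hb t * kern t s" and C=C])
      show "\<bar>hb t * kern t s\<bar> \<le> C" for t
        using hbC[of t] C0 kern_le_1[of t s] mult_mono[of "\<bar>hb t\<bar>" C "kern t s" 1]
        by (cases "t \<in> {0..<T}") (auto simp: abs_mult kern_def)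
      show "AE t in lborel. t \<in> {0..<T} \<longrightarrow> (\<lambda>n. hb (grid T (Suc n) t) * kern (grid T (Suc n) t) s) \<longlonglongrightarrow> hb t * kern t s"
        using AE_lborel_singleton[of s]
      proof eventually_elim
        case (elim t)
        show ?case
        proof (intro impI tendsto_mult hgrid)
          assume t: "t \<in> {0..<T}"
          note gb = grid_bounds[OF T _ t, of "Suc n" for n]
          show "(\<lambda>n. kern (grid T (Suc n) t) s) \<longlonglongrightarrow> kern t s"
          proof (cases "0 \<le> s \<and> s < t")
            case True
            have "\<forall>\<^sub>F n in sequentially. s < grid T (Suc n) t"
              using True by (intro order_tendstoD[OF grid_tendsto[OF T t]]) auto
            hence "\<forall>\<^sub>F n in sequentially. ((T - grid T (Suc n) t) / (T - s)) powr \<alpha> = kern (grid T (Suc n) t) s"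
            proof eventually_elim
              case (elim n)
              thus ?case using True gb(2)[of n] t by (auto simp: kern_def)
            qed
            moreover have "(\<lambda>n. ((T - grid T (Suc n) t) / (T - s)) powr \<alpha>) \<longlonglongrightarrow> ((T - t) / (T - s)) powr \<alpha>"
              using True t by (intro tendsto_intros grid_tendsto[OF T t]) auto
            moreover have "((T - t) / (T - s)) powr \<alpha> = kern t s" using True t by (simp add: kern_def)
            ultimately show ?thesis by (simp add: filterlim_cong)
          next
            case False
            hence "kern t s = 0" "kern (grid T (Suc n) t) s = 0" for n
              using elim gb(2)[of n] by (auto simp: kern_def)
            thus ?thesis by simp
          qed
        qed auto
      qed
    qed (auto simp: kern_def)
    thus ?thesis by (simp add: r_def w_def G_def mult.assoc)
  qed
  have rb: "\<bar>r n s\<bar> \<le> C * T * indicator {0..T} s" for n s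
  proof (cases "s \<in> {0..T}")
    case True
    have "\<bar>r n s\<bar> \<le> (\<Sum>j<Suc n. \<bar>w n j * kern (real j * T / real (Suc n)) s\<bar>)" unfolding r_def by (rule sum_abs)
    also have "\<dots> \<le> (\<Sum>j<Suc n. T / real (Suc n) * C)"
    proof (intro sum_mono)
      fix j assume "j \<in> {..<Suc n}"
      hence "\<bar>w n j\<bar> \<le> T / real (Suc n) * C"
        using hbC[OF tj[of j n]] T unfolding w_def abs_mult by (intro mult_mono) auto
      hence "\<bar>w n j\<bar> * kern (real j * T / real (Suc n)) s \<le> T / real (Suc n) * C * 1"
        using kern_le_1 C0 T by (intro mult_mono) auto
      thus "\<bar>w n j * kern (real j * T / real (Suc n)) s\<bar> \<le> T / real (Suc n) * C"
        using kern_le_1 by (simp add: abs_mult)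
    qed
    also have "\<dots> = C * T" by (simp add: field_simps del: of_nat_Suc)
    finally show ?thesis using True by simp
  next
    case False
    hence "kern t s = 0" for t by (auto simp: kern_def)
    thus ?thesis using False by (simp add: r_def)
  qed
  have [measurable]: "R n \<in> borel_measurable M" "r n \<in> borel_measurable borel" for n
    using wiener_rep_measurable[OF rep] by auto
  have "(\<lambda>n. CLINT \<omega>|M. iexp (R n \<omega>)) \<longlonglongrightarrow> (CLINT \<omega>|M. iexp (Z hb \<omega>))"
  proof (rule integral_dominated_convergence[where w="\<lambda>_. 1"])
    show "AE \<omega> in M. (\<lambda>n. iexp (R n \<omega>)) \<longlonglongrightarrow> iexp (Z hb \<omega>)"
      by (intro AE_I2 tendsto_intros Rlim)
  qed auto
  moreover have "(\<lambda>n. CLINT \<omega>|M. iexp (R n \<omega>)) \<longlonglongrightarrow> of_real (exp (- (LINT s|lborel. (G hb s)\<^sup>2) / 2))"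
  proof -
    have "(\<lambda>n. LINT s|lborel. (r n s)\<^sup>2) \<longlonglongrightarrow> (LINT s|lborel. (G hb s)\<^sup>2)"
    proof (rule integral_dominated_convergence[where w="\<lambda>s. (C * T)\<^sup>2 * indicator {0..T} s"])
      show "AE s in lborel. (\<lambda>n. (r n s)\<^sup>2) \<longlonglongrightarrow> (G hb s)\<^sup>2" by (intro AE_I2 tendsto_intros rlim)
      show "AE s in lborel. norm ((r n s)\<^sup>2) \<le> (C * T)\<^sup>2 * indicator {0..T} s" for n
      proof (intro AE_I2)
        fix s
        have "(r n s)\<^sup>2 \<le> (C * T * indicator {0..T} s)\<^sup>2" using rb[of n s] by (rule abs_le_square_iff[THEN iffD1, OF order_trans]) simp
        thus "norm ((r n s)\<^sup>2) \<le> (C * T)\<^sup>2 * indicator {0..T} s" by (auto simp: indicator_def)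
      qed
    qed (use T in auto)
    thus ?thesis unfolding wiener_rep_char(2)[OF rep]
      by (intro tendsto_intros) auto
  qed
  ultimately show ?thesis by (rule LIMSEQ_unique)
qed

text \<open>Here b increases to T. Paths may be unbounded near T as far as is known, so the pathwise
  limit is dominated by the integrable function |h Y|.\<close>

lemma Z_char:
  assumes h[measurable]: "h \<in> borel_measurable borel" and hc: "continuous_on {0..T} h"
    and sq: "AE \<omega> in M. integrable lborel (\<lambda>t. h t * Y t \<omega>)"
  shows "(CLINT \<omega>|M. iexp (Z h \<omega>)) = of_real (exp (- (LINT s|lborel. (G h s)\<^sup>2) / 2))"
proof -
  have "bounded (h ` {0..T})" by (intro compact_imp_bounded compact_continuous_image hc) auto
  then obtain C where "\<forall>t\<in>{0..T}. \<bar>h t\<bar> \<le> C" by (auto simp: bounded_iff)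
  hence C: "\<bar>h t\<bar> \<le> C" if "t \<in> {0..T}" for t using that by blast
  define b where "b m = T * (real m / real (Suc m))" for m
  have b: "0 \<le> b m" "b m < T" for m
  proof -
    show "0 \<le> b m" using T by (simp add: b_def)
    have "real m / real (Suc m) < 1" by simp
    thus "b m < T" using T mult_strict_left_mono[of "real m / real (Suc m)" 1 T] by (simp add: b_def)
  qed
  have blim: "b \<longlonglongrightarrow> T" unfolding b_def by real_asymp
  define hb where "hb m t = indicator {..b m} t * h t" for m t
  have hbm[measurable]: "hb m \<in> borel_measurable borel" for m unfolding hb_def by measurable
  have hlim: "(\<lambda>m. hb m t) \<longlonglongrightarrow> h t" if "t < T" for t
  proof -
    have "\<forall>\<^sub>F m in sequentially. t < b m" using that by (intro order_tendstoD[OF blim])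
    hence "\<forall>\<^sub>F m in sequentially. hb m t = h t" by eventually_elim (auto simp: hb_def)
    thus ?thesis by (rule tendsto_eventually)
  qed
  have hble: "\<bar>hb m t\<bar> \<le> \<bar>h t\<bar>" for m t by (auto simp: hb_def indicator_def)
  have hbC: "\<bar>hb m t\<bar> \<le> C" if "t \<in> {0..<T}" for m t
    using hble[of m t] C[of t] that by auto
  have "AE \<omega> in M. (\<lambda>m. Z (hb m) \<omega>) \<longlonglongrightarrow> Z h \<omega>"
    using sq AE_space
  proof eventually_elim
    case (elim \<omega>)
    have Ym: "(\<lambda>t. Y t \<omega>) \<in> borel_measurable borel"
      using measurable_compose[OF measurable_Pair2' Y_joint] elim by simp
    show ?case unfolding Z_def
    proof (rule integral_dominated_convergence[where w="\<lambda>t. \<bar>h t * Y t \<omega>\<bar>"])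
      show "AE t in lborel. (\<lambda>m. hb m t * Y t \<omega>) \<longlonglongrightarrow> h t * Y t \<omega>"
      proof (intro AE_I2)
        fix t show "(\<lambda>m. hb m t * Y t \<omega>) \<longlonglongrightarrow> h t * Y t \<omega>"
          using hlim[of t] Y_out[of t \<omega>] by (cases "t < T") (auto intro!: tendsto_intros)
      qed
      show "AE t in lborel. norm (hb m t * Y t \<omega>) \<le> \<bar>h t * Y t \<omega>\<bar>" for m
        using hble[of m] by (auto simp: abs_mult intro!: mult_right_mono)
    qed (use elim Ym in auto)
  qed
  hence "(\<lambda>m. CLINT \<omega>|M. iexp (Z (hb m) \<omega>)) \<longlonglongrightarrow> (CLINT \<omega>|M. iexp (Z h \<omega>))"
    by (intro integral_dominated_convergence[where w="\<lambda>_. 1"])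
       (auto elim!: eventually_mono intro!: tendsto_intros)
  moreover have "(\<lambda>m. CLINT \<omega>|M. iexp (Z (hb m) \<omega>)) \<longlonglongrightarrow> of_real (exp (- (LINT s|lborel. (G h s)\<^sup>2) / 2))"
  proof -
    have Glim: "(\<lambda>m. G (hb m) s) \<longlonglongrightarrow> G h s" for s
      unfolding G_def
    proof (rule integral_dominated_convergence[where w="\<lambda>t. \<bar>h t * kern t s\<bar>"])
      show "AE t in lborel. (\<lambda>m. hb m t * kern t s) \<longlonglongrightarrow> h t * kern t s"
      proof (intro AE_I2)
        fix t show "(\<lambda>m. hb m t * kern t s) \<longlonglongrightarrow> h t * kern t s"
          using hlim[of t] by (cases "t < T") (auto intro!: tendsto_intros simp: kern_def)
      qed
      show "AE t in lborel. norm (hb m t * kern t s) \<le> \<bar>h t * kern t s\<bar>" for m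
        using hble[of m] by (auto simp: abs_mult intro!: mult_right_mono)
      show "integrable lborel (\<lambda>t. \<bar>h t * kern t s\<bar>)" using G_le(1)[OF h, of C] C by auto
    qed auto
    have "(\<lambda>m. LINT s|lborel. (G (hb m) s)\<^sup>2) \<longlonglongrightarrow> (LINT s|lborel. (G h s)\<^sup>2)"
    proof (rule integral_dominated_convergence[where w="\<lambda>s. (C * T)\<^sup>2 * indicator {0..T} s"])
      show "AE s in lborel. (\<lambda>m. (G (hb m) s)\<^sup>2) \<longlonglongrightarrow> (G h s)\<^sup>2" by (intro AE_I2 tendsto_intros Glim)
      show "AE s in lborel. norm ((G (hb m) s)\<^sup>2) \<le> (C * T)\<^sup>2 * indicator {0..T} s" for m
      proof (intro AE_I2)
        fix s
        have "\<bar>G (hb m) s\<bar> \<le> C * T * indicator {0..T} s" by (rule G_le(2)[OF hbm hbC])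
        hence "(G (hb m) s)\<^sup>2 \<le> (C * T * indicator {0..T} s)\<^sup>2" by (rule abs_le_square_iff[THEN iffD1, OF order_trans]) simp
        thus "norm ((G (hb m) s)\<^sup>2) \<le> (C * T)\<^sup>2 * indicator {0..T} s" by (auto simp: indicator_def)
      qed
    qed (use T in auto)
    thus ?thesis using Z_char_aux[OF h hc b] unfolding hb_def[abs_def]
      by (simp add: tendsto_intros)
  qed
  ultimately show ?thesis by (rule LIMSEQ_unique)
qed

end

section \<open>Expansion of the squared norm\<close>

context wiener_bridge
begin

text \<open>With values in \<open>ennreal\<close> the squared norm makes sense for every path; that
  it is finite almost surely follows from its mean.\<close>

definition Q :: "'a \<Rightarrow> ennreal" where
  "Q \<omega> = (\<integral>\<^sup>+t. ennreal ((Y t \<omega>)\<^sup>2) \<partial>lborel)"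

lemma Q_measurable [measurable]: "Q \<in> borel_measurable M"
  unfolding Q_def by measurable

lemma kern_sq_pos:
  assumes t: "0 < t" "t < T"
  shows "0 < (LINT s|lborel. (kern t s)\<^sup>2)"
proof -
  define c where "c = (((T - t) / T) powr \<alpha>)\<^sup>2"
  have c: "c > 0" using t by (simp add: c_def)
  have "0 < t * c" using t c by simp
  also have "t * c = (LINT s|lborel. c * indicator {0..t} s)" using t by simp
  also have "\<dots> \<le> (LINT s|lborel. (kern t s)\<^sup>2)"
  proof (rule integral_mono)
    show "integrable lborel (\<lambda>s. c * indicator {0..t} s)" using t by simp
    show "integrable lborel (\<lambda>s. (kern t s)\<^sup>2)" using wiener_rep_char(1)[OF Y_rep, of t] t by simp
    fix s
    show "c * indicator {0..t} s \<le> (kern t s)\<^sup>2"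
    proof (cases "s \<in> {0..t}")
      case True
      hence "(T - t) / T \<le> (T - t) / (T - s)" using t by (intro divide_left_mono) auto
      hence "((T - t) / T) powr \<alpha> \<le> ((T - t) / (T - s)) powr \<alpha>" using t \<alpha> by (intro powr_mono2) auto
      hence "((T - t) / T) powr \<alpha> \<le> kern t s" using True t by (simp add: kern_def)
      thus ?thesis using True unfolding c_def by (auto intro!: power_mono)
    qed simp
  qed
  finally show ?thesis .
qed

lemma Y_second_moment:
  assumes t: "0 < t" "t < T"
  shows "(\<integral>\<^sup>+\<omega>. ennreal ((Y t \<omega>)\<^sup>2) \<partial>M) = (\<integral>\<^sup>+s. ennreal ((kern t s)\<^sup>2) \<partial>lborel)"
proof -
  have rep: "wiener_rep (Y t) (kern t)" using t by (intro Y_rep) auto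
  have "(\<integral>\<^sup>+\<omega>. ennreal ((Y t \<omega>)\<^sup>2) \<partial>M) = ennreal (LINT s|lborel. (kern t s)\<^sup>2)"
  proof (rule gaussian_second_moment[OF _ kern_sq_pos[OF t]])
    show "(CLINT \<omega>|M. iexp (a * Y t \<omega>)) = of_real (exp (- (a\<^sup>2 * (LINT s|lborel. (kern t s)\<^sup>2)) / 2))" for a
      using wiener_rep_char(2)[OF wiener_rep_scale[OF rep, of a]] by (simp add: power_mult_distrib)
  qed simp
  also have "\<dots> = (\<integral>\<^sup>+s. ennreal ((kern t s)\<^sup>2) \<partial>lborel)"
    using wiener_rep_char(1)[OF rep] by (intro nn_integral_eq_integral[symmetric]) auto
  finally show ?thesis .
qed

text \<open>The variance integral is taken in t first, with s fixed. Integrating in s first would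
  lead to the powers (T - s)^(-2\<alpha>) and a logarithm at \<alpha> = 1/2; in this order one
  primitive serves all \<alpha> > 0.\<close>

lemma kern_sq_integral:
  assumes s: "0 \<le> s" "s < T"
  shows "(\<integral>\<^sup>+t. ennreal ((kern t s)\<^sup>2) \<partial>lborel) = ennreal ((T - s) / (2 * \<alpha> + 1))"
proof -
  define f where "f t = ((T - t) / (T - s)) powr (2 * \<alpha>)" for t
  define F where "F t = - ((T - t) powr (2 * \<alpha> + 1)) / ((2 * \<alpha> + 1) * (T - s) powr (2 * \<alpha>))" for t
  have "(f has_integral F T - F s) {s..T}"
  proof (rule fundamental_theorem_of_calculus_interior)
    show "continuous_on {s..T} F" unfolding F_def using \<alpha> s
      by (intro continuous_intros continuous_on_powr') auto
    fix t assume t: "t \<in> {s<..<T}"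
    have "((\<lambda>t. (T - t) powr (2 * \<alpha> + 1)) has_real_derivative (2 * \<alpha> + 1) * (T - t) powr (2 * \<alpha>) * (- 1)) (at t)"
      using t by (auto intro!: derivative_eq_intros simp: powr_diff)
    hence "(F has_real_derivative - ((2 * \<alpha> + 1) * (T - t) powr (2 * \<alpha>) * (- 1)) / ((2 * \<alpha> + 1) * (T - s) powr (2 * \<alpha>))) (at t)"
      unfolding F_def by (intro DERIV_cdivide DERIV_minus)
    moreover have "- ((2 * \<alpha> + 1) * (T - t) powr (2 * \<alpha>) * (- 1)) / ((2 * \<alpha> + 1) * (T - s) powr (2 * \<alpha>)) = f t"
      using \<alpha> s t by (simp add: f_def powr_divide)
    ultimately show "(F has_vector_derivative f t) (at t)"
      by (simp add: has_real_derivative_iff_has_vector_derivative)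
  qed (use s in simp)
  hence "(\<integral>\<^sup>+t. ennreal (indicator {s..T} t * f t) \<partial>lborel) = ennreal (F T - F s)"
    by (rule nn_integral_has_integral_lebesgue[rotated]) (simp add: f_def)
  moreover have "(kern t s)\<^sup>2 = indicator {s..T} t * f t" for t
  proof (cases "s \<le> t \<and> t < T")
    case True
    thus ?thesis using s by (simp add: kern_def f_def power2_eq_square flip: powr_add)
  next
    case False
    thus ?thesis by (cases "t = T") (auto simp: kern_def f_def)
  qed
  moreover have "F T - F s = (T - s) / (2 * \<alpha> + 1)"
    using s \<alpha> by (simp add: F_def powr_add)
  ultimately show ?thesis by simp
qed

lemma Q_mean: "(\<integral>\<^sup>+\<omega>. Q \<omega> \<partial>M) = ennreal (T\<^sup>2 / (2 * (2 * \<alpha> + 1)))"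
proof -
  interpret LM: pair_sigma_finite lborel M ..
  have "(\<integral>\<^sup>+\<omega>. Q \<omega> \<partial>M) = (\<integral>\<^sup>+t. (\<integral>\<^sup>+\<omega>. ennreal ((Y t \<omega>)\<^sup>2) \<partial>M) \<partial>lborel)"
    unfolding Q_def by (rule LM.Fubini') measurable
  also have "\<dots> = (\<integral>\<^sup>+t. (\<integral>\<^sup>+s. ennreal ((kern t s)\<^sup>2) \<partial>lborel) \<partial>lborel)"
  proof (rule nn_integral_cong_AE)
    show "AE t in lborel. (\<integral>\<^sup>+\<omega>. ennreal ((Y t \<omega>)\<^sup>2) \<partial>M) = (\<integral>\<^sup>+s. ennreal ((kern t s)\<^sup>2) \<partial>lborel)"
      \<comment> \<open>At t = 0 the variance is 0, while the second moment lemma requires it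
        positive.\<close>
      using AE_lborel_singleton[of 0]
    proof eventually_elim
      case (elim t)
      show ?case
      proof (cases "0 < t \<and> t < T")
        case False
        hence "t \<notin> {0..<T}" using elim by auto
        hence "Y t \<omega> = 0" "kern t s = 0" for \<omega> s by (auto simp: Y_def kern_def)
        thus ?thesis by simp
      qed (use Y_second_moment in auto)
    qed
  qed
  also have "\<dots> = (\<integral>\<^sup>+s. (\<integral>\<^sup>+t. ennreal ((kern t s)\<^sup>2) \<partial>lborel) \<partial>lborel)"
    by (rule lborel_pair.Fubini'[symmetric]) measurable
  also have "\<dots> = (\<integral>\<^sup>+s. ennreal (indicator {0..T} s * ((T - s) / (2 * \<alpha> + 1))) \<partial>lborel)"
  proof (rule nn_integral_cong)
    fix s
    show "(\<integral>\<^sup>+t. ennreal ((kern t s)\<^sup>2) \<partial>lborel) = ennreal (indicator {0..T} s * ((T - s) / (2 * \<alpha> + 1)))"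
    proof (cases "0 \<le> s \<and> s < T")
      case True thus ?thesis using kern_sq_integral[of s] by simp
    next
      case False
      hence "kern t s = 0" for t by (auto simp: kern_def)
      moreover have z: "indicator {0..T} s * ((T - s) / (2 * \<alpha> + 1)) = 0" using False by (cases "s = T") auto
      ultimately show ?thesis unfolding z by simp
    qed
  qed
  also have "\<dots> = ennreal (T\<^sup>2 / (2 * (2 * \<alpha> + 1)))"
  proof (rule nn_integral_has_integral_lebesgue)
    have "((\<lambda>s. (T - s) / (2 * \<alpha> + 1)) has_integral
        (- (T - T)\<^sup>2 / (2 * (2 * \<alpha> + 1))) - (- (T - 0)\<^sup>2 / (2 * (2 * \<alpha> + 1)))) {0..T}"
    proof (rule fundamental_theorem_of_calculus)
      fix s
      have "((\<lambda>s. - (T - s)\<^sup>2 / (2 * (2 * \<alpha> + 1))) has_real_derivative - (2 * (T - s) * (- 1)) / (2 * (2 * \<alpha> + 1))) (at s within {0..T})"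
        by (intro DERIV_cdivide DERIV_minus) (auto intro!: derivative_eq_intros)
      moreover have "- (2 * (T - s) * (- 1)) / (2 * (2 * \<alpha> + 1)) = (T - s) / (2 * \<alpha> + 1)"
        by (metis mult_divide_mult_cancel_left_if mult.commute mult_minus1_right minus_minus mult_minus_left zero_neq_numeral)
      ultimately show "((\<lambda>s. - (T - s)\<^sup>2 / (2 * (2 * \<alpha> + 1))) has_vector_derivative (T - s) / (2 * \<alpha> + 1)) (at s within {0..T})"
        by (simp add: has_real_derivative_iff_has_vector_derivative)
    qed (use T in simp)
    thus "((\<lambda>s. (T - s) / (2 * \<alpha> + 1)) has_integral T\<^sup>2 / (2 * (2 * \<alpha> + 1))) {0..T}" by simp
  qed (use \<alpha> in auto)
  finally show ?thesis .
qed

lemma Y_path_measurable: "\<omega> \<in> space M \<Longrightarrow> (\<lambda>t. Y t \<omega>) \<in> borel_measurable borel"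
  using measurable_compose[OF measurable_Pair2' Y_joint] by simp

lemma Q_finite: "AE \<omega> in M. integrable lborel (\<lambda>t. (Y t \<omega>)\<^sup>2)"
proof -
  have "AE \<omega> in M. Q \<omega> \<noteq> \<infinity>" by (rule nn_integral_noteq_infinite) (simp_all add: Q_mean)
  thus ?thesis using AE_space
  proof eventually_elim
    case (elim \<omega>)
    have [measurable]: "(\<lambda>t. Y t \<omega>) \<in> borel_measurable borel" by (rule Y_path_measurable[OF elim(2)])
    show ?case using elim(1) unfolding Q_def by (intro integrableI_bounded) (auto simp: less_top)
  qed
qed

lemma Y_mult_integrable:
  assumes h[measurable]: "h \<in> borel_measurable borel" and hc: "continuous_on {0..T} h"
    and \<omega>: "\<omega> \<in> space M" "integrable lborel (\<lambda>t. (Y t \<omega>)\<^sup>2)"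
  shows "integrable lborel (\<lambda>t. h t * Y t \<omega>)"
proof -
  have [measurable]: "(\<lambda>t. Y t \<omega>) \<in> borel_measurable borel" by (rule Y_path_measurable[OF \<omega>(1)])
  have "bounded (h ` {0..T})" by (intro compact_imp_bounded compact_continuous_image hc) auto
  then obtain C where "\<forall>t\<in>{0..T}. \<bar>h t\<bar> \<le> C" by (auto simp: bounded_iff)
  hence C: "\<bar>h t\<bar> \<le> C" if "t \<in> {0..T}" for t using that by blast
  have C0: "0 \<le> C" using C[of 0] T by auto
  have "integrable lborel (\<lambda>t. C * (indicator {0..T} t + (Y t \<omega>)\<^sup>2))" using \<omega>(2) T by simp
  thus ?thesis
  proof (rule Bochner_Integration.integrable_bound)
    show "AE t in lborel. norm (h t * Y t \<omega>) \<le> norm (C * (indicator {0..T} t + (Y t \<omega>)\<^sup>2))"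
    proof (intro AE_I2)
      fix t
      show "norm (h t * Y t \<omega>) \<le> norm (C * (indicator {0..T} t + (Y t \<omega>)\<^sup>2))"
      proof (cases "t \<in> {0..<T}")
        case True
        have "\<bar>Y t \<omega>\<bar> \<le> 1 + (Y t \<omega>)\<^sup>2"
        proof (cases "\<bar>Y t \<omega>\<bar> \<le> 1")
          case False
          hence "\<bar>Y t \<omega>\<bar> * 1 \<le> \<bar>Y t \<omega>\<bar> * \<bar>Y t \<omega>\<bar>" by (intro mult_left_mono) auto
          thus ?thesis by (simp add: power2_eq_square)
        qed (simp add: add_increasing2)
        hence "\<bar>h t\<bar> * \<bar>Y t \<omega>\<bar> \<le> C * (1 + (Y t \<omega>)\<^sup>2)" using C[of t] True C0 by (intro mult_mono) auto
        thus ?thesis using True C0 by (simp add: abs_mult)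
      qed (simp add: Y_out)
    qed
  qed measurable
qed

end

text \<open>With $\eta$ standard normal, $e^{-s\zeta^2}$ is the mean of $e^{i\sqrt{2s}\,\eta\zeta}$. Replacing the factors one
  at a time reduces the claim to the joint characteristic function, without a product measure.\<close>

lemma (in prob_space) gaussian_laplace:
  fixes \<zeta> :: "nat \<Rightarrow> 'a \<Rightarrow> real"
  assumes m[measurable]: "\<And>k. \<zeta> k \<in> borel_measurable M" and lam: "\<And>k. 0 \<le> lam k"
    and ch: "\<And>a. (CLINT \<omega>|M. iexp (\<Sum>k<n. a k * \<zeta> k \<omega>)) = of_real (exp (- (\<Sum>k<n. (a k)\<^sup>2 * lam k) / 2))"
    and s: "0 \<le> s"
  shows "(LINT \<omega>|M. exp (- s * (\<Sum>k<n. (\<zeta> k \<omega>)\<^sup>2))) = (\<Prod>k<n. 1 / sqrt (1 + 2 * s * lam k))"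
proof -
  let ?N = std_normal_distribution
  interpret S: real_distribution ?N by (rule real_dist_normal_dist)
  interpret NM: pair_prob_space ?N M ..
  have gauss: "(CLINT x|?N. iexp (t * x)) = of_real (exp (- (t\<^sup>2) / 2))" for t
    using char_std_normal_distribution by (simp add: char_def fun_eq_iff)
  have gauss_sq: "(LINT x|?N. exp (- (c * x\<^sup>2) / 2)) = 1 / sqrt (1 + c)" if c: "0 \<le> c" for c
  proof -
    have "(LINT x|?N. exp (- (c * x\<^sup>2) / 2)) = (LINT x|lborel. std_normal_density x * exp (- (c * x\<^sup>2) / 2))"
      by (subst integral_density) (auto simp: normal_density_nonneg)
    also have "\<dots> = (LINT x|lborel. 1 / sqrt (1 + c) * normal_density 0 (1 / sqrt (1 + c)) x)"
    proof (intro Bochner_Integration.integral_cong refl)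
      fix x :: real
      have e: "- x\<^sup>2 / 2 + - (c * x\<^sup>2) / 2 = - (x - 0)\<^sup>2 / (2 * (1 / sqrt (1 + c))\<^sup>2)"
        using c by (simp add: power_divide field_simps)
      have "std_normal_density x * exp (- (c * x\<^sup>2) / 2) = 1 / sqrt (2 * pi) * (exp (- x\<^sup>2 / 2) * exp (- (c * x\<^sup>2) / 2))"
        by (simp add: std_normal_density_def)
      also have "exp (- x\<^sup>2 / 2) * exp (- (c * x\<^sup>2) / 2) = exp (- (x - 0)\<^sup>2 / (2 * (1 / sqrt (1 + c))\<^sup>2))"
        unfolding exp_add[symmetric] e ..
      also have "1 / sqrt (2 * pi) = 1 / sqrt (1 + c) * (1 / sqrt (2 * pi * (1 / sqrt (1 + c))\<^sup>2))"
        using c by (simp add: power_divide real_sqrt_divide)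
      finally show "std_normal_density x * exp (- (c * x\<^sup>2) / 2) = 1 / sqrt (1 + c) * normal_density 0 (1 / sqrt (1 + c)) x"
        by (simp add: normal_density_def)
    qed
    also have "\<dots> = 1 / sqrt (1 + c)" using c by simp
    finally show ?thesis .
  qed
  define E where "E j \<omega> = exp (- s * (\<Sum>k<j. (\<zeta> k \<omega>)\<^sup>2))" for j \<omega>
  have E1: "E j \<omega> \<le> 1" "0 < E j \<omega>" for j \<omega>
    using s by (auto simp: E_def intro!: mult_nonneg_nonneg sum_nonneg)
  have [measurable]: "E j \<in> borel_measurable M" for j unfolding E_def by measurable
  have "(CLINT \<omega>|M. of_real (E j \<omega>) * iexp (\<Sum>k\<in>{j..<n}. a k * \<zeta> k \<omega>))
     = of_real ((\<Prod>k<j. 1 / sqrt (1 + 2 * s * lam k)) * exp (- (\<Sum>k\<in>{j..<n}. (a k)\<^sup>2 * lam k) / 2))"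
    if "j \<le> n" for j a
    using that
  proof (induction j arbitrary: a)
    case 0
    show ?case using ch[of a] by (simp add: E_def atLeast0LessThan)
  next
    case (Suc j)
    define t where "t x = sqrt (2 * s) * x" for x :: real
    define P where "P = (\<Prod>k<j. 1 / sqrt (1 + 2 * s * lam k))"
    define R where "R \<omega> = (\<Sum>k\<in>{Suc j..<n}. a k * \<zeta> k \<omega>)" for \<omega>
    define r where "r = (\<Sum>k\<in>{Suc j..<n}. (a k)\<^sup>2 * lam k)"
    have [measurable]: "R \<in> borel_measurable M" unfolding R_def by measurable
    have split: "{j..<n} = insert j {Suc j..<n}" using Suc.prems by auto
    \<comment> \<open>The induction hypothesis holds for all coefficients, so the j-th may be
      replaced by sqrt (2 s) x; integrating x against the normal law then converts the factor of
      index j.\<close>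
    have IH: "(CLINT \<omega>|M. of_real (E j \<omega>) * iexp (t x * \<zeta> j \<omega> + R \<omega>)) = of_real (P * exp (- ((t x)\<^sup>2 * lam j + r) / 2))" for x
    proof -
      have "(\<Sum>k\<in>{j..<n}. (a(j := t x)) k * \<zeta> k \<omega>) = t x * \<zeta> j \<omega> + R \<omega>" for \<omega>
        unfolding split R_def by simp
      moreover have "(\<Sum>k\<in>{j..<n}. ((a(j := t x)) k)\<^sup>2 * lam k) = (t x)\<^sup>2 * lam j + r"
        unfolding split r_def by simp
      ultimately show ?thesis using Suc.IH[of "a(j := t x)"] Suc.prems by (simp add: P_def)
    qed
    define f where "f x \<omega> = complex_of_real (E j \<omega>) * iexp (t x * \<zeta> j \<omega> + R \<omega>)" for x \<omega>
    have fm: "case_prod f \<in> borel_measurable (?N \<Otimes>\<^sub>M M)" unfolding f_def t_def by measurable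
    have fi: "integrable (?N \<Otimes>\<^sub>M M) (case_prod f)"
      by (rule NM.P.integrable_const_bound[where B=1])
         (use fm E1 in \<open>auto simp: f_def norm_mult intro!: AE_I2 less_imp_le[THEN abs_of_nonneg, THEN ord_eq_le_trans]\<close>)
    have "(CLINT x|?N. f x \<omega>) = of_real (E (Suc j) \<omega>) * iexp (R \<omega>)" for \<omega>
    proof -
      have "f x \<omega> = (of_real (E j \<omega>) * iexp (R \<omega>)) * iexp (sqrt (2 * s) * \<zeta> j \<omega> * x)" for x
        by (simp add: f_def t_def ring_distribs exp_add mult_ac)
      hence "(CLINT x|?N. f x \<omega>) = of_real (E j \<omega>) * iexp (R \<omega>) * of_real (exp (- ((sqrt (2 * s) * \<zeta> j \<omega>)\<^sup>2) / 2))"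
        by (simp only: integral_mult_right_zero gauss)
      also have "- ((sqrt (2 * s) * \<zeta> j \<omega>)\<^sup>2) / 2 = - s * (\<zeta> j \<omega>)\<^sup>2" using s by (simp add: power_mult_distrib)
      also have "of_real (E j \<omega>) * iexp (R \<omega>) * of_real (exp (- s * (\<zeta> j \<omega>)\<^sup>2)) = of_real (E j \<omega> * exp (- s * (\<zeta> j \<omega>)\<^sup>2)) * iexp (R \<omega>)"
        by (simp add: mult_ac)
      also have "E j \<omega> * exp (- s * (\<zeta> j \<omega>)\<^sup>2) = E (Suc j) \<omega>" by (simp add: E_def distrib_left flip: exp_add)
      finally show ?thesis .
    qed
    hence "(CLINT \<omega>|M. of_real (E (Suc j) \<omega>) * iexp (R \<omega>)) = (CLINT \<omega>|M. CLINT x|?N. f x \<omega>)" by simp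
    also have "\<dots> = (CLINT x|?N. CLINT \<omega>|M. f x \<omega>)" by (rule NM.Fubini_integral[OF fi])
    also have "\<dots> = (CLINT x|?N. of_real (P * exp (- r / 2) * exp (- (2 * s * lam j * x\<^sup>2) / 2)))"
    proof -
      have "P * exp (- ((t x)\<^sup>2 * lam j + r) / 2) = P * exp (- r / 2) * exp (- (2 * s * lam j * x\<^sup>2) / 2)" for x
      proof -
        have "(t x)\<^sup>2 = 2 * s * x\<^sup>2" using s by (simp add: t_def power_mult_distrib)
        hence "- ((t x)\<^sup>2 * lam j + r) / 2 = - r / 2 + - (2 * s * lam j * x\<^sup>2) / 2" by (simp add: field_simps)
        thus ?thesis by (simp only: exp_add mult.assoc)
      qed
      thus ?thesis unfolding f_def IH by (simp only:)
    qed
    also have "\<dots> = of_real (P * exp (- r / 2) * (1 / sqrt (1 + 2 * s * lam j)))"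
      unfolding integral_complex_of_real using gauss_sq[of "2 * s * lam j"] s lam[of j] by simp
    also have "P * exp (- r / 2) * (1 / sqrt (1 + 2 * s * lam j)) = (\<Prod>k<Suc j. 1 / sqrt (1 + 2 * s * lam k)) * exp (- r / 2)"
      by (simp add: P_def)
    finally show ?case unfolding R_def r_def .
  qed
  from this[of n "\<lambda>_. 0"] have "(CLINT \<omega>|M. of_real (E n \<omega>)) = of_real (\<Prod>k<n. 1 / sqrt (1 + 2 * s * lam k))"
    by simp
  thus ?thesis unfolding integral_complex_of_real E_def by (simp only: of_real_eq_iff)
qed

text \<open>What the expansion uses of the eigenfunctions, free of Bessel functions. The covariance
  of \<open>Z (h i)\<close> and \<open>Z (h j)\<close> is the inner product of
  \<open>G (h i)\<close> and \<open>G (h j)\<close>, so \<open>G_orth\<close> says that the h k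
  diagonalise the covariance form on their span, with eigenvalues \<open>lam k\<close>.\<close>

locale wiener_bridge_expansion = wiener_bridge +
  fixes h :: "nat \<Rightarrow> real \<Rightarrow> real" and lam :: "nat \<Rightarrow> real"
  assumes h_meas [measurable]: "\<And>k. h k \<in> borel_measurable borel"
    and h_cont: "\<And>k. continuous_on {0..T} (h k)"
    and h_orth: "\<And>i j. (LINT t|lborel. indicator {0..T} t * (h i t * h j t)) = (if i = j then 1 else 0)"
    and G_orth: "\<And>i j. (LINT s|lborel. G (h i) s * G (h j) s) = (if i = j then lam i else 0)"
    and lam_pos: "\<And>k. 0 < lam k"
    and trace: "summable lam" "T\<^sup>2 / (2 * (2 * \<alpha> + 1)) \<le> (\<Sum>k. lam k)"
begin

definition \<zeta> :: "nat \<Rightarrow> 'a \<Rightarrow> real" where "\<zeta> k = Z (h k)"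

lemma \<zeta>_measurable [measurable]: "\<zeta> k \<in> borel_measurable M"
  unfolding \<zeta>_def by measurable

lemma h_bounded: "\<exists>C. \<forall>t\<in>{0..T}. \<bar>h k t\<bar> \<le> C"
proof -
  have "bounded (h k ` {0..T})" by (intro compact_imp_bounded compact_continuous_image h_cont) auto
  thus ?thesis by (auto simp: bounded_iff)
qed

text \<open>A linear combination of coefficients is itself a functional \<open>Z H\<close>, so its
  law is known; orthogonality removes the mixed terms of the variance, which is the independence of
  the coefficients in terms of the joint characteristic function.\<close>

lemma \<zeta>_char: "(CLINT \<omega>|M. iexp (\<Sum>k<n. a k * \<zeta> k \<omega>)) = of_real (exp (- (\<Sum>k<n. (a k)\<^sup>2 * lam k) / 2))"
proof -
  define H where "H t = (\<Sum>k<n. a k * h k t)" for t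
  have Hm[measurable]: "H \<in> borel_measurable borel" unfolding H_def by measurable
  have Hc: "continuous_on {0..T} H" unfolding H_def by (intro continuous_intros h_cont)
  have good: "AE \<omega> in M. integrable lborel (\<lambda>t. H t * Y t \<omega>)"
    using Q_finite AE_space by eventually_elim (rule Y_mult_integrable[OF Hm Hc])
  have ZH: "AE \<omega> in M. (\<Sum>k<n. a k * \<zeta> k \<omega>) = Z H \<omega>"
    using Q_finite AE_space
  proof eventually_elim
    case (elim \<omega>)
    have "Z H \<omega> = (LINT t|lborel. (\<Sum>k<n. a k * (h k t * Y t \<omega>)))"
      unfolding Z_def H_def by (simp add: sum_distrib_right mult.assoc)
    also have "\<dots> = (\<Sum>k<n. LINT t|lborel. a k * (h k t * Y t \<omega>))"
      by (intro Bochner_Integration.integral_sum integrable_mult_right Y_mult_integrable h_meas h_cont elim)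
    finally show ?case by (simp add: \<zeta>_def Z_def)
  qed
  have GH: "G H s = (\<Sum>k<n. a k * G (h k) s)" for s
  proof -
    have "G H s = (LINT t|lborel. (\<Sum>k<n. a k * (h k t * kern t s)))"
      unfolding G_def H_def by (simp add: sum_distrib_right mult.assoc)
    also have "\<dots> = (\<Sum>k<n. LINT t|lborel. a k * (h k t * kern t s))"
    proof (intro Bochner_Integration.integral_sum integrable_mult_right)
      fix k
      obtain C where "\<forall>t\<in>{0..T}. \<bar>h k t\<bar> \<le> C" using h_bounded by blast
      thus "integrable lborel (\<lambda>t. h k t * kern t s)" by (intro G_le(1)[where C=C]) auto
    qed
    finally show ?thesis by (simp add: G_def)
  qed
  have Gi: "integrable lborel (\<lambda>s. G (h i) s * G (h j) s)" for i j
  proof -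
    obtain C D where C: "\<forall>t\<in>{0..T}. \<bar>h i t\<bar> \<le> C" and D: "\<forall>t\<in>{0..T}. \<bar>h j t\<bar> \<le> D" using h_bounded by metis
    have c: "\<bar>G (h i) s\<bar> \<le> C * T * indicator {0..T} s" "\<bar>G (h j) s\<bar> \<le> D * T * indicator {0..T} s" for s
      by (rule G_le(2); use C D in auto)+
    have "integrable lborel (\<lambda>s. (C * T * (D * T)) * indicator {0..T} s)" using T by simp
    thus ?thesis
    proof (rule Bochner_Integration.integrable_bound)
      show "AE s in lborel. norm (G (h i) s * G (h j) s) \<le> norm (C * T * (D * T) * indicator {0..T} s)"
      proof (intro AE_I2)
        fix s
        have "\<bar>G (h i) s\<bar> * \<bar>G (h j) s\<bar> \<le> (C * T * indicator {0..T} s) * (D * T * indicator {0..T} s)"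
          using c[of s] by (intro mult_mono order_trans[OF abs_ge_zero c(1)]) auto
        also have "\<dots> \<le> \<bar>C * T * (D * T) * indicator {0..T} s\<bar>" by (auto simp: indicator_def)
        finally show "norm (G (h i) s * G (h j) s) \<le> norm (C * T * (D * T) * indicator {0..T} s)" by (simp add: abs_mult)
      qed
    qed measurable
  qed
  have "(LINT s|lborel. (G H s)\<^sup>2) = (LINT s|lborel. (\<Sum>i<n. \<Sum>j<n. a i * a j * (G (h i) s * G (h j) s)))"
    unfolding GH power2_eq_square sum_product by (simp add: mult_ac)
  also have "\<dots> = (\<Sum>i<n. \<Sum>j<n. a i * a j * (if i = j then lam i else 0))"
    using Gi by (simp add: Bochner_Integration.integral_sum Bochner_Integration.integrable_sum G_orth)
  also have "\<dots> = (\<Sum>i<n. (a i)\<^sup>2 * lam i)"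
    by (intro sum.cong refl) (simp add: power2_eq_square if_distrib cong: if_cong)
  finally have I: "(LINT s|lborel. (G H s)\<^sup>2) = (\<Sum>i<n. (a i)\<^sup>2 * lam i)" .
  have "(CLINT \<omega>|M. iexp (\<Sum>k<n. a k * \<zeta> k \<omega>)) = (CLINT \<omega>|M. iexp (Z H \<omega>))"
  proof (rule integral_cong_AE)
    show "AE \<omega> in M. iexp (\<Sum>k<n. a k * \<zeta> k \<omega>) = iexp (Z H \<omega>)"
      using ZH by eventually_elim (simp only:)
  qed measurable
  also have "\<dots> = of_real (exp (- (\<Sum>k<n. (a k)\<^sup>2 * lam k) / 2))"
    unfolding Z_char[OF Hm Hc good] I ..
  finally show ?thesis .
qed

lemma \<zeta>_second_moment: "(\<integral>\<^sup>+\<omega>. ennreal ((\<zeta> k \<omega>)\<^sup>2) \<partial>M) = ennreal (lam k)"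
proof (rule gaussian_second_moment[OF _ lam_pos])
  show "(CLINT \<omega>|M. iexp (a * \<zeta> k \<omega>)) = of_real (exp (- (a\<^sup>2 * lam k) / 2))" for a
    using \<zeta>_char[where a="\<lambda>j. if j = k then a else 0" and n="Suc k"]
    by (simp add: if_distrib[of "\<lambda>x. x\<^sup>2"] if_distrib[of "\<lambda>x. x * _"] cong: if_cong)
qed simp

lemma bessel_inequality:
  assumes \<omega>: "\<omega> \<in> space M" "integrable lborel (\<lambda>t. (Y t \<omega>)\<^sup>2)"
  shows "(\<Sum>k<n. (\<zeta> k \<omega>)\<^sup>2) \<le> (LINT t|lborel. (Y t \<omega>)\<^sup>2)"
proof -
  define e where "e k t = indicator {0..T} t * h k t" for k t
  define S where "S t = (\<Sum>k<n. \<zeta> k \<omega> * e k t)" for t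
  have eY: "e k t * Y t \<omega> = h k t * Y t \<omega>" for k t
    using Y_out[of t \<omega>] by (cases "t \<in> {0..<T}") (auto simp: e_def)
  have i1: "integrable lborel (\<lambda>t. e k t * Y t \<omega>)" for k
    unfolding eY by (rule Y_mult_integrable[OF h_meas h_cont \<omega>])
  have ee: "e i t * e j t = indicator {0..T} t * (h i t * h j t)" for i j t by (simp add: e_def indicator_def)
  have i2: "integrable lborel (\<lambda>t. e i t * e j t)" for i j
  proof -
    have "continuous_on {0..T} (\<lambda>t. h i t * h j t)" by (intro continuous_intros h_cont)
    hence "set_integrable lborel {0..T} (\<lambda>t. h i t * h j t)" by (rule borel_integrable_atLeastAtMost')
    thus ?thesis unfolding ee by (simp add: set_integrable_def)
  qed
  have YS: "Y t \<omega> * S t = (\<Sum>k<n. \<zeta> k \<omega> * (e k t * Y t \<omega>))" for t by (simp add: S_def sum_distrib_left mult_ac)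
  have SS: "(S t)\<^sup>2 = (\<Sum>i<n. \<Sum>j<n. \<zeta> i \<omega> * \<zeta> j \<omega> * (e i t * e j t))" for t
    unfolding S_def power2_eq_square sum_product by (simp add: mult_ac)
  have iYS: "integrable lborel (\<lambda>t. Y t \<omega> * S t)" unfolding YS using i1 by simp
  have iSS: "integrable lborel (\<lambda>t. (S t)\<^sup>2)" unfolding SS using i2 by simp
  have IYS: "(LINT t|lborel. Y t \<omega> * S t) = (\<Sum>k<n. (\<zeta> k \<omega>)\<^sup>2)"
    unfolding YS using i1 by (simp add: Bochner_Integration.integral_sum eY power2_eq_square) (simp add: \<zeta>_def Z_def)
  have "(LINT t|lborel. (S t)\<^sup>2) = (\<Sum>i<n. \<Sum>j<n. \<zeta> i \<omega> * \<zeta> j \<omega> * (LINT t|lborel. e i t * e j t))"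
    unfolding SS using i2 by (simp add: Bochner_Integration.integral_sum Bochner_Integration.integrable_sum)
  also have "\<dots> = (\<Sum>k<n. (\<zeta> k \<omega>)\<^sup>2)"
    unfolding ee h_orth by (intro sum.cong refl) (simp add: power2_eq_square if_distrib cong: if_cong)
  finally have ISS: "(LINT t|lborel. (S t)\<^sup>2) = (\<Sum>k<n. (\<zeta> k \<omega>)\<^sup>2)" .
  have "0 \<le> (LINT t|lborel. (Y t \<omega> - S t)\<^sup>2)" by simp
  also have "\<dots> = (LINT t|lborel. (Y t \<omega>)\<^sup>2 - 2 * (Y t \<omega> * S t) + (S t)\<^sup>2)"
    by (intro Bochner_Integration.integral_cong) (auto simp: power2_diff)
  also have "\<dots> = (LINT t|lborel. (Y t \<omega>)\<^sup>2) - 2 * (\<Sum>k<n. (\<zeta> k \<omega>)\<^sup>2) + (\<Sum>k<n. (\<zeta> k \<omega>)\<^sup>2)"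
    using \<omega>(2) iYS iSS by (simp add: IYS ISS)
  finally show ?thesis by simp
qed

lemma Q_expansion: "AE \<omega> in M. (SUP n. ennreal (\<Sum>k<n. (\<zeta> k \<omega>)\<^sup>2)) = Q \<omega>"
proof -
  define S where "S \<omega> = (SUP n. ennreal (\<Sum>k<n. (\<zeta> k \<omega>)\<^sup>2))" for \<omega>
  have [measurable]: "S \<in> borel_measurable M" unfolding S_def by measurable
  have le: "AE \<omega> in M. S \<omega> \<le> Q \<omega>"
    using Q_finite AE_space
  proof eventually_elim
    case (elim \<omega>)
    have "Q \<omega> = ennreal (LINT t|lborel. (Y t \<omega>)\<^sup>2)"
      unfolding Q_def by (rule nn_integral_eq_integral[OF elim(1)]) auto
    thus ?case unfolding S_def using bessel_inequality[OF elim(2,1)] by (auto intro!: SUP_least ennreal_leI)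
  qed
  have part: "(\<integral>\<^sup>+\<omega>. ennreal (\<Sum>k<n. (\<zeta> k \<omega>)\<^sup>2) \<partial>M) = ennreal (\<Sum>k<n. lam k)" for n
  proof -
    have "(\<integral>\<^sup>+\<omega>. ennreal (\<Sum>k<n. (\<zeta> k \<omega>)\<^sup>2) \<partial>M) = (\<integral>\<^sup>+\<omega>. (\<Sum>k<n. ennreal ((\<zeta> k \<omega>)\<^sup>2)) \<partial>M)" by simp
    also have "\<dots> = (\<Sum>k<n. ennreal (lam k))" by (subst nn_integral_sum) (auto simp: \<zeta>_second_moment)
    also have "\<dots> = ennreal (\<Sum>k<n. lam k)" using lam_pos by (intro sum_ennreal) (auto intro: less_imp_le)
    finally show ?thesis .
  qed
  have "(\<integral>\<^sup>+\<omega>. S \<omega> \<partial>M) = (SUP n. \<integral>\<^sup>+\<omega>. ennreal (\<Sum>k<n. (\<zeta> k \<omega>)\<^sup>2) \<partial>M)"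
    unfolding S_def
    by (rule nn_integral_monotone_convergence_SUP)
       (auto simp: incseq_def le_fun_def intro!: ennreal_leI sum_mono2)
  also have "\<dots> = ennreal (\<Sum>k. lam k)"
  proof -
    have "incseq (\<lambda>n. ennreal (\<Sum>k<n. lam k))"
      by (intro incseq_SucI ennreal_leI) (simp add: less_imp_le lam_pos)
    from LIMSEQ_unique[OF LIMSEQ_SUP[OF this] tendsto_ennrealI[OF summable_LIMSEQ[OF trace(1)]]]
    show ?thesis unfolding part .
  qed
  finally have IS: "(\<integral>\<^sup>+\<omega>. S \<omega> \<partial>M) = ennreal (\<Sum>k. lam k)" .
  have "(\<integral>\<^sup>+\<omega>. Q \<omega> - S \<omega> \<partial>M) = (\<integral>\<^sup>+\<omega>. Q \<omega> \<partial>M) - (\<integral>\<^sup>+\<omega>. S \<omega> \<partial>M)"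
    \<comment> \<open>Splitting the difference in \<open>ennreal\<close> requires the subtrahend to
      have finite integral and to lie below Q almost everywhere.\<close>
    by (rule nn_integral_diff) (use le in \<open>auto simp: IS\<close>)
  also have "\<dots> = 0" unfolding IS Q_mean using trace(2) by (simp add: ennreal_minus diff_eq_0_ennreal ennreal_leI)
  finally have "AE \<omega> in M. Q \<omega> - S \<omega> = 0" by (subst (asm) nn_integral_0_iff_AE) auto
  moreover have "AE \<omega> in M. Q \<omega> \<noteq> \<infinity>" by (rule nn_integral_noteq_infinite) (simp_all add: Q_mean)
  ultimately show ?thesis using le
  proof eventually_elim
    case (elim \<omega>)
    have "Q \<omega> \<le> S \<omega>" using elim(1,2) by (metis diff_gr0_ennreal infinity_ennreal_def less_top linorder_not_less not_gr_zero)
    thus ?case using elim(3) by (simp add: S_def)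
  qed
qed

text \<open>The strict inequality matters: x lies below the supremum exactly when it lies below some
  partial sum, so the events increase to the limiting event up to a null set.\<close>

lemma Q_tail:
  assumes x: "0 \<le> x"
  shows "(\<lambda>n. prob {\<omega> \<in> space M. x < (\<Sum>k<n. (\<zeta> k \<omega>)\<^sup>2)}) \<longlonglongrightarrow> prob {\<omega> \<in> space M. ennreal x < Q \<omega>}"
proof -
  define A where "A n = {\<omega> \<in> space M. x < (\<Sum>k<n. (\<zeta> k \<omega>)\<^sup>2)}" for n
  have A: "A n \<in> sets M" for n unfolding A_def by measurable
  have "incseq A"
  proof (rule incseq_SucI)
    fix n show "A n \<subseteq> A (Suc n)" by (auto simp: A_def intro: less_le_trans)
  qed
  hence "(\<lambda>n. prob (A n)) \<longlonglongrightarrow> prob (\<Union>n. A n)"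
    using A by (intro finite_Lim_measure_incseq) auto
  moreover have "prob (\<Union>n. A n) = prob {\<omega> \<in> space M. ennreal x < Q \<omega>}"
  proof (rule finite_measure_eq_AE)
    show "AE \<omega> in M. (\<omega> \<in> (\<Union>n. A n)) = (\<omega> \<in> {\<omega> \<in> space M. ennreal x < Q \<omega>})"
      using Q_expansion AE_space
    proof eventually_elim
      case (elim \<omega>)
      have "ennreal x < Q \<omega> \<longleftrightarrow> (\<exists>n. ennreal x < ennreal (\<Sum>k<n. (\<zeta> k \<omega>)\<^sup>2))"
        unfolding elim(1)[symmetric] by (simp add: less_SUP_iff)
      thus ?case using elim(2) x by (auto simp: A_def ennreal_less_iff)
    qed
  qed (use A in measurable)
  ultimately show ?thesis by (simp add: A_def)
qed

lemma \<zeta>_laplace: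
  "0 \<le> s \<Longrightarrow> (LINT \<omega>|M. exp (- s * (\<Sum>k<n. (\<zeta> k \<omega>)\<^sup>2))) = (\<Prod>k<n. 1 / sqrt (1 + 2 * s * lam k))"
  by (rule gaussian_laplace[OF \<zeta>_measurable less_imp_le[OF lam_pos] \<zeta>_char])

end

section \<open>Passage to the limit\<close>

lemma prod_pairs: "(\<Prod>k<m. f (2 * k) * f (Suc (2 * k))) = (\<Prod>j<2 * m. f j :: real)"
  by (induction m) (simp_all add: mult.assoc)

lemma prod_inverse_sqrt: "(\<Prod>k<(n::nat). 1 / sqrt (f k)) = 1 / sqrt (\<Prod>k<n. f k)"
  by (induction n) (simp_all add: real_sqrt_mult)

context bessel_zeros
begin

definition pint :: "nat \<Rightarrow> real \<Rightarrow> real" where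
  "pint n y = (\<Prod>j<n. 1 - y\<^sup>2 / (z j)\<^sup>2)"

lemma pint_tendsto: "(\<lambda>n. pint n y) \<longlonglongrightarrow> bessel_phi \<nu> (y\<^sup>2)"
  unfolding pint_def by (rule product_real)

text \<open>Each further factor has z m >= y and therefore modulus at most 1.\<close>

lemma pint_ge:
  assumes y: "0 < y" "y \<le> z n" and "n \<le> m"
  shows "\<bar>pint m y\<bar> \<le> \<bar>pint n y\<bar>"
  using assms(3)
proof (induction m rule: dec_induct)
  case (step m)
  have "y \<le> z m" using y step(1) mono by (meson order_trans strict_mono_less_eq)
  hence "y\<^sup>2 \<le> (z m)\<^sup>2" using y by (intro power_mono) auto
  hence "\<bar>1 - y\<^sup>2 / (z m)\<^sup>2\<bar> \<le> 1" using z_pos[of m] by (simp add: abs_le_iff)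
  hence "\<bar>pint (Suc m) y\<bar> \<le> \<bar>pint m y\<bar> * 1"
    unfolding pint_def prod.lessThan_Suc abs_mult by (intro mult_left_mono) auto
  thus ?case using step by simp
qed simp

lemma phi_le_pint:
  assumes y: "0 < y" "y \<le> z n"
  shows "\<bar>bessel_phi \<nu> (y\<^sup>2)\<bar> \<le> \<bar>pint n y\<bar>"
  by (rule LIMSEQ_le_const2[OF tendsto_rabs[OF pint_tendsto]]) (use pint_ge[OF y] in blast)

lemma partial_integrand_le:
  assumes "y \<in> {z (2 * k)..z (Suc (2 * k))}" "k \<le> m"
  shows "exp (- c * y\<^sup>2) / (y * sqrt \<bar>pint (2 * Suc m) y\<bar>) \<le> exp (- c * y\<^sup>2) / (y * sqrt \<bar>bessel_phi \<nu> (y\<^sup>2)\<bar>)"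
proof -
  have y0: "0 < y" using assms z_pos[of "2 * k"] by auto
  have "z (Suc (2 * k)) < z (2 * Suc m)" using assms(2) mono by (simp add: strict_mono_less)
  hence y: "y < z (2 * Suc m)" using assms by auto
  show ?thesis
  \<comment> \<open>At a zero of the Bessel factor the right-hand side is 0 by the convention for
    division by 0. The partial product contains that zero as well, so the left-hand side is 0
    too.\<close>
  proof (cases "bessel_phi \<nu> (y\<^sup>2) = 0")
    case True
    hence "y \<in> range z" using y0 unfolding range_z by auto
    then obtain j where j: "y = z j" by auto
    hence "j < 2 * Suc m" using y mono by (simp add: strict_mono_less)
    hence "pint (2 * Suc m) y = 0" using z_pos[of j] unfolding pint_def j by (intro prod_zero bexI[of _ j]) auto
    thus ?thesis by (simp add: True)
  next
    case False
    have "sqrt \<bar>bessel_phi \<nu> (y\<^sup>2)\<bar> \<le> sqrt \<bar>pint (2 * Suc m) y\<bar>" using phi_le_pint[OF y0, of "2 * Suc m"] y by simp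
    thus ?thesis using y0 False by (intro divide_left_mono mult_left_mono mult_pos_pos) auto
  qed
qed

text \<open>The index m stands for m + 1 pairs of zeros, hence \<open>2 * Suc m\<close> factors, and
  k runs from 0 to m.\<close>

definition part_int :: "real \<Rightarrow> nat \<Rightarrow> nat \<Rightarrow> real" where
  "part_int c m k = (LBINT y:{z (2 * k)..z (Suc (2 * k))}. exp (- c * y\<^sup>2) / (y * sqrt \<bar>pint (2 * Suc m) y\<bar>))"

definition lim_int :: "real \<Rightarrow> nat \<Rightarrow> real" where
  "lim_int c k = (LBINT y:{z (2 * k)..z (Suc (2 * k))}. exp (- c * y\<^sup>2) / (y * sqrt \<bar>bessel_phi \<nu> (y\<^sup>2)\<bar>))"

lemma partial_integrand_measurable: "(\<lambda>y. exp (- c * y\<^sup>2) / (y * sqrt \<bar>pint n y\<bar>)) \<in> borel_measurable borel"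
  unfolding pint_def by measurable

lemma part_int_tendsto:
  assumes c: "0 \<le> c"
  shows "(\<lambda>m. part_int c m k) \<longlonglongrightarrow> lim_int c k"
proof -
  let ?I = "{z (2 * k)..z (Suc (2 * k))}"
  \<comment> \<open>The shift by k guarantees that the first k + 1 pairs are present, as domination
    by the limit requires.\<close>
  have "(\<lambda>m. LINT y|lborel. indicator ?I y *\<^sub>R (exp (- c * y\<^sup>2) / (y * sqrt \<bar>pint (2 * Suc (m + k)) y\<bar>)))
    \<longlonglongrightarrow> (LINT y|lborel. indicator ?I y *\<^sub>R (exp (- c * y\<^sup>2) / (y * sqrt \<bar>bessel_phi \<nu> (y\<^sup>2)\<bar>)))"
  proof (rule integral_dominated_convergence[where w="\<lambda>y. indicator ?I y *\<^sub>R (exp (- c * y\<^sup>2) / (y * sqrt \<bar>bessel_phi \<nu> (y\<^sup>2)\<bar>))"])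
    show "integrable lborel (\<lambda>y. indicator ?I y *\<^sub>R (exp (- c * y\<^sup>2) / (y * sqrt \<bar>bessel_phi \<nu> (y\<^sup>2)\<bar>)))"
      using integrand_integrable[OF c, of "2 * k"] by (simp add: set_integrable_def)
    show "AE y in lborel. norm (indicator ?I y *\<^sub>R (exp (- c * y\<^sup>2) / (y * sqrt \<bar>pint (2 * Suc (m + k)) y\<bar>)))
      \<le> indicator ?I y *\<^sub>R (exp (- c * y\<^sup>2) / (y * sqrt \<bar>bessel_phi \<nu> (y\<^sup>2)\<bar>))" for m
    proof (intro AE_I2)
      fix y
      show "norm (indicator ?I y *\<^sub>R (exp (- c * y\<^sup>2) / (y * sqrt \<bar>pint (2 * Suc (m + k)) y\<bar>)))
        \<le> indicator ?I y *\<^sub>R (exp (- c * y\<^sup>2) / (y * sqrt \<bar>bessel_phi \<nu> (y\<^sup>2)\<bar>))"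
      proof (cases "y \<in> ?I")
        case True
        hence "0 < y" using z_pos[of "2 * k"] by auto
        thus ?thesis using True partial_integrand_le[OF True, of "m + k" c] by simp
      qed simp
    qed
    show "AE y in lborel. (\<lambda>m. indicator ?I y *\<^sub>R (exp (- c * y\<^sup>2) / (y * sqrt \<bar>pint (2 * Suc (m + k)) y\<bar>)))
      \<longlonglongrightarrow> indicator ?I y *\<^sub>R (exp (- c * y\<^sup>2) / (y * sqrt \<bar>bessel_phi \<nu> (y\<^sup>2)\<bar>))"
      using AE_lborel_singleton[of "z (2 * k)"] AE_lborel_singleton[of "z (Suc (2 * k))"]
    proof eventually_elim
      case (elim y)
      show ?case
      proof (cases "y \<in> ?I")
        case True
        hence y: "z (2 * k) < y" "y < z (Suc (2 * k))" "0 < y" using elim z_pos[of "2 * k"] by auto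
        have nz: "bessel_phi \<nu> (y\<^sup>2) \<noteq> 0" by (rule no_zero_between[OF y(1,2)])
        have "filterlim (\<lambda>m. 2 * Suc (m + k)) at_top sequentially"
          by (rule filterlim_subseq) (auto simp: strict_mono_def)
        hence "(\<lambda>m. pint (2 * Suc (m + k)) y) \<longlonglongrightarrow> bessel_phi \<nu> (y\<^sup>2)"
          by (rule filterlim_compose[OF pint_tendsto])
        thus ?thesis using nz y by (intro tendsto_intros) auto
      qed simp
    qed
  qed (use integrand_measurable[of c] partial_integrand_measurable[of c] in measurable)
  hence "(\<lambda>m. part_int c (m + k) k) \<longlonglongrightarrow> lim_int c k"
    by (simp add: part_int_def lim_int_def set_lebesgue_integral_def)
  thus ?thesis by (rule LIMSEQ_offset)
qed

lemma part_int_le: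
  assumes c: "0 \<le> c" and k: "k \<le> m"
  shows "\<bar>part_int c m k\<bar> \<le> lim_int c k"
proof -
  let ?I = "{z (2 * k)..z (Suc (2 * k))}"
  let ?g = "\<lambda>y. exp (- c * y\<^sup>2) / (y * sqrt \<bar>bessel_phi \<nu> (y\<^sup>2)\<bar>)"
  let ?f = "\<lambda>y. exp (- c * y\<^sup>2) / (y * sqrt \<bar>pint (2 * Suc m) y\<bar>)"
  have nn: "0 \<le> indicator ?I y *\<^sub>R ?f y" for y using z_pos[of "2 * k"] by (auto simp: indicator_def)
  have le: "indicator ?I y *\<^sub>R ?f y \<le> indicator ?I y *\<^sub>R ?g y" for y
    using partial_integrand_le[OF _ k, of y c] by (cases "y \<in> ?I") auto
  have g: "integrable lborel (\<lambda>y. indicator ?I y *\<^sub>R ?g y)"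
    using integrand_integrable[OF c, of "2 * k"] by (simp add: set_integrable_def)
  have f: "integrable lborel (\<lambda>y. indicator ?I y *\<^sub>R ?f y)"
    by (rule Bochner_Integration.integrable_bound[OF g])
       (use partial_integrand_measurable[of c] nn le in \<open>auto intro!: AE_I2 order_trans[OF _ abs_ge_self] simp del: real_scaleR_def\<close>)
  have "part_int c m k \<le> lim_int c k"
    unfolding part_int_def lim_int_def set_lebesgue_integral_def using f g le by (rule integral_mono)
  moreover have "0 \<le> part_int c m k"
    unfolding part_int_def set_lebesgue_integral_def using nn by (rule Bochner_Integration.integral_nonneg)
  ultimately show ?thesis by simp
qed

lemma alternating_sum_tendsto:
  assumes c: "0 < c"
  shows "summable (\<lambda>k. (-1) ^ k * lim_int c k)"
    and "(\<lambda>m. \<Sum>k<Suc m. (-1) ^ k * part_int c m k) \<longlonglongrightarrow> (\<Sum>k. (-1) ^ k * lim_int c k)"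
proof -
  \<comment> \<open>Rows padded with zeros, so that all are series over the same index with the
    common majorant \<open>lim_int c\<close>, as Tannery's theorem demands.\<close>
  define u where "u k m = (if k < Suc m then (-1) ^ k * part_int c m k else 0)" for k m :: nat
  have lim: "(\<lambda>m. u k m) \<longlonglongrightarrow> (-1) ^ k * lim_int c k" for k
  proof -
    have "(\<lambda>m. (-1) ^ k * part_int c m k) \<longlonglongrightarrow> (-1) ^ k * lim_int c k"
      using c by (intro tendsto_intros part_int_tendsto) auto
    moreover have "\<forall>\<^sub>F m in sequentially. u k m = (-1) ^ k * part_int c m k"
      using eventually_ge_at_top[of k] by eventually_elim (simp add: u_def)
    ultimately show ?thesis by (simp add: filterlim_cong)
  qed
  have nn: "0 \<le> lim_int c k" for k using part_int_le[of c k k] c by (simp add: order_trans[OF abs_ge_zero])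
  have "norm (u k m) \<le> lim_int c k" for k m
    using part_int_le[of c k m] c nn[of k] by (simp add: u_def abs_mult power_abs)
  hence bd: "\<forall>\<^sub>F (k, m) in at_top \<times>\<^sub>F sequentially. norm (u k m) \<le> lim_int c k" by (simp add: always_eventually)
  have sm: "summable (lim_int c)" using integrand_summable[OF c] by (simp add: lim_int_def[abs_def])
  note t = tannerys_theorem[OF lim bd sm sequentially_bot]
  show "summable (\<lambda>k. (-1) ^ k * lim_int c k)" using t by (auto intro: summable_norm_cancel)
  have "(\<Sum>k. u k m) = (\<Sum>k<Suc m. (-1) ^ k * part_int c m k)" for m
    by (subst suminf_finite[of "{..<Suc m}"]) (auto simp: u_def intro!: sum.cong)
  thus "(\<lambda>m. \<Sum>k<Suc m. (-1) ^ k * part_int c m k) \<longlonglongrightarrow> (\<Sum>k. (-1) ^ k * lim_int c k)"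
    using t by simp
qed

theorem smirnov_series:
  fixes M :: "'a measure" and S :: "nat \<Rightarrow> 'a \<Rightarrow> real"
  assumes M: "prob_space M" and S: "\<And>n. S n \<in> borel_measurable M" "\<And>n \<omega>. 0 \<le> S n \<omega>"
    and laplace: "\<And>n s. 0 \<le> s \<Longrightarrow> (LINT \<omega>|M. exp (- s * S n \<omega>)) = (\<Prod>k<n. 1 / sqrt (1 + 2 * s * (T\<^sup>2 / (z k)\<^sup>2)))"
    and T: "0 < T" and x: "0 < x"
    and lim: "(\<lambda>n. measure M {\<omega> \<in> space M. x < S n \<omega>}) \<longlonglongrightarrow> p"
  shows "p = 2 / pi * (\<Sum>k. (-1) ^ k * lim_int (x / (2 * T\<^sup>2)) k)"
proof -
  \<comment> \<open>Zeros are counted from 0, so the k-th pair is z (2k), z (2k+1); a and b are the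
    reciprocals of the variances T^2 / z_j^2.\<close>
  define a where "a k = (z (2 * k))\<^sup>2 / T\<^sup>2" for k
  define b where "b k = (z (Suc (2 * k)))\<^sup>2 / T\<^sup>2" for k
  define c where "c = x / (2 * T\<^sup>2)"
  have c: "0 < c" using T x by (simp add: c_def)
  have less: "(z i)\<^sup>2 / T\<^sup>2 < (z j)\<^sup>2 / T\<^sup>2" if "i < j" for i j
    using strict_monoD[OF zsq_mono that] T by (simp add: divide_strict_right_mono)
  interpret I: interlacing a b
  proof
    show "0 < a 0" using z_pos[of 0] T by (simp add: a_def)
    show "a k < b k" "b k < a (Suc k)" for k unfolding a_def b_def by (rule less; simp)+
  qed
  have F: "I.F m u = (\<Prod>j<2 * m. 1 - u * T\<^sup>2 / (z j)\<^sup>2)" for m u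
    unfolding I.F_def a_def b_def by (subst prod_pairs[symmetric]) (use T in \<open>simp add: field_simps\<close>)
  have Fp: "I.F m (y\<^sup>2 / T\<^sup>2) = pint (2 * m) y" for m y
    using T unfolding F pint_def by simp
  \<comment> \<open>Variables are grouped in pairs, so even numbers of terms are treated; the
    convergence of the tails is used along this subsequence.\<close>
  have "measure M {\<omega> \<in> space M. x < S (2 * Suc m) \<omega>} = 2 / pi * (\<Sum>k<Suc m. (-1) ^ k * part_int c m k)" for m
  proof -
    have "measure M {\<omega> \<in> space M. x < S (2 * Suc m) \<omega>}
      = (\<Sum>k<Suc m. (-1) ^ k * (LINT u|lborel. I.\<rho> (Suc m) k u * exp (- u * x / 2) / u))"
    proof (rule I.smirnov_finite[OF M S(1) S(2)])
      fix s :: real assume s: "0 \<le> s"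
      have "(\<Prod>k<2 * Suc m. 1 / sqrt (1 + 2 * s * (T\<^sup>2 / (z k)\<^sup>2))) = 1 / sqrt (I.F (Suc m) (- 2 * s))"
      proof -
        have "I.F (Suc m) (- 2 * s) = (\<Prod>k<2 * Suc m. 1 + 2 * s * (T\<^sup>2 / (z k)\<^sup>2))"
          unfolding F by simp
        thus ?thesis by (simp only: prod_inverse_sqrt)
      qed
      thus "(LINT \<omega>|M. exp (- s * S (2 * Suc m) \<omega>)) = 1 / sqrt (I.F (Suc m) (- 2 * s))"
        using laplace[OF s] by simp
    qed (use x in simp)
    also have "(LINT u|lborel. I.\<rho> (Suc m) k u * exp (- u * x / 2) / u) = 2 / pi * part_int c m k" if k: "k < Suc m" for k
    proof -
      define f where "f u = exp (- u * x / 2) / (u * (pi * sqrt \<bar>I.F (Suc m) u\<bar>))" for u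
      have f: "indicator {a k..b k} u *\<^sub>R f u = I.\<rho> (Suc m) k u * exp (- u * x / 2) / u" for u
        by (simp add: I.\<rho>_def f_def)
      have zz: "0 < z (2 * k)" "z (2 * k) \<le> z (Suc (2 * k))" using z_pos mono by (auto simp: strict_mono_less_eq)
      have "set_integrable lborel {a k..b k} f"
        unfolding set_integrable_def f
      proof (rule Bochner_Integration.integrable_bound)
        have ri: "integrable lborel (I.\<rho> (Suc m) k)" using k by (intro I.stieltjes_formula) auto
        show "integrable lborel (\<lambda>u. I.\<rho> (Suc m) k u / a k)" using ri by simp
        have [measurable]: "I.\<rho> (Suc m) k \<in> borel_measurable borel" using borel_measurable_integrable[OF ri] by simp
        show "(\<lambda>u. I.\<rho> (Suc m) k u * exp (- u * x / 2) / u) \<in> borel_measurable lborel" by measurable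
        show "AE u in lborel. norm (I.\<rho> (Suc m) k u * exp (- u * x / 2) / u) \<le> norm (I.\<rho> (Suc m) k u / a k)"
        proof (intro AE_I2)
          fix u
          show "norm (I.\<rho> (Suc m) k u * exp (- u * x / 2) / u) \<le> norm (I.\<rho> (Suc m) k u / a k)"
          proof (cases "I.\<rho> (Suc m) k u = 0")
            case False
            hence u: "a k \<le> u" "0 < a k" using I.\<rho>_supp I.a_pos by auto
            have "exp (- u * x / 2) \<le> 1" using u x by simp
            hence "\<bar>I.\<rho> (Suc m) k u\<bar> * exp (- u * x / 2) \<le> \<bar>I.\<rho> (Suc m) k u\<bar> * 1" by (intro mult_left_mono) auto
            thus ?thesis using u by (simp add: abs_mult frac_le)
          qed simp
        qed
      qed
      hence fi: "set_integrable lborel {(z (2 * k))\<^sup>2 / T\<^sup>2..(z (Suc (2 * k)))\<^sup>2 / T\<^sup>2} f" by (simp only: a_def b_def)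
      \<comment> \<open>Substituting u = y^2 / T^2 gives du / u = 2 dy / y, the source of the factor
        2 in 2 / pi.\<close>
      have sub: "(LINT u|lborel. f u * indicator {(z (2 * k))\<^sup>2 / T\<^sup>2..(z (Suc (2 * k)))\<^sup>2 / T\<^sup>2} u)
         = (LINT y|lborel. f (y\<^sup>2 / T\<^sup>2) * (2 * y / T\<^sup>2) * indicator {z (2 * k)..z (Suc (2 * k))} y)"
      proof (rule integral_substitution(2)[where g = "\<lambda>y. y\<^sup>2 / T\<^sup>2" and g' = "\<lambda>y. 2 * y / T\<^sup>2"
            and f = f and a = "z (2 * k)" and b = "z (Suc (2 * k))"])
        show "set_integrable lborel {(z (2 * k))\<^sup>2 / T\<^sup>2..(z (Suc (2 * k)))\<^sup>2 / T\<^sup>2} f" by (rule fi)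
        show "((\<lambda>y. y\<^sup>2 / T\<^sup>2) has_real_derivative 2 * y / T\<^sup>2) (at y)" for y
          by (intro DERIV_cdivide) (auto intro!: derivative_eq_intros)
        show "continuous_on {z (2 * k)..z (Suc (2 * k))} (\<lambda>y. 2 * y / T\<^sup>2)" using T by (intro continuous_intros) auto
      qed (use zz in auto)
      have "(LINT u|lborel. I.\<rho> (Suc m) k u * exp (- u * x / 2) / u)
         = (LINT u|lborel. f u * indicator {(z (2 * k))\<^sup>2 / T\<^sup>2..(z (Suc (2 * k)))\<^sup>2 / T\<^sup>2} u)"
        unfolding f[symmetric] a_def b_def by (simp add: mult.commute)
      also have "\<dots> = (LINT y|lborel. 2 / pi * (indicator {z (2 * k)..z (Suc (2 * k))} y *\<^sub>R
            (exp (- c * y\<^sup>2) / (y * sqrt \<bar>pint (2 * Suc m) y\<bar>))))"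
        unfolding sub
      proof (intro Bochner_Integration.integral_cong refl)
        fix y
        show "f (y\<^sup>2 / T\<^sup>2) * (2 * y / T\<^sup>2) * indicator {z (2 * k)..z (Suc (2 * k))} y
          = 2 / pi * (indicator {z (2 * k)..z (Suc (2 * k))} y *\<^sub>R (exp (- c * y\<^sup>2) / (y * sqrt \<bar>pint (2 * Suc m) y\<bar>)))"
        proof (cases "y \<in> {z (2 * k)..z (Suc (2 * k))}")
          case True
          hence y: "0 < y" using zz by auto
          have e: "- (y\<^sup>2 / T\<^sup>2) * x / 2 = - c * y\<^sup>2" by (simp add: c_def mult_ac)
          have "f (y\<^sup>2 / T\<^sup>2) * (2 * y / T\<^sup>2) = 2 / pi * (exp (- c * y\<^sup>2) / (y * sqrt \<bar>pint (2 * Suc m) y\<bar>))"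
            unfolding f_def Fp e using y T by (simp add: field_simps power2_eq_square)
          thus ?thesis using True by simp
        qed simp
      qed
      also have "\<dots> = 2 / pi * part_int c m k"
        unfolding part_int_def set_lebesgue_integral_def by (rule integral_mult_right_zero)
      finally show ?thesis .
    qed
    hence "(\<Sum>k<Suc m. (-1) ^ k * (LINT u|lborel. I.\<rho> (Suc m) k u * exp (- u * x / 2) / u))
        = (\<Sum>k<Suc m. (-1) ^ k * (2 / pi * part_int c m k))" by (intro sum.cong refl) auto
    also have "\<dots> = 2 / pi * (\<Sum>k<Suc m. (-1) ^ k * part_int c m k)"
      unfolding sum_distrib_left by (intro sum.cong refl) simp
    finally show ?thesis .
  qed
  hence "(\<lambda>m. measure M {\<omega> \<in> space M. x < S (2 * Suc m) \<omega>}) \<longlonglongrightarrow> 2 / pi * (\<Sum>k. (-1) ^ k * lim_int c k)"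
    using tendsto_mult[OF tendsto_const alternating_sum_tendsto(2)[OF c], of "2 / pi"] by (simp only:)
  moreover have "(\<lambda>m. measure M {\<omega> \<in> space M. x < S (2 * Suc m) \<omega>}) \<longlonglongrightarrow> p"
    by (rule filterlim_compose[OF lim], rule filterlim_subseq) (auto simp: strict_mono_def)
  ultimately show ?thesis unfolding c_def by (rule LIMSEQ_unique[rotated])
qed

end

section \<open>The Wiener bridge and Bessel functions\<close>

lemma lborel_integral_reflect:
  fixes f :: "real \<Rightarrow> real"
  assumes "0 < T"
  shows "(LINT t|lborel. f t) = T * (LINT x|lborel. f (T - T * x))"
  using lborel_integral_real_affine[of "- T" f T] assms by simp

lemma lborel_integral_Icc:
  fixes g :: "real \<Rightarrow> real"
  assumes "continuous_on {a..b} g"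
  shows "(LINT x|lborel. indicator {a..b} x * g x) = integral {a..b} g"
  using set_borel_integral_eq_integral(2)[OF borel_integrable_atLeastAtMost'[OF assms]]
  by (simp add: set_lebesgue_integral_def)

text \<open>In x = (T - t) / T the square of the weight x^\<alpha> is x^(2\<nu>+1), so
  orthonormality is that of the Bessel functions on [0,1]. The kernel acts through
  \<open>bessel_phi_primitive\<close> and yields the functions of order \<nu>+1, whose inner
  products \<open>bessel_phi_dirichlet\<close> reduces to the former ones with the factor 1 /
  z_k^2.\<close>

lemma (in wiener_bridge) bessel_expansion:
  assumes "bessel_zeros \<nu> z" and \<nu>: "\<nu> = \<alpha> - 1 / 2"
  shows "\<exists>h. wiener_bridge_expansion M B X \<alpha> T N h (\<lambda>k. T\<^sup>2 / (z k)\<^sup>2)"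
proof -
  interpret bessel_zeros \<nu> z by fact
  define ph where "ph j k x = bessel_phi (\<nu> + j) ((z k)\<^sup>2 * x\<^sup>2)" for j k and x :: real
  define I where "I i j = integral {0..1} (\<lambda>x. x powr (2 * \<nu> + 1) * ph 0 i x * ph 0 j x)" for i j
  \<comment> \<open>The factor T under the root comes from dt = T dx.\<close>
  define c where "c k = 1 / sqrt (T * I k k)" for k
  define h where "h k t = c k * (((T - t) / T) powr \<alpha> * ph 0 k ((T - t) / T))" for k t
  have phc: "continuous_on S (ph 0 k)" "continuous_on S (ph 1 k)" for S k
    unfolding ph_def using nu by (intro continuous_intros; auto)+
  have I_pos: "0 < I k k" for k
    using bessel_phi_energy_pos[OF nu, of "(z k)\<^sup>2"]
    by (simp add: I_def ph_def power2_eq_square mult_ac)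
  have I_off: "I i j = 0" if "i \<noteq> j" for i j
  proof -
    have "(z i)\<^sup>2 \<noteq> (z j)\<^sup>2" using strict_mono_eq[OF zsq_mono] that by simp
    thus ?thesis using bessel_phi_orthogonal[OF nu phi_z phi_z] by (simp add: I_def ph_def)
  qed
  have cc: "c k * c k * (T * I k k) = 1" for k
    using T I_pos[of k] by (simp add: c_def)
  have affine: "(T - (T - T * x)) / T = x" for x using T by simp
  have ind: "indicator {0..T} (T - T * x) = (indicator {0..1} x :: real)" for x
    using T by (auto simp: indicator_def mult_le_cancel_left1 zero_le_mult_iff)
  have two_\<alpha>: "x powr \<alpha> * x powr \<alpha> = x powr (2 * \<nu> + 1)" for x :: real
    by (simp add: \<nu> flip: powr_add)
  have orth: "(LINT t|lborel. indicator {0..T} t * (h i t * h j t)) = (if i = j then 1 else 0)" for i j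
  proof -
    have "(LINT t|lborel. indicator {0..T} t * (h i t * h j t))
      = T * (LINT x|lborel. indicator {0..1} x * (c i * c j * (x powr (2 * \<nu> + 1) * ph 0 i x * ph 0 j x)))"
      unfolding lborel_integral_reflect[OF T, of "\<lambda>t. indicator {0..T} t * (h i t * h j t)"]
      unfolding ind h_def affine two_\<alpha>[symmetric]
      by (simp add: mult_ac)
    also have "(LINT x|lborel. indicator {0..1} x * (c i * c j * (x powr (2 * \<nu> + 1) * ph 0 i x * ph 0 j x)))
      = integral {0..1} (\<lambda>x. c i * c j * (x powr (2 * \<nu> + 1) * ph 0 i x * ph 0 j x))"
      using nu by (intro lborel_integral_Icc continuous_intros phc) auto
    also have "\<dots> = c i * c j * I i j" unfolding I_def by (rule integral_mult_right)
    finally show ?thesis using cc[of i] I_off[of i j] by (auto simp: mult_ac)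
  qed
  have hm: "h k \<in> borel_measurable borel" for k
  proof -
    have [measurable]: "ph 0 k \<in> borel_measurable borel" using phc(1) by (rule borel_measurable_continuous_onI)
    show ?thesis unfolding h_def by measurable
  qed
  have hc: "continuous_on {0..T} (h k)" for k
    unfolding h_def using T \<alpha> by (intro continuous_intros continuous_on_compose2[OF phc(1)[of UNIV]] continuous_on_powr') auto
  define D where "D k = T * c k / (2 * (\<nu> + 1))" for k
  have G_eq: "G (h k) s = indicator {0..T} s * (D k * (((T - s) / T) powr (\<nu> + 3/2) * ph 1 k ((T - s) / T)))" for k s
  proof (cases "0 \<le> s \<and> s < T")
    case True
    define \<rho> where "\<rho> = (T - s) / T"
    have \<rho>: "0 < \<rho>" "T - s = T * \<rho>" using True T by (auto simp: \<rho>_def)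
    \<comment> \<open>After the reflection s <= t reads x <= \<rho>, and the kernel separates into
      powers of \<rho> and x. At x = 0, that is t = T, both sides are 0.\<close>
    have kern: "kern (T - T * x) s = indicator {0..\<rho>} x * (\<rho> powr (- \<alpha>) * x powr \<alpha>)" for x
    proof (cases "0 < x \<and> x \<le> \<rho>")
      case x: True
      have "T * x \<le> T * \<rho>" using x T by simp
      hence "s \<le> T - T * x" using \<rho>(2) by linarith
      moreover have "T - T * x < T" using x T by simp
      ultimately have "kern (T - T * x) s = (T * x / (T * \<rho>)) powr \<alpha>" using True \<rho>(2) by (simp add: kern_def)
      also have "\<dots> = \<rho> powr (- \<alpha>) * x powr \<alpha>" using T x \<rho> by (simp add: powr_divide powr_minus field_simps)
      finally show ?thesis using x by simp
    next
      case False
      have "\<not> (s \<le> T - T * x \<and> T - T * x < T)"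
      proof
        assume "s \<le> T - T * x \<and> T - T * x < T"
        hence "T * x \<le> T * \<rho>" "0 < T * x" using \<rho>(2) by auto
        thus False using False T by (simp add: zero_less_mult_iff)
      qed
      hence "kern (T - T * x) s = 0" unfolding kern_def by auto
      moreover have "indicator {0..\<rho>} x * (\<rho> powr (- \<alpha>) * x powr \<alpha>) = 0" using False by (cases "x = 0") (auto simp: indicator_def)
      ultimately show ?thesis by simp
    qed
    have "G (h k) s = T * (LINT x|lborel. indicator {0..\<rho>} x * (c k * \<rho> powr (- \<alpha>) * (x powr (2 * \<nu> + 1) * ph 0 k x)))"
      unfolding G_def lborel_integral_reflect[OF T, of "\<lambda>t. h k t * kern t s"]
      unfolding kern h_def affine two_\<alpha>[symmetric]
      by (simp add: mult_ac)
    also have "(LINT x|lborel. indicator {0..\<rho>} x * (c k * \<rho> powr (- \<alpha>) * (x powr (2 * \<nu> + 1) * ph 0 k x)))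
      = integral {0..\<rho>} (\<lambda>x. c k * \<rho> powr (- \<alpha>) * (x powr (2 * \<nu> + 1) * ph 0 k x))"
      using nu by (intro lborel_integral_Icc continuous_intros phc) auto
    also have "\<dots> = c k * \<rho> powr (- \<alpha>) * integral {0..\<rho>} (\<lambda>x. x powr (2 * \<nu> + 1) * ph 0 k x)" by (rule integral_mult_right)
    also have "integral {0..\<rho>} (\<lambda>x. x powr (2 * \<nu> + 1) * ph 0 k x) = \<rho> powr (2 * \<nu> + 2) * ph 1 k \<rho> / (2 * (\<nu> + 1))"
      using bessel_phi_primitive[OF nu, of \<rho> "(z k)\<^sup>2"] \<rho> by (intro integral_unique) (simp add: ph_def)
    also have "T * (c k * \<rho> powr (- \<alpha>) * (\<rho> powr (2 * \<nu> + 2) * ph 1 k \<rho> / (2 * (\<nu> + 1))))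
      = D k * ((\<rho> powr (- \<alpha>) * \<rho> powr (2 * \<nu> + 2)) * ph 1 k \<rho>)" by (simp add: D_def)
    also have "\<rho> powr (- \<alpha>) * \<rho> powr (2 * \<nu> + 2) = \<rho> powr (\<nu> + 3/2)" by (simp add: \<nu> add_ac flip: powr_add)
    finally show ?thesis using True by (simp add: \<rho>_def)
  next
    case False
    hence "kern t s = 0" for t by (auto simp: kern_def)
    hence "G (h k) s = 0" by (simp add: G_def)
    moreover have "indicator {0..T} s * (D k * (((T - s) / T) powr (\<nu> + 3/2) * ph 1 k ((T - s) / T))) = 0"
      using False by (cases "s = T") (auto simp: indicator_def)
    ultimately show ?thesis by simp
  qed
  have G_orth: "(LINT s|lborel. G (h i) s * G (h j) s) = (if i = j then T\<^sup>2 / (z i)\<^sup>2 else 0)" for i j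
  proof -
    define K where "K = integral {0..1} (\<lambda>x. x powr (2 * \<nu> + 3) * ph 1 i x * ph 1 j x)"
    have K: "(z i)\<^sup>2 * K = (2 * (\<nu> + 1))\<^sup>2 * I i j"
      using bessel_phi_dirichlet[OF nu phi_z[of i], of "(z j)\<^sup>2"] by (simp add: K_def I_def ph_def)
    have pw: "x powr (\<nu> + 3/2) * x powr (\<nu> + 3/2) = x powr (2 * \<nu> + 3)" for x :: real by (simp flip: powr_add)
    have "(LINT s|lborel. G (h i) s * G (h j) s) = T * (LINT x|lborel. indicator {0..1} x * (D i * D j * (x powr (2 * \<nu> + 3) * ph 1 i x * ph 1 j x)))"
      unfolding lborel_integral_reflect[OF T, of "\<lambda>s. G (h i) s * G (h j) s"]
      unfolding G_eq ind affine pw[symmetric]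
      by (rule arg_cong2[where f="(*)"], rule refl, rule Bochner_Integration.integral_cong[OF refl]) (auto simp: indicator_def)
    also have "(LINT x|lborel. indicator {0..1} x * (D i * D j * (x powr (2 * \<nu> + 3) * ph 1 i x * ph 1 j x)))
      = integral {0..1} (\<lambda>x. D i * D j * (x powr (2 * \<nu> + 3) * ph 1 i x * ph 1 j x))"
      using nu by (intro lborel_integral_Icc continuous_intros phc) auto
    also have "\<dots> = D i * D j * K" unfolding K_def by (rule integral_mult_right)
    also have "K = (2 * (\<nu> + 1))\<^sup>2 * I i j / (z i)\<^sup>2" using K z_pos[of i] by (simp add: field_simps)
    also have "T * (D i * D j * ((2 * (\<nu> + 1))\<^sup>2 * I i j / (z i)\<^sup>2)) = T\<^sup>2 * (c i * c j * (T * I i j)) / (z i)\<^sup>2"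
    proof -
      define m where "m = 2 * (\<nu> + 1)"
      have "m \<noteq> 0" using nu by (simp add: m_def)
      thus ?thesis unfolding D_def m_def[symmetric] by (simp add: power2_eq_square)
    qed
    finally show ?thesis using cc[of i] I_off[of i j] by auto
  qed
  have "wiener_bridge_expansion M B X \<alpha> T N h (\<lambda>k. T\<^sup>2 / (z k)\<^sup>2)"
  proof
    show "0 < T\<^sup>2 / (z k)\<^sup>2" for k using T z_pos[of k] by simp
    show "summable (\<lambda>k. T\<^sup>2 / (z k)\<^sup>2)" using summable_mult[OF rayleigh(1), of "T\<^sup>2"] by simp
    have "T\<^sup>2 / (2 * (2 * \<alpha> + 1)) = T\<^sup>2 * (1 / (4 * (\<nu> + 1)))" by (simp add: \<nu>)
    also have "\<dots> \<le> T\<^sup>2 * (\<Sum>k. 1 / (z k)\<^sup>2)" by (intro mult_left_mono rayleigh) auto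
    also have "\<dots> = (\<Sum>k. T\<^sup>2 / (z k)\<^sup>2)" using suminf_mult[OF rayleigh(1), of "T\<^sup>2"] by simp
    finally show "T\<^sup>2 / (2 * (2 * \<alpha> + 1)) \<le> (\<Sum>k. T\<^sup>2 / (z k)\<^sup>2)" .
  qed (use hm hc orth G_orth in auto)
  thus ?thesis by blast
qed

text \<open>On the null set N the paths of X are arbitrary, so the event may fail to be in M.
  Outside N it agrees with the event for the regular version, the time T being null, and so it is
  measurable for the completion with the same measure.\<close>

lemma (in wiener_bridge) completion_tail:
  assumes "0 \<le> x"
  shows "measure (completion M) {\<omega> \<in> space M. (\<integral>\<^sup>+t\<in>{0..T}. ennreal ((X t \<omega>)\<^sup>2) \<partial>lborel) > ennreal x}
    = prob {\<omega> \<in> space M. ennreal x < Q \<omega>}"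
proof -
  define A where "A = {\<omega> \<in> space M. (\<integral>\<^sup>+t\<in>{0..T}. ennreal ((X t \<omega>)\<^sup>2) \<partial>lborel) > ennreal x}"
  define A' where "A' = {\<omega> \<in> space M. ennreal x < Q \<omega>}"
  have A'm: "A' \<in> sets M" unfolding A'_def by measurable
  have eq: "\<omega> \<in> A \<longleftrightarrow> \<omega> \<in> A'" if "\<omega> \<notin> N" for \<omega>
  proof (cases "\<omega> \<in> space M")
    case True
    have "(\<integral>\<^sup>+t\<in>{0..T}. ennreal ((X t \<omega>)\<^sup>2) \<partial>lborel) = Q \<omega>"
      unfolding Q_def
    proof (rule nn_integral_cong_AE)
      show "AE t in lborel. ennreal ((X t \<omega>)\<^sup>2) * indicator {0..T} t = ennreal ((Y t \<omega>)\<^sup>2)"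
        using AE_lborel_singleton[of T]
        by eventually_elim (use True that in \<open>auto simp: Y_def indicator_def\<close>)
    qed
    thus ?thesis using True by (simp add: A_def A'_def)
  qed (simp add: A_def A'_def)
  have Am: "A \<in> sets (completion M)"
  proof (rule sets_completionI)
    show "A = (A' - N) \<union> (A \<inter> N)" using eq by auto
    show "A' - N \<in> sets M" using A'm N by auto
  qed (use N in auto)
  have "AE \<omega> in completion M. \<omega> \<in> A \<longleftrightarrow> \<omega> \<in> A'"
    by (rule AE_completion) (use AE_not_in[OF N] eq in \<open>auto elim!: eventually_mono\<close>)
  hence "emeasure (completion M) A = emeasure (completion M) A'"
    using Am A'm by (intro emeasure_eq_AE) auto
  thus ?thesis using A'm unfolding A_def[symmetric] A'_def[symmetric] by (simp add: measure_def)
qed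

lemma wiener_bridge_intro:
  assumes W: "standard_wiener_process M B" and X: "alpha_wiener_bridge M B \<alpha> T X" and "0 < T" "0 < \<alpha>"
  shows "\<exists>N. wiener_bridge M B X \<alpha> T N"
proof -
  have "AE \<omega> in M. continuous_on {0..<T} (\<lambda>t. X t \<omega>)" using X by (simp add: alpha_wiener_bridge_def)
  then obtain N where N: "{\<omega> \<in> space M. \<not> continuous_on {0..<T} (\<lambda>t. X t \<omega>)} \<subseteq> N" "N \<in> null_sets M"
    by (auto simp: eventually_ae_filter)
  interpret prob_space M using W by (simp add: standard_wiener_process_def)
  have "wiener_bridge M B X \<alpha> T N"
    by unfold_locales (use W X N assms(3,4) in \<open>auto simp: standard_wiener_process_def alpha_wiener_bridge_def\<close>)
  thus ?thesis by blast
qed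

text \<open>Integrability of each integrand and convergence of the series are asserted as well,
  because integrals and infinite sums in the formula would otherwise be able to take default values.
  The squared norm is an \<open>ennreal\<close> integral, so it is meaningful for every
  path.\<close>

theorem proposition3p3:
  fixes M :: "'a measure" and B X :: "real \<Rightarrow> 'a \<Rightarrow> real"
    and T \<alpha> \<nu> x :: real and z :: "nat \<Rightarrow> real"
  assumes "0 < T" and "0 < \<alpha>" and "\<nu> = \<alpha> - 1 / 2"
    and "strict_mono_on {1..} z"
    and "z ` {1..} = {u. 0 < u \<and> bessel_J \<nu> u = 0}"
    and "standard_wiener_process M B"
    and "alpha_wiener_bridge M B \<alpha> T X"
    and "0 < x"
  shows "let f = (\<lambda>u. u powr (\<nu> / 2 - 1) * (exp (- x * u\<^sup>2 / (2 * T\<^sup>2)) / sqrt \<bar>bessel_J \<nu> u\<bar>));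
             a = (\<lambda>k::nat. (-1) ^ (k + 1) * (LBINT u:{z (2 * k - 1)..z (2 * k)}. f u))
         in (\<forall>k\<ge>1. set_integrable lborel {z (2 * k - 1)..z (2 * k)} f) \<and>
            summable (\<lambda>j. a (Suc j)) \<and>
            measure (completion M)
              {\<omega> \<in> space M. (\<integral>\<^sup>+t\<in>{0..T}. ennreal ((X t \<omega>)\<^sup>2) \<partial>lborel) > ennreal x}
            = 2 powr (1 - \<nu> / 2) / (pi * sqrt (Gamma (\<nu> + 1))) * (\<Sum>j. a (Suc j))"
proof -
  have nu: "-1/2 < \<nu>" using assms(2,3) by simp
  have Gam: "0 < Gamma (\<nu> + 1)" using nu by (intro Gamma_real_pos) auto
  \<comment> \<open>The statement counts zeros from 1, the locale from 0. With k = j + 1 the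
    interval becomes that of y (2j) and y (2j+1), and the sign (-1)^(k+1) becomes (-1)^j.\<close>
  define y where "y k = z (Suc k)" for k
  have J: "bessel_J \<nu> u = (u / 2) powr \<nu> / Gamma (\<nu> + 1) * bessel_phi \<nu> (u\<^sup>2)" if "0 < u" for u
    by (rule bessel_J_eq_bessel_phi[OF nu that])
  have bz: "bessel_zeros \<nu> y"
  proof
    show "strict_mono y" using assms(4) by (auto simp: strict_mono_def strict_mono_on_def y_def)
    have "{1..} = range Suc" 
    proof (rule set_eqI)
      fix n :: nat
      show "n \<in> {1..} \<longleftrightarrow> n \<in> range Suc" by (cases n) auto
    qed
    hence "range y = z ` {1..}" by (simp only: y_def[abs_def] image_image)
    thus "range y = {u. 0 < u \<and> bessel_phi \<nu> (u\<^sup>2) = 0}" using J Gam unfolding assms(5) by auto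
  qed (rule nu)
  interpret bessel_zeros \<nu> y by (rule bz)
  obtain N where "wiener_bridge M B X \<alpha> T N" using wiener_bridge_intro[OF assms(6,7,1,2)] by blast
  then interpret W: wiener_bridge M B X \<alpha> T N .
  obtain h where "wiener_bridge_expansion M B X \<alpha> T N h (\<lambda>k. T\<^sup>2 / (y k)\<^sup>2)"
    using W.bessel_expansion[OF bz assms(3)] by blast
  then interpret E: wiener_bridge_expansion M B X \<alpha> T N h "\<lambda>k. T\<^sup>2 / (y k)\<^sup>2" .
  define c where "c = x / (2 * T\<^sup>2)"
  have c: "0 < c" using assms by (simp add: c_def)
  define p where "p = measure (completion M) {\<omega> \<in> space M. (\<integral>\<^sup>+t\<in>{0..T}. ennreal ((X t \<omega>)\<^sup>2) \<partial>lborel) > ennreal x}"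
  have "p = 2 / pi * (\<Sum>k. (-1) ^ k * lim_int (x / (2 * T\<^sup>2)) k)"
  proof (rule smirnov_series[where S="\<lambda>n \<omega>. \<Sum>k<n. (E.\<zeta> k \<omega>)\<^sup>2"])
    show "prob_space M" by unfold_locales
    show "(\<lambda>n. measure M {\<omega> \<in> space M. x < (\<Sum>k<n. (E.\<zeta> k \<omega>)\<^sup>2)}) \<longlonglongrightarrow> p"
      using E.Q_tail[of x] W.completion_tail[of x] assms(8) by (simp add: p_def)
    show "(LINT \<omega>|M. exp (- s * (\<Sum>k<n. (E.\<zeta> k \<omega>)\<^sup>2))) = (\<Prod>k<n. 1 / sqrt (1 + 2 * s * (T\<^sup>2 / (y k)\<^sup>2)))" if "0 \<le> s" for n s
      by (rule E.\<zeta>_laplace[OF that])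
  qed (use assms in \<open>auto intro!: sum_nonneg\<close>)
  hence p: "p = 2 / pi * (\<Sum>k. (-1) ^ k * lim_int c k)" by (simp only: c_def)
  define f where "f u = u powr (\<nu> / 2 - 1) * (exp (- x * u\<^sup>2 / (2 * T\<^sup>2)) / sqrt \<bar>bessel_J \<nu> u\<bar>)" for u
  \<comment> \<open>The constant in sqrt |J_\<nu>(u)| = (u^(\<nu>/2) / K) sqrt |phi|, read off from
    the normalisation of the Bessel function. Its product with the prefactor of the theorem is 2 /
    pi.\<close>
  define K where "K = 2 powr (\<nu> / 2) * sqrt (Gamma (\<nu> + 1))"
  have f: "f u = K * (exp (- c * u\<^sup>2) / (u * sqrt \<bar>bessel_phi \<nu> (u\<^sup>2)\<bar>))" if u: "0 < u" for u
  proof -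
    have "sqrt \<bar>bessel_J \<nu> u\<bar> = sqrt ((u / 2) powr \<nu>) / sqrt (Gamma (\<nu> + 1)) * sqrt \<bar>bessel_phi \<nu> (u\<^sup>2)\<bar>"
      unfolding J[OF u] using Gam by (simp add: abs_mult real_sqrt_mult real_sqrt_divide)
    also have "sqrt ((u / 2) powr \<nu>) = u powr (\<nu> / 2) / 2 powr (\<nu> / 2)"
      using u by (simp add: powr_half_sqrt[symmetric] powr_powr powr_divide)
    finally have s: "sqrt \<bar>bessel_J \<nu> u\<bar> = u powr (\<nu> / 2) / K * sqrt \<bar>bessel_phi \<nu> (u\<^sup>2)\<bar>" by (simp add: K_def)
    have e: "- x * u\<^sup>2 / (2 * T\<^sup>2) = - c * u\<^sup>2" by (simp add: c_def)
    have "u powr (\<nu> / 2 - 1) = u powr (\<nu> / 2) / u" using u by (simp add: powr_diff)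
    thus ?thesis unfolding f_def s e using u by (simp add: mult_ac)
  qed
  have zy: "{z (2 * Suc j - 1)..z (2 * Suc j)} = {y (2 * j)..y (Suc (2 * j))}" for j by (simp add: y_def)
  \<comment> \<open>The formula for f requires u > 0; the indicator restricts to such u, since the
    zeros are positive.\<close>
  have find: "indicator {y (2 * j)..y (Suc (2 * j))} u *\<^sub>R f u =
      K * (indicator {y (2 * j)..y (Suc (2 * j))} u *\<^sub>R (exp (- c * u\<^sup>2) / (u * sqrt \<bar>bessel_phi \<nu> (u\<^sup>2)\<bar>)))" for j u
    using z_pos[of "2 * j"] f[of u] by (auto simp: indicator_def)
  have int: "set_integrable lborel {z (2 * Suc j - 1)..z (2 * Suc j)} f" for j
    using integrand_integrable[of c "2 * j"] c unfolding zy set_integrable_def find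
    by (intro integrable_mult_right) simp
  have val: "(LBINT u:{z (2 * Suc j - 1)..z (2 * Suc j)}. f u) = K * lim_int c j" for j
    unfolding zy set_lebesgue_integral_def find lim_int_def by (rule integral_mult_right_zero)
  define a where "a k = (-1) ^ (k + 1) * (LBINT u:{z (2 * k - 1)..z (2 * k)}. f u)" for k :: nat
  have a: "a (Suc j) = K * ((-1) ^ j * lim_int c j)" for j
    unfolding a_def val by simp
  have "summable (\<lambda>j. a (Suc j))" unfolding a by (intro summable_mult alternating_sum_tendsto(1) c)
  moreover have "p = 2 powr (1 - \<nu> / 2) / (pi * sqrt (Gamma (\<nu> + 1))) * (\<Sum>j. a (Suc j))"
  proof -
    have "(\<Sum>j. a (Suc j)) = K * (\<Sum>k. (-1) ^ k * lim_int c k)"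
      unfolding a by (rule suminf_mult[OF alternating_sum_tendsto(1)[OF c]])
    moreover have "2 powr (1 - \<nu> / 2) / (pi * sqrt (Gamma (\<nu> + 1))) * K = 2 / pi"
      using Gam by (simp add: K_def powr_diff)
    ultimately show ?thesis using p by (simp only: mult.assoc[symmetric])
  qed
  moreover have "set_integrable lborel {z (2 * k - 1)..z (2 * k)} f" if "1 \<le> k" for k
    using int[of "k - 1"] that by simp
  ultimately show ?thesis unfolding Let_def p_def a_def f_def[abs_def] by blast
qed

end
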